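(* For all $q\ge 2$, $\mathcal{EP}$ is undecidable in the free nilpotent group $N(2,q)$; that is, there is no algorithm which, given any finite system of equations in $N(2,q)$, decides whether the system has a solution in $N(2,q)$. In particular, $\mathcal{EP}$ is undecidable in the Heisenberg group $H(\mathbb{Z})$.
   Context: Commutators: $[a,b]$ is the usual commutator, and nested commutators are left-normed: $[a,b,c]=[[a,b],c]$, and so on. $N(p,q)=F_q/H_{p+1}$ is the free nilpotent group of step $p$ and rank $q$ (with $p,q\ge 2$), where $F_q$ is the free group on $q$ generators and $H_i$ is its lower central series, $H_1=F_q$, $H_{i+1}=[H_i,F_q]$. $H(\mathbb{Z})=\langle a,b : [a,b,a],[a,b,b]\rangle$ is the discrete Heisenberg group, and $H(\mathbb{Z})=N(2,2)$. An equation in a group $G$ is an expression $w=1$, where $w$ is a word written as a product of constants (fixed elements of $G$, given as words in a fixed finite generating set) and variables and their inverses. A solution of a system of equations is an assignment of elements of $G$ to the variables satisfying all equations of the system simultaneously. $\mathcal{EP}$ in $G$ is the decision problem of determining, for a given finite system of equations in any finite number of variables, whether it has a solution in $G$. The group $G$ is fixed and the system is the input. *)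

theory Defs
  imports "HOL-Algebra.Algebra" "HOL-Library.Nat_Bijection"
begin

section \<open>Partial recursive functions\<close>

datatype recf =
    Zero
  | Succ
  | Proj nat
  | Comp recf "recf list"
  | PrimRec recf recf
  | Mu recf

text \<open>
  \<open>computes f xs y\<close>: the partial recursive function described by \<open>f\<close> is defined on the
  argument tuple \<open>xs\<close> and has the value \<open>y\<close> there.  The rule \<open>mu\<close> requires \<open>f\<close> to be defined
  (and nonzero) at all smaller arguments.
\<close>

inductive computes :: "recf \<Rightarrow> nat list \<Rightarrow> nat \<Rightarrow> bool" where
  zero: "computes Zero xs 0"
| succ: "computes Succ [x] (Suc x)"
| proj: "i < length xs \<Longrightarrow> computes (Proj i) xs (xs ! i)"
| comp: "list_all2 (\<lambda>g y. computes g xs y) gs ys \<Longrightarrow> computes f ys z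
         \<Longrightarrow> computes (Comp f gs) xs z"
| prim_0: "computes f xs y \<Longrightarrow> computes (PrimRec f g) (0 # xs) y"
| prim_Suc: "computes (PrimRec f g) (n # xs) y \<Longrightarrow> computes g (n # y # xs) z
         \<Longrightarrow> computes (PrimRec f g) (Suc n # xs) z"
| mu: "computes f (n # xs) 0 \<Longrightarrow> (\<And>m. m < n \<Longrightarrow> \<exists>k>0. computes f (m # xs) k)
         \<Longrightarrow> computes (Mu f) xs n"

inductive_cases computes_elims:
  "computes Zero xs y"
  "computes Succ xs y"
  "computes (Proj i) xs y"
  "computes (Comp f gs) xs y"
  "computes (PrimRec f g) (0 # xs) y"
  "computes (PrimRec f g) (Suc n # xs) y"
  "computes (Mu f) xs y"

lemma computes_deterministic:
  "computes f xs y \<Longrightarrow> computes f xs z \<Longrightarrow> y = z"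
proof (induction f xs y arbitrary: z rule: computes.induct)
  case (comp xs gs ys f w)
  from comp.prems obtain ys' where ys': "list_all2 (\<lambda>g y. computes g xs y) gs ys'"
    and f: "computes f ys' z"
    by (rule computes_elims)
  have len: "length ys = length gs" "length ys' = length gs"
    using comp.IH(1) ys' by (auto dest: list_all2_lengthD)
  have "ys ! i = ys' ! i" if "i < length gs" for i
  proof -
    have "\<forall>x. computes (gs ! i) xs x \<longrightarrow> ys ! i = x"
      using list_all2_nthD[OF comp.IH(1) that] by (rule conjunct2)
    moreover have "computes (gs ! i) xs (ys' ! i)"
      using list_all2_nthD[OF ys' that] .
    ultimately show ?thesis by blast
  qed
  then have "ys = ys'" using len by (intro nth_equalityI) simp_all
  with f have "computes f ys z" by simp
  then show ?case by (rule comp.IH(2))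
next
  case (prim_Suc f g n xs y w)
  from prim_Suc.prems obtain y' where y': "computes (PrimRec f g) (n # xs) y'"
    and z: "computes g (n # y' # xs) z"
    by (rule computes_elims)
  from prim_Suc.IH(1)[OF y'] z have "computes g (n # y # xs) z" by simp
  then show ?case by (rule prim_Suc.IH(2))
next
  case (mu f n xs)
  from mu.prems have z: "computes f (z # xs) 0"
    by (rule computes_elims)
  have below: "\<exists>k>0. computes f (m # xs) k" if "m < z" for m
    using mu.prems by (rule computes_elims) (use that in blast)
  have "\<not> z < n"
  proof
    assume "z < n"
    then obtain k where "k > 0" and k: "\<forall>x. computes f (z # xs) x \<longrightarrow> k = x"
      using mu.IH(2) by blast
    with z show False by blast
  qed
  moreover have "\<not> n < z"
  proof
    assume "n < z"
    then obtain k where "k > 0" and k: "computes f (n # xs) k"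
      using below by blast
    with mu.IH(1)[OF k] show False by simp
  qed
  ultimately show ?case by simp
next
  case (prim_0 f xs y g)
  from prim_0.prems have "computes f xs z" by (rule computes_elims)
  then show ?case by (rule prim_0.IH)
next
  case (succ x)
  then show ?case by (auto elim: computes_elims(2))
next
  case (proj i xs)
  then show ?case by (auto elim: computes_elims(3))
next
  case (zero xs)
  then show ?case by (auto elim: computes_elims(1))
qed

text \<open>
  The inputs of a decision problem are the elements of \<open>D\<close>, presented through their codes;
  nothing is required of the algorithm on numbers that are not codes of inputs.
\<close>

definition decidable :: "('i \<Rightarrow> nat) \<Rightarrow> 'i set \<Rightarrow> ('i \<Rightarrow> bool) \<Rightarrow> bool" where
  "decidable code D P \<longleftrightarrow>
     (\<exists>f. \<forall>x\<in>D. computes f [code x] (if P x then 1 else 0))"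


section \<open>Group words and systems of equations\<close>

text \<open>The letter \<open>(x, True)\<close> stands for \<open>x\<close>, the letter \<open>(x, False)\<close> for its inverse.\<close>

type_synonym 'x word = "('x \<times> bool) list"

primrec word_value :: "('a, 'm) monoid_scheme \<Rightarrow> ('x \<Rightarrow> 'a) \<Rightarrow> 'x word \<Rightarrow> 'a" where
  "word_value G v [] = \<one>\<^bsub>G\<^esub>"
| "word_value G v (l # w) =
     (if snd l then v (fst l) else inv\<^bsub>G\<^esub> (v (fst l))) \<otimes>\<^bsub>G\<^esub> word_value G v w"

text \<open>
  \<open>Inl i\<close> is the \<open>i\<close>-th element of a fixed list of generators, \<open>Inr j\<close> is the \<open>j\<close>-th variable.
  The word \<open>w\<close> represents the equation \<open>w = 1\<close>, and a list of words a system.  A constant of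
  the group enters an equation as a word in the generators.
\<close>

type_synonym equation = "(nat + nat) word"

definition systems :: "nat \<Rightarrow> equation list set" where
  "systems k = {S. \<forall>w\<in>set S. \<forall>i e. (Inl i, e) \<in> set w \<longrightarrow> i < k}"

definition solvable_system :: "('a, 'm) monoid_scheme \<Rightarrow> 'a list \<Rightarrow> equation list \<Rightarrow> bool" where
  "solvable_system G gs S \<longleftrightarrow>
     (\<exists>\<sigma>. (\<forall>j. \<sigma> j \<in> carrier G) \<and>
          (\<forall>w\<in>set S. word_value G (case_sum (\<lambda>i. gs ! i) \<sigma>) w = \<one>\<^bsub>G\<^esub>))"

definition letter_code :: "(nat + nat) \<times> bool \<Rightarrow> nat" where
  "letter_code l = prod_encode (sum_encode (fst l), of_bool (snd l))"

definition system_code :: "equation list \<Rightarrow> nat" where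
  "system_code S = list_encode (map (\<lambda>w. list_encode (map letter_code w)) S)"

lemma inj_system_code: "inj system_code"
proof -
  have "inj letter_code"
    by (auto simp: inj_def letter_code_def sum_encode_eq)
  then show ?thesis
    unfolding inj_def system_code_def
    by (metis (no_types, lifting) injI inj_map_eq_map list_encode_inverse)
qed

definition EP_decidable :: "('a, 'm) monoid_scheme \<Rightarrow> 'a list \<Rightarrow> bool" where
  "EP_decidable G gs \<longleftrightarrow>
     decidable system_code (systems (length gs)) (solvable_system G gs)"

definition generating_list :: "('a, 'm) monoid_scheme \<Rightarrow> 'a list \<Rightarrow> bool" where
  "generating_list G gs \<longleftrightarrow> set gs \<subseteq> carrier G \<and> generate G (set gs) = carrier G"


section \<open>Free groups\<close>

definition words :: "nat \<Rightarrow> nat word set" where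
  "words q = {w. fst ` set w \<subseteq> {..<q}}"

inductive cancels :: "nat word \<Rightarrow> nat word \<Rightarrow> bool" where
  "cancels (u @ [(i, e), (i, \<not> e)] @ v) (u @ v)"

definition free_rel :: "nat \<Rightarrow> nat word rel" where
  "free_rel q = {(u, v). u \<in> words q \<and> v \<in> words q \<and> equivclp cancels u v}"

definition free_group :: "nat \<Rightarrow> nat word set monoid" where
  "free_group q =
     \<lparr>carrier = words q // free_rel q,
      monoid.mult = (\<lambda>A B. \<Union>u\<in>A. \<Union>v\<in>B. free_rel q `` {u @ v}),
      monoid.one = free_rel q `` {[]}\<rparr>"

definition free_gen :: "nat \<Rightarrow> nat \<Rightarrow> nat word set" where
  "free_gen q i = free_rel q `` {[(i, True)]}"

lemma words_simps [simp]:
  "[] \<in> words q"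
  "l # w \<in> words q \<longleftrightarrow> fst l < q \<and> w \<in> words q"
  "u @ v \<in> words q \<longleftrightarrow> u \<in> words q \<and> v \<in> words q"
  by (auto simp: words_def)

lemma equiv_free_rel: "equiv (words q) (free_rel q)"
proof (rule equivI)
  show "free_rel q \<subseteq> words q \<times> words q" by (auto simp: free_rel_def)
  show "refl_on (words q) (free_rel q)" by (auto simp: free_rel_def refl_on_def equivclp_def)
  show "sym (free_rel q)" by (auto simp: free_rel_def sym_def intro: equivclp_sym)
  show "trans (free_rel q)"
    by (auto simp: free_rel_def trans_def intro: transpD[OF transp_equivclp])
qed

lemma cancels_append: "cancels u v \<Longrightarrow> cancels (x @ u @ y) (x @ v @ y)"
proof (induction rule: cancels.induct)
  case (1 u i e v)
  show ?case using cancels.intros[of "x @ u" i e "v @ y"] by simp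
qed

lemma equivclp_cancels_append: "equivclp cancels u v \<Longrightarrow> equivclp cancels (x @ u @ y) (x @ v @ y)"
proof (induction rule: equivclp_induct)
  case base
  show ?case by (simp add: equivclp_def)
next
  case (step v w)
  from step.hyps(2) have "equivclp cancels (x @ v @ y) (x @ w @ y)"
    using cancels_append[of v w x y] cancels_append[of w v x y]
    by (meson equivclp_sym r_into_equivclp)
  with step.IH show ?case by (rule transpD[OF transp_equivclp])
qed

lemma free_rel_append:
  assumes "(u, u') \<in> free_rel q" "(v, v') \<in> free_rel q"
  shows "(u @ v, u' @ v') \<in> free_rel q"
proof -
  have "equivclp cancels (u @ v) (u' @ v)"
    using equivclp_cancels_append[of u u' "[]" v] assms by (simp add: free_rel_def)
  moreover have "equivclp cancels (u' @ v) (u' @ v')"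
    using equivclp_cancels_append[of v v' u' "[]"] assms by (simp add: free_rel_def)
  ultimately show ?thesis
    using assms by (auto simp: free_rel_def intro: transpD[OF transp_equivclp])
qed

lemma free_group_mult [simp]:
  assumes "u \<in> words q" "v \<in> words q"
  shows "free_rel q `` {u} \<otimes>\<^bsub>free_group q\<^esub> free_rel q `` {v} = free_rel q `` {u @ v}"
proof -
  have "congruent2 (free_rel q) (free_rel q) (\<lambda>u v. free_rel q `` {u @ v})"
    by (rule congruent2I')
       (auto intro!: equiv_class_eq[OF equiv_free_rel] free_rel_append)
  with assms show ?thesis
    by (simp add: free_group_def UN_equiv_class2[OF equiv_free_rel equiv_free_rel])
qed

lemma free_group_carrier_cases:
  assumes "x \<in> carrier (free_group q)"
  obtains u where "u \<in> words q" "x = free_rel q `` {u}"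
  using assms by (auto simp: free_group_def elim: quotientE)

lemma free_group_carrierI [simp]: "u \<in> words q \<Longrightarrow> free_rel q `` {u} \<in> carrier (free_group q)"
  by (simp add: free_group_def quotientI)

lemma free_group_one: "\<one>\<^bsub>free_group q\<^esub> = free_rel q `` {[]}"
  by (simp add: free_group_def)

lemma free_rel_cancel: "i < q \<Longrightarrow> free_rel q `` {[(i, e), (i, \<not> e)]} = free_rel q `` {[]}"
  using cancels.intros[of "[]" i e "[]"]
  by (intro equiv_class_eq[OF equiv_free_rel]) (auto simp: free_rel_def intro: r_into_equivclp)

lemma free_group_left_inverse:
  "u \<in> words q \<Longrightarrow> \<exists>v\<in>words q. free_rel q `` {v @ u} = free_rel q `` {[]}"
proof (induction u)
  case Nil
  show ?case by (rule bexI[of _ "[]"]) auto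
next
  case (Cons l u)
  then obtain v where v: "v \<in> words q" "free_rel q `` {v @ u} = free_rel q `` {[]}" by auto
  obtain i e where l: "l = (i, e)" by fastforce
  have i: "i < q" using Cons.prems l by simp
  have "free_rel q `` {(v @ [(i, \<not> e)]) @ l # u} =
        free_rel q `` {v} \<otimes>\<^bsub>free_group q\<^esub>
          (free_rel q `` {[(i, \<not> e), (i, \<not> \<not> e)]} \<otimes>\<^bsub>free_group q\<^esub> free_rel q `` {u})"
    using Cons.prems v i l by simp
  also have "\<dots> = free_rel q `` {[]}"
    unfolding free_rel_cancel[OF i] using Cons.prems v by simp
  finally show ?case
    using v i by (intro bexI[of _ "v @ [(i, \<not> e)]"]) auto
qed

lemma group_free_group: "group (free_group q)"
proof (rule groupI)
  fix x assume "x \<in> carrier (free_group q)"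
  then obtain u where "u \<in> words q" "x = free_rel q `` {u}" by (rule free_group_carrier_cases)
  moreover from this obtain v where "v \<in> words q" "free_rel q `` {v @ u} = free_rel q `` {[]}"
    using free_group_left_inverse by blast
  ultimately show "\<exists>y\<in>carrier (free_group q). y \<otimes>\<^bsub>free_group q\<^esub> x = \<one>\<^bsub>free_group q\<^esub>"
    by (intro bexI[of _ "free_rel q `` {v}"]) (simp_all add: free_group_one)
qed (auto simp: free_group_one elim!: free_group_carrier_cases)

lemma generate_free_group: "generate (free_group q) (free_gen q ` {..<q}) = carrier (free_group q)"
proof
  interpret F: group "free_group q" by (rule group_free_group)
  have gens: "free_gen q ` {..<q} \<subseteq> carrier (free_group q)" by (auto simp: free_gen_def)
  then show "generate (free_group q) (free_gen q ` {..<q}) \<subseteq> carrier (free_group q)"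
    by (rule F.generate_incl)
  show "carrier (free_group q) \<subseteq> generate (free_group q) (free_gen q ` {..<q})"
  proof
    fix x assume "x \<in> carrier (free_group q)"
    then obtain u where "u \<in> words q" "x = free_rel q `` {u}" by (rule free_group_carrier_cases)
    then show "x \<in> generate (free_group q) (free_gen q ` {..<q})"
    proof (induction u arbitrary: x)
      case Nil
      then show ?case using generate.one[of "free_group q"] by (simp add: free_group_one)
    next
      case (Cons l u)
      obtain i e where l: "l = (i, e)" by fastforce
      have i: "i < q" using Cons.prems l by simp
      have "free_rel q `` {[(i, False)]} = inv\<^bsub>free_group q\<^esub> (free_gen q i)"
        using free_rel_cancel[OF i, of False] i
        by (intro F.inv_equality[symmetric]) (auto simp: free_gen_def free_group_one)
      then have "free_rel q `` {[l]} \<in> generate (free_group q) (free_gen q ` {..<q})"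
        using i l by (cases e) (auto simp: free_gen_def intro: generate.incl generate.inv)
      moreover have "x = free_rel q `` {[l]} \<otimes>\<^bsub>free_group q\<^esub> free_rel q `` {u}"
        using Cons.prems i l by simp
      moreover have "free_rel q `` {u} \<in> generate (free_group q) (free_gen q ` {..<q})"
        using Cons.prems by (intro Cons.IH) simp_all
      ultimately show ?case by (simp add: generate.eng)
    qed
  qed
qed


section \<open>Lower central series, free nilpotent groups, the Heisenberg group\<close>

definition commutator :: "('a, 'm) monoid_scheme \<Rightarrow> 'a \<Rightarrow> 'a \<Rightarrow> 'a" where
  "commutator G x y = x \<otimes>\<^bsub>G\<^esub> y \<otimes>\<^bsub>G\<^esub> inv\<^bsub>G\<^esub> x \<otimes>\<^bsub>G\<^esub> inv\<^bsub>G\<^esub> y"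

text \<open>
  Indexing starts at \<open>0\<close>: \<open>lower_central G i\<close> is the term of the lower central series
  usually numbered \<open>i + 1\<close>.
\<close>

primrec lower_central :: "('a, 'm) monoid_scheme \<Rightarrow> nat \<Rightarrow> 'a set" where
  "lower_central G 0 = carrier G"
| "lower_central G (Suc i) =
     generate G {commutator G x y | x y. x \<in> lower_central G i \<and> y \<in> carrier G}"

definition free_nilpotent :: "nat \<Rightarrow> nat \<Rightarrow> nat word set set monoid" where
  "free_nilpotent p q = free_group q Mod lower_central (free_group q) p"

definition normal_closure :: "('a, 'm) monoid_scheme \<Rightarrow> 'a set \<Rightarrow> 'a set" where
  "normal_closure G R =
     generate G {g \<otimes>\<^bsub>G\<^esub> r \<otimes>\<^bsub>G\<^esub> inv\<^bsub>G\<^esub> g | g r. g \<in> carrier G \<and> r \<in> R}"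

definition heisenberg :: "nat word set set monoid" where
  "heisenberg =
     (let F = free_group 2; a = free_gen 2 0; b = free_gen 2 1; c = commutator F a b
      in F Mod normal_closure F {commutator F c a, commutator F c b})"

lemma (in group) conj_commutator:
  assumes "g \<in> carrier G" "x \<in> carrier G" "y \<in> carrier G"
  shows "g \<otimes> commutator G x y \<otimes> inv g = commutator G (g \<otimes> x \<otimes> inv g) (g \<otimes> y \<otimes> inv g)"
proof -
  have cancel: "inv g \<otimes> (g \<otimes> z) = z" if "z \<in> carrier G" for z
    using assms that by (simp add: m_assoc[symmetric])
  show ?thesis
    using assms by (simp add: commutator_def m_assoc inv_mult_group cancel)
qed

lemma (in group) lower_central_normal: "lower_central G i \<lhd> G"
proof (induction i)
  case 0
  show ?case by (simp add: normal_inv_iff subgroup_self)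
next
  case (Suc i)
  interpret N: normal "lower_central G i" G by (rule Suc)
  show ?case unfolding lower_central.simps
  proof (rule normal_generateI, goal_cases)
    case 1
    show ?case by (auto simp: commutator_def)
  next
    case (2 s g)
    then obtain x y where "x \<in> lower_central G i" "y \<in> carrier G" "s = commutator G x y" by auto
    with 2(2) have "g \<otimes> s \<otimes> inv g = commutator G (g \<otimes> x \<otimes> inv g) (g \<otimes> y \<otimes> inv g)"
      and "g \<otimes> x \<otimes> inv g \<in> lower_central G i" "g \<otimes> y \<otimes> inv g \<in> carrier G"
      by (simp_all add: conj_commutator N.inv_op_closed2)
    then show ?case by blast
  qed
qed

lemma (in group) normal_closure_normal:
  assumes "R \<subseteq> carrier G"
  shows "normal_closure G R \<lhd> G"
  unfolding normal_closure_def
proof (rule normal_generateI, goal_cases)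
  case 1
  show ?case using assms by auto
next
  case (2 s g)
  then obtain h r where h: "h \<in> carrier G" "r \<in> R" "s = h \<otimes> r \<otimes> inv h" by auto
  then have "g \<otimes> s \<otimes> inv g = (g \<otimes> h) \<otimes> r \<otimes> inv (g \<otimes> h)"
    using 2(2) assms by (auto simp: m_assoc inv_mult_group subset_iff)
  then show ?case using h 2(2) by blast
qed

lemma group_free_nilpotent: "group (free_nilpotent p q)"
  unfolding free_nilpotent_def
  by (intro normal.factorgroup_is_group group.lower_central_normal group_free_group)

lemma free_gen_carrier: "i < q \<Longrightarrow> free_gen q i \<in> carrier (free_group q)"
  by (simp add: free_gen_def)

lemma group_heisenberg: "group heisenberg"
proof -
  interpret F: group "free_group 2" by (rule group_free_group)
  show ?thesis unfolding heisenberg_def Let_def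
    by (intro normal.factorgroup_is_group F.normal_closure_normal)
       (auto simp: commutator_def free_gen_carrier)
qed

lemma (in normal) generating_list_Mod:
  assumes "generating_list G gs"
  shows "generating_list (G Mod H) (map (\<lambda>g. H #> g) gs)"
proof -
  interpret Q: group "G Mod H" by (rule factorgroup_is_group)
  interpret h: group_hom G "G Mod H" "\<lambda>g. H #> g"
    by unfold_locales (rule r_coset_hom_Mod)
  have "generate (G Mod H) ((\<lambda>g. H #> g) ` set gs) = (\<lambda>g. H #> g) ` carrier G"
    using h.generate_img[of "set gs"] assms by (simp add: generating_list_def)
  also have "\<dots> = carrier (G Mod H)"
    by (auto simp: FactGroup_def RCOSETS_def)
  finally show ?thesis
    using assms by (auto simp: generating_list_def)
qed

lemma generating_list_free_group: "generating_list (free_group q) (map (free_gen q) [0..<q])"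
proof -
  have "set (map (free_gen q) [0..<q]) = free_gen q ` {..<q}" by auto
  then show ?thesis
    unfolding generating_list_def by (auto simp: generate_free_group free_gen_carrier)
qed

lemma generating_list_free_nilpotent: "\<exists>gs. generating_list (free_nilpotent p q) gs"
  unfolding free_nilpotent_def
  using normal.generating_list_Mod[OF group.lower_central_normal[OF group_free_group]
      generating_list_free_group] by blast

lemma generating_list_heisenberg: "\<exists>gs. generating_list heisenberg gs"
proof -
  interpret F: group "free_group 2" by (rule group_free_group)
  show ?thesis unfolding heisenberg_def Let_def
    by (rule exI, rule normal.generating_list_Mod[OF F.normal_closure_normal
          generating_list_free_group])
       (auto simp: commutator_def free_gen_carrier)
qed

end

theory Submission
  imports Defs "HOL-Number_Theory.Cong"
begin

text \<open>
  Integers \<open>n\<close> are encoded by elements that commute like \<open>a\<^sup>n\<close> and \<open>b\<^sup>n\<close>.  Since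
  \<open>[a\<^sup>m, b\<^sup>n] = [a, b]\<^sup>m\<^sup>n\<close>, systems over the group express addition and multiplication, and
  homomorphisms to and from the group of integral unitriangular matrices, matching \<open>a\<close> and \<open>b\<close>,
  show that they express nothing more.  So it remains to prove that Diophantine systems over the integers
  cannot be decided.  The class of existentially definable predicates over the naturals contains
  exponentiation (Pell equations), hence binomial coefficients and factorials, hence is closed under
  bounded universal quantification; so it contains the graph of every partial recursive function.
  If \<open>f\<close> decided solvability, then ``\<open>f\<close> rejects the system with code \<open>e\<close> applied to its own code
  \<open>e\<close>'' would be expressed by a system in the parameter \<open>e\<close>, and taking for \<open>e\<close> the code of that very
  system gives a contradiction.  No universal machine is needed.
\<close>

section \<open>Diophantine predicates\<close>

text \<open>The diagonal step dictates how a parameter enters a system. If n were spread over the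
  equations, the code of an instance would be an awkward function of n. Here n occurs in a single
  equation a^n x^-1 = 1, put in front of a list of equations that do not mention n. The code of the
  instance is then a function of n and of the code e of the remaining list, and this function is
  definable because it iterates a pairing function, once per copy of a. The number fed back is the
  code e of the remaining list, fixed before n is chosen; the instance with n = e speaks about its
  own code. Solvability is existential and positive. This is why homomorphisms carry solutions along
  without any knowledge of centralizers in the group. It is also why the predicates below are built
  only by conjunction, existential quantification and bounded universal quantification: inequalities
  and nonvanishing have to be rephrased as solvability statements.\<close>

datatype 'x atom = Is_One 'x | Is_Sum 'x 'x 'x | Is_Prod 'x 'x 'x

text \<open>There is no atom for 0 and none for equality: by cancellation z + z = z says z = 0, and
  then z + x = y says x = y. The type class covers both the naturals, where the recursion theory
  takes place, and the integers, which the group encodes.\<close>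

primrec holds :: "('x \<Rightarrow> 'a::comm_semiring_1_cancel) \<Rightarrow> 'x atom \<Rightarrow> bool" where
  "holds v (Is_One x) \<longleftrightarrow> v x = 1"
| "holds v (Is_Sum x y z) \<longleftrightarrow> v x + v y = v z"
| "holds v (Is_Prod x y z) \<longleftrightarrow> v x * v y = v z"

lemma holds_map_atom: "holds v (map_atom f A) \<longleftrightarrow> holds (v \<circ> f) A"
  by (cases A) simp_all

definition dioph :: "((nat \<Rightarrow> 'a::comm_semiring_1_cancel) \<Rightarrow> bool) \<Rightarrow> bool" where
  "dioph R \<longleftrightarrow> (\<exists>E :: (nat + nat) atom list. \<forall>v. R v \<longleftrightarrow> (\<exists>u. \<forall>A\<in>set E. holds (case_sum v u) A))"

text \<open>The graph of \<open>F\<close> has its value in variable \<open>0\<close> and the arguments shifted by one.\<close>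

definition dfun :: "((nat \<Rightarrow> 'a::comm_semiring_1_cancel) \<Rightarrow> 'a) \<Rightarrow> bool" where
  "dfun F \<longleftrightarrow> dioph (\<lambda>w. F (\<lambda>i. w (Suc i)) = w 0)"

lemma diophI:
  fixes E :: "(nat + nat) atom list"
  assumes "\<And>v. R v \<longleftrightarrow> (\<exists>u. \<forall>A\<in>set E. holds (case_sum v u) A)"
  shows "dioph R"
  using assms unfolding dioph_def by blast

lemma diophE:
  assumes "dioph R"
  obtains E :: "(nat + nat) atom list"
    where "\<And>v. R v \<longleftrightarrow> (\<exists>u. \<forall>A\<in>set E. holds (case_sum v u) A)"
  using assms unfolding dioph_def by blast

lemma dioph_rename:
  assumes "dioph R"
  shows "dioph (\<lambda>v. R (\<lambda>i. v (f i)))"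
proof -
  obtain E :: "(nat + nat) atom list" where E: "\<And>v. R v \<longleftrightarrow> (\<exists>u. \<forall>A\<in>set E. holds (case_sum v u) A)"
    using assms by (rule diophE) (rule that)
  have "case_sum v u \<circ> map_sum f id = case_sum (\<lambda>i. v (f i)) u" for v u :: "nat \<Rightarrow> 'a"
    by (auto simp: fun_eq_iff split: sum.split)
  then show ?thesis
    by (intro diophI[of _ "map (map_atom (map_sum f id)) E"]) (simp add: E holds_map_atom)
qed

text \<open>Quantifies over a whole sequence of unknowns at once, for use when their number depends
  on a list of atoms or of component functions. Parameters and unknowns are interleaved at even and
  odd positions.\<close>

lemma dioph_exfun:
  assumes "dioph (\<lambda>w. P (\<lambda>i. w (2 * i)) (\<lambda>i. w (2 * i + 1)))"
  shows "dioph (\<lambda>v. \<exists>a. P v a)"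
proof -
  obtain E :: "(nat + nat) atom list" where E: "\<And>w. P (\<lambda>i. w (2 * i)) (\<lambda>i. w (2 * i + 1))
      \<longleftrightarrow> (\<exists>u. \<forall>A\<in>set E. holds (case_sum w u) A)"
    using assms by (rule diophE) (rule that)
  \<comment> \<open>Odd positions stop being parameters and become witnesses at even indices; the
    old witnesses move to odd indices.\<close>
  define g where "g = case_sum (\<lambda>i. if even i then Inl (i div 2) else Inr (2 * (i div 2)))
    (\<lambda>j. Inr (2 * j + 1) :: nat + nat)"
  have P: "P v a \<longleftrightarrow> (\<exists>u. \<forall>A\<in>set E. holds (case_sum
    (\<lambda>i. if even i then v (i div 2) else a (i div 2)) u) A)" for v a
    using E[of "\<lambda>i. if even i then v (i div 2) else a (i div 2)"] by simp
  have "(\<exists>a. P v a) \<longleftrightarrow> (\<exists>u. \<forall>A\<in>set E. holds (case_sum v u \<circ> g) A)" for v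
  proof
    assume "\<exists>a. P v a"
    then obtain a u where *: "\<forall>A\<in>set E. holds (case_sum
        (\<lambda>i. if even i then v (i div 2) else a (i div 2)) u) A"
      unfolding P by blast
    define u' where "u' = (\<lambda>i. if even i then a (i div 2) else u (i div 2))"
    have "case_sum v u' \<circ> g = case_sum (\<lambda>i. if even i then v (i div 2) else a (i div 2)) u"
      by (auto simp: fun_eq_iff g_def u'_def split: sum.split elim!: oddE)
    with * show "\<exists>u. \<forall>A\<in>set E. holds (case_sum v u \<circ> g) A" by metis
  next
    assume "\<exists>u. \<forall>A\<in>set E. holds (case_sum v u \<circ> g) A"
    then obtain u where *: "\<forall>A\<in>set E. holds (case_sum v u \<circ> g) A" by blast
    have "case_sum v u \<circ> g = case_sum (\<lambda>i. if even i then v (i div 2) else u (2 * (i div 2)))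
        (\<lambda>j. u (2 * j + 1))"
      by (auto simp: fun_eq_iff g_def split: sum.split)
    with * have "P v (\<lambda>i. u (2 * i))" unfolding P by auto
    then show "\<exists>a. P v a" by blast
  qed
  then show ?thesis
    by (intro diophI[of _ "map (map_atom g) E"]) (simp add: holds_map_atom)
qed

lemma dioph_ex:
  assumes "dioph (\<lambda>w. P (\<lambda>i. w (Suc i)) (w 0))"
  shows "dioph (\<lambda>v. \<exists>n. P v n)"
proof -
  have "dioph (\<lambda>v. \<exists>a. P v (a (0::nat)))"
    using dioph_rename[OF assms, of "case_nat 1 (\<lambda>i. 2 * i)"] by (intro dioph_exfun) simp
  moreover have "(\<exists>a. P v (a (0::nat))) \<longleftrightarrow> (\<exists>n. P v n)" for v
    by (auto intro: exI[of _ "\<lambda>_. n" for n])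
  ultimately show ?thesis by simp
qed

lemma dioph_conj:
  assumes "dioph P" "dioph Q"
  shows "dioph (\<lambda>v. P v \<and> Q v)"
proof -
  obtain E :: "(nat + nat) atom list" where E: "\<And>v. P v \<longleftrightarrow> (\<exists>u. \<forall>A\<in>set E. holds (case_sum v u) A)"
    using assms(1) by (rule diophE) (rule that)
  obtain E' :: "(nat + nat) atom list" where E': "\<And>v. Q v \<longleftrightarrow> (\<exists>u. \<forall>A\<in>set E'. holds (case_sum v u) A)"
    using assms(2) by (rule diophE) (rule that)
  let ?f = "map_sum id (\<lambda>i. 2 * i)" and ?g = "map_sum id (\<lambda>i. Suc (2 * i))"
  let ?E = "map (map_atom ?f) E @ map (map_atom ?g) E'"
  have f: "case_sum v u \<circ> ?f = case_sum v (\<lambda>i. u (2 * i))"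
    and g: "case_sum v u \<circ> ?g = case_sum v (\<lambda>i. u (Suc (2 * i)))" for v u :: "nat \<Rightarrow> 'a"
    by (auto simp: fun_eq_iff split: sum.split)
  have "P v \<and> Q v \<longleftrightarrow> (\<exists>u. \<forall>A\<in>set ?E. holds (case_sum v u) A)" for v
  proof
    assume "P v \<and> Q v"
    then obtain u u' where "\<forall>A\<in>set E. holds (case_sum v u) A" "\<forall>A\<in>set E'. holds (case_sum v u') A"
      unfolding E E' by blast
    then show "\<exists>u. \<forall>A\<in>set ?E. holds (case_sum v u) A"
      by (intro exI[of _ "\<lambda>i. if even i then u (i div 2) else u' (i div 2)"])
        (auto simp: holds_map_atom f g)
  next
    assume "\<exists>u. \<forall>A\<in>set ?E. holds (case_sum v u) A"
    then obtain u where "\<forall>A\<in>set ?E. holds (case_sum v u) A" by blast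
    then have "\<forall>A\<in>set E. holds (case_sum v (\<lambda>i. u (2 * i))) A"
      "\<forall>A\<in>set E'. holds (case_sum v (\<lambda>i. u (Suc (2 * i)))) A"
      unfolding f[symmetric] g[symmetric] by (simp_all add: holds_map_atom[symmetric] ball_Un)
    then show "P v \<and> Q v" unfolding E E' by blast
  qed
  then show ?thesis by (rule diophI)
qed

lemma dioph_ball:
  assumes "finite S" "\<And>x. x \<in> S \<Longrightarrow> dioph (P x)"
  shows "dioph (\<lambda>v. \<forall>x\<in>S. P x v)"
  using assms
proof (induction S)
  case empty
  show ?case by (rule diophI[of _ "[]"]) simp
next
  case (insert x S)
  then show ?case by (simp add: dioph_conj)
qed

lemma dioph_atom: "dioph (\<lambda>v. holds v A)"
proof -
  have "case_sum v u \<circ> Inl = v" for v u :: "nat \<Rightarrow> 'a" by auto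
  then show ?thesis
    by (intro diophI[of _ "[map_atom Inl A]"]) (simp add: holds_map_atom)
qed

lemma dfun_graph: "dfun F \<Longrightarrow> dioph (\<lambda>v. F (\<lambda>i. v (f i)) = v j)"
  unfolding dfun_def by (drule dioph_rename[of _ "case_nat j f"]) simp

lemma dfun_rename: "dfun F \<Longrightarrow> dfun (\<lambda>v. F (\<lambda>i. v (f i)))"
  unfolding dfun_def by (drule dioph_rename[of _ "case_nat 0 (\<lambda>i. Suc (f i))"]) simp

lemma dfunI:
  assumes "dioph R" "\<And>w. R w \<longleftrightarrow> F (\<lambda>i. w (Suc i)) = w 0"
  shows "dfun F"
  using assms(1) unfolding dfun_def assms(2) .

section \<open>Composition with definable functions\<close>

lemma dioph_subst1:
  assumes "dioph (\<lambda>v. R (v 0))" "dfun F"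
  shows "dioph (\<lambda>v. R (F v))"
proof -
  have "dioph (\<lambda>v. \<exists>x. F v = x \<and> R x)"
    by (intro dioph_ex dioph_conj dfun_graph[OF assms(2)])
      (rule dioph_rename[OF assms(1), of "\<lambda>_. 0"])
  then show ?thesis by simp
qed

lemma dioph_subst2:
  assumes "dioph (\<lambda>v. R (v 0) (v 1))" "dfun F" "dfun G"
  shows "dioph (\<lambda>v. R (F v) (G v))"
proof -
  have "dioph (\<lambda>v. \<exists>x y. F v = x \<and> G v = y \<and> R x y)"
    \<comment> \<open>The innermost quantifier owns position 0, so x and y arrive in reverse
      order.\<close>
    using dioph_rename[OF assms(1), of "\<lambda>i. 1 - i"]
    by (intro dioph_ex dioph_conj dfun_graph[OF assms(2)] dfun_graph[OF assms(3)]) simp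
  then show ?thesis by simp
qed

lemma dioph_subst3:
  assumes "dioph (\<lambda>v. R (v 0) (v 1) (v 2))" "dfun F" "dfun G" "dfun H"
  shows "dioph (\<lambda>v. R (F v) (G v) (H v))"
proof -
  have "dioph (\<lambda>v. \<exists>x y z. F v = x \<and> G v = y \<and> H v = z \<and> R x y z)"
    using dioph_rename[OF assms(1), of "\<lambda>i. 2 - i"]
    by (intro dioph_ex dioph_conj dfun_graph[OF assms(2)] dfun_graph[OF assms(3)] dfun_graph[OF assms(4)]) (simp add: numeral_2_eq_2)
  then show ?thesis by simp
qed

lemma dfun_subst1:
  assumes "dfun (\<lambda>v. f (v 0))" "dfun F"
  shows "dfun (\<lambda>v. f (F v))"
proof -
  have "dioph (\<lambda>v. f (v 0) = v 1)"
    using dioph_rename[OF assms(1)[unfolded dfun_def], of "case_nat 1 (\<lambda>_. 0)"] by simp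
  moreover have "dioph (\<lambda>w. F (\<lambda>i. w (Suc (Suc i))) = w 0)"
    by (rule dfun_graph[OF assms(2)])
  ultimately have "dioph (\<lambda>v. \<exists>x. F (\<lambda>i. v (Suc i)) = x \<and> f x = v 0)"
    by (intro dioph_ex dioph_conj) simp_all
  then show ?thesis by (rule dfunI) simp
qed

lemma dfun_subst2:
  assumes "dfun (\<lambda>v. f (v 0) (v 1))" "dfun F" "dfun G"
  shows "dfun (\<lambda>v. f (F v) (G v))"
proof -
  have "dioph (\<lambda>v. f (v 1) (v 0) = v 2)"
    using dioph_rename[OF assms(1)[unfolded dfun_def], of "case_nat 2 (\<lambda>i. 1 - i)"] by simp
  then have "dioph (\<lambda>v. \<exists>x y. F (\<lambda>i. v (Suc i)) = x \<and> G (\<lambda>i. v (Suc i)) = y \<and> f x y = v 0)"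
    by (intro dioph_ex dioph_conj dfun_graph[OF assms(2)] dfun_graph[OF assms(3)]) (simp add: numeral_2_eq_2)
  then show ?thesis by (rule dfunI) simp
qed

section \<open>Arithmetic operations and relations\<close>

named_theorems dioph_intros

lemma dfun_var [dioph_intros]: "dfun (\<lambda>v. v i)"
proof -
  have "dioph (\<lambda>v::nat\<Rightarrow>'a. \<exists>z. holds (\<lambda>j. if j = 0 then z else v (j - 1)) (Is_Sum 0 0 0)
      \<and> holds (\<lambda>j. if j = 0 then z else v (j - 1)) (Is_Sum 0 (Suc (Suc i)) 1))"
    using dioph_conj[OF dioph_atom dioph_atom, of "Is_Sum 0 0 0" "Is_Sum 0 (Suc (Suc i)) 1"]
    by (intro dioph_ex) simp
  then show ?thesis by (rule dfunI) simp
qed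

lemma dioph_eq [dioph_intros]:
  assumes "dfun F" "dfun G"
  shows "dioph (\<lambda>v. F v = G v)"
proof -
  have "dioph (\<lambda>v. \<exists>x. F v = x \<and> G v = x)"
    by (intro dioph_ex dioph_conj dfun_graph[OF assms(1)] dfun_graph[OF assms(2)])
  then show ?thesis by (simp add: eq_commute)
qed

lemma dfun_0 [dioph_intros]: "dfun (\<lambda>v. 0)"
  using dioph_atom[of "Is_Sum 0 0 0"] by (rule dfunI) simp

lemma dfun_1 [dioph_intros]: "dfun (\<lambda>v. 1)"
  using dioph_atom[of "Is_One 0"] by (rule dfunI) auto

lemma dfun_add [dioph_intros]: "dfun F \<Longrightarrow> dfun G \<Longrightarrow> dfun (\<lambda>v. F v + G v)"
  by (rule dfun_subst2[of "(+)"], rule dfunI[OF dioph_atom[of "Is_Sum 1 2 0"]])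
    (simp_all add: numeral_2_eq_2)

lemma dfun_mult [dioph_intros]: "dfun F \<Longrightarrow> dfun G \<Longrightarrow> dfun (\<lambda>v. F v * G v)"
  by (rule dfun_subst2[of "(*)"], rule dfunI[OF dioph_atom[of "Is_Prod 1 2 0"]])
    (simp_all add: numeral_2_eq_2)

lemma dfun_of_nat [dioph_intros]: "dfun (\<lambda>v. of_nat n)"
  by (induction n) (auto intro!: dioph_intros)

lemma dfun_numeral [dioph_intros]: "dfun (\<lambda>v. numeral n)"
  using dfun_of_nat[of "numeral n"] by simp

lemmas [dioph_intros] = dioph_conj dioph_ex dioph_ball

lemma dfun_Suc [dioph_intros]: "dfun F \<Longrightarrow> dfun (\<lambda>v. Suc (F v))"
  using dfun_add[OF _ dfun_1, of F] by simp

lemma dfun_const: "dfun (\<lambda>v. n :: nat)"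
  using dfun_of_nat[of n, where 'a = nat] by simp

lemma dioph_le [dioph_intros]: "dfun F \<Longrightarrow> dfun G \<Longrightarrow> dioph (\<lambda>v. F v \<le> (G v :: nat))"
proof (rule dioph_subst2)
  have "dioph (\<lambda>v :: nat \<Rightarrow> nat. \<exists>d. v 1 = v 0 + d)" by (intro dioph_intros)
  then show "dioph (\<lambda>v. v 0 \<le> (v 1 :: nat))" unfolding le_iff_add .
qed

lemma dioph_less [dioph_intros]: "dfun F \<Longrightarrow> dfun G \<Longrightarrow> dioph (\<lambda>v. F v < (G v :: nat))"
  unfolding less_eq_Suc_le by (intro dioph_intros)

lemma dioph_dvd [dioph_intros]: "dfun F \<Longrightarrow> dfun G \<Longrightarrow> dioph (\<lambda>v. F v dvd (G v :: nat))"
proof (rule dioph_subst2)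
  show "dioph (\<lambda>v. v 0 dvd (v 1 :: nat))" unfolding dvd_def by (intro dioph_intros)
qed

lemma dioph_cong [dioph_intros]:
  assumes "dfun F" "dfun G" "dfun H"
  shows "dioph (\<lambda>v. [F v = (G v :: nat)] (mod H v))"
proof (rule dioph_subst3[OF _ assms])
  show "dioph (\<lambda>v. [v 0 = (v 1 :: nat)] (mod v 2))"
    unfolding cong_iff_lin_nat by (intro dioph_intros)
qed

lemma dfun_pred:
  fixes F :: "(nat \<Rightarrow> nat) \<Rightarrow> nat"
  assumes "dfun F" "\<And>v. 0 < F v"
  shows "dfun (\<lambda>v. F v - 1)"
proof (rule dfunI)
  show "dioph (\<lambda>w. Suc (w 0) = F (\<lambda>i. w (Suc i)))"
    by (intro dioph_intros dfun_rename[OF assms(1)])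
  show "Suc (w 0) = F (\<lambda>i. w (Suc i)) \<longleftrightarrow> F (\<lambda>i. w (Suc i)) - 1 = w 0" for w
    using assms(2)[of "\<lambda>i. w (Suc i)"] by auto
qed

lemma dfun_div:
  fixes F G :: "(nat \<Rightarrow> nat) \<Rightarrow> nat"
  assumes "dfun F" "dfun G" "\<And>v. G v > 0"
  shows "dfun (\<lambda>v. F v div G v)"
proof -
  \<comment> \<open>A divisor of the form \<open>Suc _\<close> lets quotient and remainder define
    the function at all arguments, as substitution demands.\<close>
  have "dfun (\<lambda>v. v 0 div Suc (v 1))"
  proof (rule dfunI)
    show "dioph (\<lambda>w. \<exists>r. w (Suc 0) = w 0 * Suc (w (Suc 1)) + r \<and> r < Suc (w (Suc 1)))"
      by (intro dioph_intros)
    show "(\<exists>r. w (Suc 0) = w 0 * Suc (w (Suc 1)) + r \<and> r < Suc (w (Suc 1)))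
       \<longleftrightarrow> w (Suc 0) div Suc (w (Suc 1)) = w 0" (is "?l \<longleftrightarrow> ?r") for w :: "nat \<Rightarrow> nat"
    proof
      assume ?l
      then show ?r by (auto simp del: mult_Suc_right)
    next
      assume ?r
      then show ?l
        using div_mult_mod_eq[of "w (Suc 0)" "Suc (w (Suc 1))"]
        by (intro exI[of _ "w (Suc 0) mod Suc (w (Suc 1))"]) simp
    qed
  qed
  then have "dfun (\<lambda>v. F v div Suc (G v - 1))"
    by (rule dfun_subst2[of "\<lambda>x y. x div Suc y", OF _ assms(1) dfun_pred[OF assms(2,3)]])
  then show ?thesis using assms(3) by simp
qed


lemma dfun_mod:
  fixes F G :: "(nat \<Rightarrow> nat) \<Rightarrow> nat"
  assumes "dfun F" "dfun G" "\<And>v. G v > 0"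
  shows "dfun (\<lambda>v. F v mod G v)"
proof (rule dfunI)
  show "dioph (\<lambda>w. F (\<lambda>i. w (Suc i)) = (F (\<lambda>i. w (Suc i)) div G (\<lambda>i. w (Suc i))) * G (\<lambda>i. w (Suc i)) + w 0)"
    by (intro dioph_intros dfun_div dfun_rename[OF assms(1)] dfun_rename[OF assms(2)] assms(3))
qed (metis add_left_cancel div_mult_mod_eq)

section \<open>The Pell sequence is Diophantine\<close>

text \<open>The Lucas sequence U_n of x^2 - b x + 1. For b = 2 a it gives the second components of
  the solutions of the Pell equation X^2 - (a^2 - 1) Y^2 = 1. Working with consecutive terms of this
  one sequence avoids carrying X along.\<close>

fun luc :: "int \<Rightarrow> nat \<Rightarrow> int" where
  "luc b 0 = 0"
| "luc b (Suc 0) = 1"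
| "luc b (Suc (Suc n)) = b * luc b (Suc n) - luc b n"

text \<open>The upper left entry of M^m M^n, where M is the matrix with rows (b, -1) and (1,
  0).\<close>

lemma luc_add_Suc: "luc b (m + Suc n) = luc b (Suc m) * luc b (Suc n) - luc b m * luc b n"
proof (induction b n rule: luc.induct)
  case (3 b n)
  have "luc b (m + Suc (Suc (Suc n))) = b * luc b (m + Suc (Suc n)) - luc b (m + Suc n)"
    by simp
  also have "\<dots> = luc b (Suc m) * luc b (Suc (Suc (Suc n))) - luc b m * luc b (Suc (Suc n))"
    unfolding 3 by (simp add: algebra_simps)
  finally show ?case .
qed simp_all

text \<open>The bracket stands for U_(n-1), written so that it also makes sense for n = 0.\<close>

lemma luc_add: "luc b (m + n) = luc b (Suc m) * luc b n - luc b m * (b * luc b n - luc b (Suc n))"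
  by (cases n) (simp_all only: luc_add_Suc, simp_all)

text \<open>This is det M^n = 1 with U_(n-1) eliminated.\<close>

lemma luc_quadratic:
  "luc b (Suc n) * luc b (Suc n) + luc b n * luc b n = 1 + b * luc b (Suc n) * luc b n"
proof (induction n)
  case (Suc n)
  have "luc b (Suc (Suc n)) * luc b (Suc (Suc n)) + luc b (Suc n) * luc b (Suc n)
      - (1 + b * luc b (Suc (Suc n)) * luc b (Suc n)) =
    luc b (Suc n) * luc b (Suc n) + luc b n * luc b n - (1 + b * luc b (Suc n) * luc b n)"
    by (simp add: algebra_simps)
  with Suc show ?case by simp
qed simp

lemma coprime_luc_Suc: "coprime (luc b n) (luc b (Suc n))"
proof (rule coprimeI)
  fix d assume "d dvd luc b n" "d dvd luc b (Suc n)"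
  then obtain x y where "luc b n = d * x" "luc b (Suc n) = d * y" by (elim dvdE)
  with luc_quadratic[of b n] have "1 = d * (d * y * y + d * x * x - b * d * y * x)"
    by (simp add: algebra_simps)
  then show "is_unit d" by (rule dvdI)
qed

lemma luc_nonneg_less:
  assumes "2 \<le> b"
  shows "0 \<le> luc b n \<and> luc b n < luc b (Suc n)"
proof (induction n)
  case (Suc n)
  then have "2 * luc b (Suc n) \<le> b * luc b (Suc n)"
    using assms by (intro mult_right_mono) auto
  with Suc show ?case unfolding luc.simps by linarith
qed simp

lemma luc_nonneg: "2 \<le> b \<Longrightarrow> 0 \<le> luc b n"
  using luc_nonneg_less by blast

lemma luc_less_Suc: "2 \<le> b \<Longrightarrow> luc b n < luc b (Suc n)"
  using luc_nonneg_less by blast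

lemma luc_less: "2 \<le> b \<Longrightarrow> m < n \<Longrightarrow> luc b m < luc b n"
  by (rule lift_Suc_mono_less) (rule luc_less_Suc)

lemma luc_le: "2 \<le> b \<Longrightarrow> m \<le> n \<Longrightarrow> luc b m \<le> luc b n"
  using luc_less[of b m n] by (cases "m = n") auto

lemma le_luc: "2 \<le> b \<Longrightarrow> int n \<le> luc b n"
proof (induction n)
  case (Suc n)
  with luc_less_Suc[of b n] show ?case by simp
qed simp

lemma power_le_luc:
  assumes "2 \<le> b"
  shows "(b - 1) ^ n \<le> luc b (Suc n)"
proof (induction n)
  case (Suc n)
  have "(b - 1) * (b - 1) ^ n \<le> (b - 1) * luc b (Suc n)"
    using Suc assms by (intro mult_left_mono) auto
  also have "\<dots> \<le> luc b (Suc (Suc n))"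
    using luc_less_Suc[OF assms, of n] by (simp add: algebra_simps)
  finally show ?case by simp
qed simp

text \<open>Descent: the pair (b x - y, x) solves the same equation and is smaller, until x = 0 is
  reached. The descent step inverts the recurrence.\<close>

lemma luc_characterization:
  assumes b: "2 \<le> b"
  shows "0 \<le> x \<Longrightarrow> x < y \<Longrightarrow> x * x + y * y = 1 + b * x * y \<Longrightarrow>
    \<exists>n. x = luc b n \<and> y = luc b (Suc n)"
proof (induction "nat x" arbitrary: x y rule: less_induct)
  case less
  show ?case
  proof (cases "x = 0")
    case True
    with less.prems have "y * y = 1" "0 < y" by simp_all
    then have "y = 1" by (auto simp: zmult_eq_1_iff)
    then show ?thesis using True by (intro exI[of _ 0]) simp
  next
    case False
    define z where "z = b * x - y"
    have eq: "y * z = x * x - 1" using less.prems unfolding z_def by (simp add: algebra_simps)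
    have "0 < x * x" using False by (simp add: zero_less_mult_iff) arith
    with eq have "0 \<le> y * z" by linarith
    with less.prems have "0 \<le> z" by (simp add: zero_le_mult_iff)
    have "y * z < y * x"
    proof -
      have "x * x \<le> y * x" using less.prems by (intro mult_right_mono) auto
      with eq show ?thesis by linarith
    qed
    then have "z < x" using less.prems by simp
    have "\<exists>n. z = luc b n \<and> x = luc b (Suc n)"
    proof (rule less.hyps)
      show "nat z < nat x" using \<open>0 \<le> z\<close> \<open>z < x\<close> by simp
      show "z * z + x * x = 1 + b * z * x"
        using less.prems(3) unfolding z_def by (simp add: algebra_simps)
    qed fact+
    then obtain n where "z = luc b n" "x = luc b (Suc n)" by blast
    then show ?thesis
      by (intro exI[of _ "Suc n"]) (simp add: z_def)
  qed
qed

text \<open>Modulo A^2, the term U_(kn) is n A B^(n-1); the extra factor B on both sides avoids the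
  exponent n - 1.\<close>

lemma luc_multiples:
  fixes b :: int and k :: nat
  defines "A \<equiv> luc b k" and "B \<equiv> luc b (Suc k)"
  shows "A dvd luc b (k * n) \<and> A * A dvd luc b (Suc (k * n)) - B ^ n
    \<and> A * A dvd luc b (k * n) * B - int n * B ^ n * A"
proof (induction n)
  case 0
  show ?case by simp
next
  case (Suc n)
  then obtain p q r where p: "luc b (k * n) = A * p"
    and q': "luc b (Suc (k * n)) - B ^ n = A * A * q"
    and r': "luc b (k * n) * B - int n * B ^ n * A = A * A * r"
    by (elim conjE dvdE)
  from q' have q: "luc b (Suc (k * n)) = B ^ n + A * A * q" by simp
  from r' p have r: "A * p * B - int n * B ^ n * A - A * A * r = 0" by simp
  have 1: "luc b (k * Suc n) = luc b (Suc (k * n)) * A - A * p * (b * A - B)"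
    using luc_add[of b "k * n" k] p by (simp add: A_def B_def add.commute)
  have 2: "luc b (Suc (k * Suc n)) = luc b (Suc (k * n)) * B - A * p * A"
    using luc_add_Suc[of b "k * n" k] p by (simp add: A_def B_def add.commute)
  have "luc b (k * Suc n) = A * (luc b (Suc (k * n)) - p * (b * A - B))"
    using 1 by (simp add: algebra_simps)
  moreover have "luc b (Suc (k * Suc n)) - B ^ Suc n = A * A * (q * B - p)"
    unfolding 2 q by (simp add: algebra_simps)
  moreover have "luc b (k * Suc n) * B - int (Suc n) * B ^ Suc n * A
      = A * A * (q * A * B - p * b * B + r * B)"
  proof -
    have "luc b (k * Suc n) * B - int (Suc n) * B ^ Suc n * A - A * A * (q * A * B - p * b * B + r * B)
      = B * (A * p * B - int n * B ^ n * A - A * A * r)"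
      unfolding 1 q by (simp add: algebra_simps)
    with r show ?thesis by simp
  qed
  ultimately show ?case by (metis dvd_triv_left)
qed

text \<open>First k divides m, since the remainder r of m modulo k would give a multiple U_r of A
  below A. With m = k n, the expansion modulo A^2 then makes A divide n B^n, and A is coprime to
  B.\<close>

lemma luc_square_dvd:
  assumes b: "2 \<le> b" and "0 < k" and dvd: "luc b k * luc b k dvd luc b m"
  shows "luc b k dvd int m"
proof -
  define A B n r where defs: "A = luc b k" "B = luc b (Suc k)" "n = m div k" "r = m mod k"
  have m: "m = k * n + r" and "r < k" using \<open>0 < k\<close> by (simp_all add: defs)
  have cop: "coprime A B" unfolding defs by (rule coprime_luc_Suc)
  have 0: "0 < A" using le_luc[OF b, of k] \<open>0 < k\<close> unfolding defs by linarith
  have "A dvd luc b (k * n)" and 1: "A * A dvd luc b (Suc (k * n)) - B ^ n"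
    and 2: "A * A dvd luc b (k * n) * B - int n * B ^ n * A"
    using luc_multiples[of b k n] by (auto simp: defs)
  then obtain p q where p: "luc b (k * n) = A * p" and q': "luc b (Suc (k * n)) - B ^ n = A * A * q"
    by (elim dvdE)
  from q' have q: "luc b (Suc (k * n)) = B ^ n + A * A * q" by simp
  obtain s where s: "luc b m = A * A * s" using dvd unfolding defs by (elim dvdE)
  have "luc b m = luc b (Suc (k * n)) * luc b r - A * p * (b * luc b r - luc b (Suc r))"
    unfolding m using luc_add[of b "k * n" r] p by simp
  then have "B ^ n * luc b r = A * (A * s - A * q * luc b r + p * (b * luc b r - luc b (Suc r)))"
    unfolding s q by (simp add: algebra_simps)
  then have "A dvd B ^ n * luc b r" by (rule dvdI)
  moreover have "coprime A (B ^ n)" using cop by simp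
  ultimately have "A dvd luc b r" by (simp add: coprime_dvd_mult_right_iff)
  moreover have "luc b r < A" unfolding defs using \<open>r < k\<close> b by (intro luc_less) (simp_all add: defs)
  ultimately have "luc b r = 0"
    using luc_nonneg[OF b, of r] zdvd_not_zless[of "luc b r" A] by linarith
  with le_luc[OF b, of r] have "r = 0" by simp
  with m have m: "m = k * n" by simp
  have "A * A dvd luc b (k * n) * B" using dvd unfolding m defs(1,2) by simp
  from dvd_diff[OF this 2] have "A * A dvd int n * B ^ n * A" by simp
  then have "A dvd int n * B ^ n" using 0 by simp
  with cop have "A dvd int n" by (simp add: coprime_dvd_mult_left_iff)
  then show ?thesis by (simp add: m defs(1))
qed

lemma luc_dvd_diff: "b - c dvd luc b n - luc c n"
proof (induction b n rule: luc.induct)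
  case (3 b n)
  have "luc b (Suc (Suc n)) - luc c (Suc (Suc n)) =
    (b - c) * luc b (Suc n) + c * (luc b (Suc n) - luc c (Suc n)) - (luc b n - luc c n)"
    by (simp add: algebra_simps)
  then show ?case
    using dvd_diff[OF dvd_add[OF dvd_triv_left dvd_mult[OF 3(1)]] 3(2)] by (simp only:)
qed simp_all

lemma luc_2: "luc 2 n = int n"
  by (induction n rule: induct_nat_012) simp_all

text \<open>The divisor is the trace of M^m. By Cayley-Hamilton M^(2m) is -1 modulo this trace, so a
  shift of the index by 2 m only changes the sign.\<close>

lemma luc_double_add: "2 * luc b (Suc m) - b * luc b m dvd luc b (2 * m + n) + luc b n"
proof (induction b n rule: luc.induct)
  case (1 b)
  have "luc b (2 * m) = (2 * luc b (Suc m) - b * luc b m) * luc b m"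
    unfolding mult_2[of m] luc_add by (simp add: algebra_simps)
  then show ?case by simp
next
  case (2 b)
  have "luc b (2 * m + 1) + 1 = (2 * luc b (Suc m) - b * luc b m) * luc b (Suc m)"
  proof -
    have "luc b (2 * m + 1) = luc b (m + Suc m)"
      by (rule arg_cong[of _ _ "luc b"]) simp
    then show ?thesis
      unfolding luc_add_Suc using luc_quadratic[of b m] by (simp add: algebra_simps)
  qed
  then show ?case by simp
next
  case (3 b n)
  have "luc b (2 * m + Suc (Suc n)) + luc b (Suc (Suc n)) =
    b * (luc b (2 * m + Suc n) + luc b (Suc n)) - (luc b (2 * m + n) + luc b n)"
    by (simp add: algebra_simps)
  then show ?case
    using dvd_diff[OF dvd_mult[OF 3(1)] 3(2)] by (simp only:)
qed

lemma luc_double_diff: "n \<le> 2 * m \<Longrightarrow> 2 * luc b (Suc m) - b * luc b m dvd luc b (2 * m - n) - luc b n"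
proof (induction b n rule: luc.induct)
  case (1 b)
  show ?case using luc_double_add[of b m 0] by simp
next
  case (2 b)
  then obtain d where d: "2 * m = Suc d" by (cases "2 * m") auto
  have "2 * luc b (Suc m) - b * luc b m dvd b * luc b (Suc d) - (luc b (2 * m + 1) + 1)"
    using luc_double_add[of b m 0] luc_double_add[of b m 1] d by (intro dvd_diff dvd_mult) simp_all
  moreover have "b * luc b (Suc d) - (luc b (2 * m + 1) + 1) = luc b (2 * m - Suc 0) - luc b (Suc 0)"
    by (simp add: d)
  ultimately show ?case by (simp only:)
next
  case (3 b n)
  define d where "d = 2 * m - Suc (Suc n)"
  have d: "2 * m = d + n + 2" using 3(3) by (simp add: d_def)
  have "luc b (2 * m - Suc (Suc n)) - luc b (Suc (Suc n)) =
    b * (luc b (2 * m - Suc n) - luc b (Suc n)) - (luc b (2 * m - n) - luc b n)"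
  proof -
    have "2 * m - Suc n = Suc d" "2 * m - n = Suc (Suc d)" "2 * m - Suc (Suc n) = d"
      by (simp_all add: d)
    then show ?thesis by (simp add: algebra_simps)
  qed
  moreover have "Suc n \<le> 2 * m" "n \<le> 2 * m" using 3(3) by simp_all
  ultimately show ?case
    using dvd_diff[OF dvd_mult[OF 3(1)] 3(2)] by (simp only:)
qed

text \<open>Shifts by 2 m and the reflection n to 2 m - n bring any index into [0, m]. Both preserve
  the index up to sign modulo m, which has to be recorded at the same time.\<close>

lemma luc_residue:
  assumes "0 < m"
  shows "\<exists>j\<le>m. (2 * luc b (Suc m) - b * luc b m dvd luc b n - luc b j \<or>
      2 * luc b (Suc m) - b * luc b m dvd luc b n + luc b j) \<and>
    (int m dvd int n - int j \<or> int m dvd int n + int j)"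
proof (induction n rule: less_induct)
  case (less n)
  let ?v = "2 * luc b (Suc m) - b * luc b m"
  consider "n \<le> m" | "m < n" "n \<le> 2 * m" | "2 * m < n" by linarith
  then show ?case
  proof cases
    case 1
    then show ?thesis by (intro exI[of _ n]) simp
  next
    case 2
    have "?v dvd luc b n - luc b (2 * m - n)"
      using luc_double_diff[of "2 * m - n" m b] 2 by simp
    then show ?thesis using 2 by (intro exI[of _ "2 * m - n"]) (auto simp: of_nat_diff)
  next
    case 3
    define k where "k = n - 2 * m"
    have n: "n = 2 * m + k" using 3 by (simp add: k_def)
    then obtain j where j: "j \<le> m" "?v dvd luc b k - luc b j \<or> ?v dvd luc b k + luc b j"
      "int m dvd int k - int j \<or> int m dvd int k + int j"
      using less[of k] assms by auto
    have v: "?v dvd luc b n + luc b k" using luc_double_add[of b m k] n by simp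
    have "?v dvd luc b n - luc b j \<or> ?v dvd luc b n + luc b j"
    proof (rule disjE[OF j(2)])
      assume "?v dvd luc b k - luc b j"
      from dvd_diff[OF v this] show ?thesis by simp
    next
      assume "?v dvd luc b k + luc b j"
      from dvd_diff[OF v this] show ?thesis by simp
    qed
    moreover have "int m dvd int n - int j \<or> int m dvd int n + int j"
    proof (rule disjE[OF j(3)])
      assume "int m dvd int k - int j"
      from dvd_add[OF dvd_triv_right[of "int m" 2] this] show ?thesis by (simp add: n algebra_simps)
    next
      assume "int m dvd int k + int j"
      from dvd_add[OF dvd_triv_right[of "int m" 2] this] show ?thesis by (simp add: n algebra_simps)
    qed
    ultimately show ?thesis using j(1) by blast
  qed
qed

text \<open>
  Certificate for \<open>a = luc b c\<close>.  The numbers \<open>u\<close>, \<open>s\<close>, \<open>x\<close> are Pell numbers, \<open>x\<close> to the base \<open>w\<close>.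
  As \<open>w\<close> is congruent to \<open>b\<close> modulo \<open>v\<close> and to \<open>2\<close> modulo \<open>u\<close>, and \<open>luc 2 n = n\<close>, the residues of \<open>x\<close> modulo
  \<open>v\<close> and \<open>u\<close> are \<open>luc b n\<close> and \<open>n\<close>.  Modulo \<open>v\<close> the sequence \<open>luc b\<close> is periodic up to sign with a
  period divisible by \<open>u\<close>, because \<open>u\<^sup>2\<close> divides \<open>s\<close>.
\<close>

definition luc_cert :: "nat \<Rightarrow> nat \<Rightarrow> nat \<Rightarrow> nat \<Rightarrow> nat \<Rightarrow> nat \<Rightarrow> nat \<Rightarrow> nat \<Rightarrow> nat \<Rightarrow> nat \<Rightarrow> nat \<Rightarrow> bool"
  where "luc_cert a b c r s t u v w x y \<longleftrightarrow>
    t < u \<and> u * u + t * t = 1 + b * t * u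
    \<and> r < s \<and> s * s + r * r = 1 + b * r * s
    \<and> u * u dvd s \<and> v + 2 * r = b * s
    \<and> [w = b] (mod v) \<and> [w = 2] (mod u) \<and> 2 < w
    \<and> x < y \<and> x * x + y * y = 1 + w * x * y
    \<and> 2 * a < u \<and> 2 * a < v \<and> 2 * c < u
    \<and> [x = a] (mod v) \<and> [x = c] (mod u)"

text \<open>Write x = \<open>luc w n\<close> and reduce n to an index i up to m. Modulo v, a is
  \<open>luc b i\<close> up to sign, and both are below v / 2, so they are equal. Hence i is at most
  a, so both i and c are below u / 2, and they agree up to sign modulo u. The factors 2 in the
  certificate serve to remove the signs.\<close>

lemma luc_sound:
  assumes b: "4 \<le> b" and cert: "luc_cert a b c r s t u v w x y"
  shows "int a = luc (int b) c"
proof -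
  have tu: "t < u" "u * u + t * t = 1 + b * t * u"
    and rs: "r < s" "s * s + r * r = 1 + b * r * s"
    and us: "u * u dvd s" and v: "v + 2 * r = b * s"
    and wv: "[w = b] (mod v)" and wu: "[w = 2] (mod u)" and w: "2 < w"
    and xy: "x < y" "x * x + y * y = 1 + w * x * y"
    and a: "2 * a < u" "2 * a < v" and c: "2 * c < u"
    and xv: "[x = a] (mod v)" and xu: "[x = c] (mod u)"
    using cert unfolding luc_cert_def by blast+
  have b2: "2 \<le> int b" using b by simp
  have quad: "\<exists>n. int p = luc (int b) n \<and> int q = luc (int b) (Suc n)"
    if "p < q" "q * q + p * p = 1 + b * p * q" for p q
  proof (rule luc_characterization[OF b2])
    have "int (q * q + p * p) = int (1 + b * p * q)" using that by simp
    then show "int p * int p + int q * int q = 1 + int b * int p * int q" by simp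
  qed (use that in simp_all)
  obtain k where k: "int u = luc (int b) (Suc k)"
    using quad[OF tu] by blast
  obtain j where j: "int r = luc (int b) j" "int s = luc (int b) (Suc j)"
    using quad[OF rs] by blast
  have "\<exists>n. int x = luc (int w) n \<and> int y = luc (int w) (Suc n)"
  proof (rule luc_characterization)
    have "int (x * x + y * y) = int (1 + w * x * y)" using xy by simp
    then show "int x * int x + int y * int y = 1 + int w * int x * int y" by simp
  qed (use w xy in simp_all)
  then obtain n where n: "int x = luc (int w) n" by blast
  define m where "m = Suc j"
  have "luc (int b) (Suc k) * luc (int b) (Suc k) dvd luc (int b) m"
    using us unfolding k[symmetric] j(2)[symmetric] m_def by (metis int_dvd_int_iff of_nat_mult)
  from luc_square_dvd[OF b2 _ this] have um: "int u dvd int m" by (simp add: k)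
  have v': "int v = 2 * luc (int b) (Suc m) - int b * luc (int b) m"
  proof -
    have "int v + 2 * int r = int b * int s" using v by (metis of_nat_add of_nat_mult of_nat_numeral)
    then show ?thesis unfolding m_def luc.simps j by simp
  qed
  obtain i where i: "i \<le> m" "int v dvd luc (int b) n - luc (int b) i \<or> int v dvd luc (int b) n + luc (int b) i"
      "int m dvd int n - int i \<or> int m dvd int n + int i"
    using luc_residue[of m "int b" n] unfolding v' by (auto simp: m_def)
  have xn: "int v dvd int x - luc (int b) n"
  proof -
    have "int v dvd int w - int b" using wv by (simp add: cong_iff_dvd_diff flip: cong_int_iff)
    then show ?thesis unfolding n using luc_dvd_diff dvd_trans by blast
  qed
  have xa: "int v dvd int x - int a" using xv by (simp add: cong_iff_dvd_diff flip: cong_int_iff)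
  have xn': "int u dvd int x - int n"
  proof -
    have "int u dvd int w - 2" using wu by (simp add: cong_iff_dvd_diff flip: cong_int_iff)
    then show ?thesis unfolding n using luc_dvd_diff[of "int w" 2 n] dvd_trans unfolding luc_2 by blast
  qed
  have xc: "int u dvd int x - int c" using xu by (simp add: cong_iff_dvd_diff flip: cong_int_iff)
  have i0: "0 \<le> luc (int b) i" using luc_nonneg[OF b2] .
  \<comment> \<open>This is where \<open>4 \<le> b\<close> enters: v is at least 4 U_m - 2 U_j with
    U_j < U_m.\<close>
  have "2 * luc (int b) i < int v"
  proof -
    have "luc (int b) i \<le> luc (int b) m" using i(1) by (rule luc_le[OF b2])
    moreover have "luc (int b) j < luc (int b) m" unfolding m_def using luc_less_Suc[OF b2] .
    moreover have "4 * luc (int b) m \<le> int b * luc (int b) m"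
      using b luc_nonneg[OF b2, of m] by (intro mult_right_mono) auto
    moreover have "int v + 2 * luc (int b) j = int b * luc (int b) m"
      using v unfolding m_def j[symmetric] by (metis of_nat_add of_nat_mult of_nat_numeral)
    ultimately show ?thesis by linarith
  qed
  have small: "p = q" if "d dvd p - q \<or> d dvd p + q" "0 \<le> p" "0 \<le> q" "2 * p < d" "2 * q < d" for p q d :: int
    using that(1)
  proof
    assume "d dvd p - q"
    moreover have "\<bar>p - q\<bar> < \<bar>d\<bar>" using that by linarith
    ultimately have "p - q = 0" using dvd_imp_le_int[of "p - q" d] by linarith
    then show ?thesis by simp
  next
    assume "d dvd p + q"
    moreover have "\<bar>p + q\<bar> < \<bar>d\<bar>" using that by linarith
    ultimately have "p + q = 0" using dvd_imp_le_int[of "p + q" d] by linarith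
    then show ?thesis using that by linarith
  qed
  have chain: "d dvd p - k \<or> d dvd p + k" if "d dvd p - q" "d dvd q - k \<or> d dvd q + k" for d p q k :: int
    using that(2) dvd_add[OF that(1), of "q - k"] dvd_add[OF that(1), of "q + k"] by auto
  have "int v dvd int a - luc (int b) n" using dvd_diff[OF xn xa] by (simp add: dvd_diff_commute)
  then have "int v dvd int a - luc (int b) i \<or> int v dvd int a + luc (int b) i"
    using i(2) by (rule chain)
  then have ai: "int a = luc (int b) i"
    by (rule small) (use i0 a \<open>2 * luc (int b) i < int v\<close> in simp_all)
  have "int i \<le> int a" unfolding ai by (rule le_luc[OF b2])
  have "int u dvd int c - int n" using dvd_diff[OF xn' xc] by (simp add: dvd_diff_commute)
  then have "int u dvd int c - int i \<or> int u dvd int c + int i"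
    using chain[of "int u" "int c" "int n" "int i"] i(3) dvd_trans[OF um] by blast
  then have "int c = int i"
    by (rule small) (use a c \<open>int i \<le> int a\<close> in simp_all)
  with ai show ?thesis by simp
qed

lemma luc_complete:
  fixes a b c :: nat
  assumes b: "4 \<le> b" and a: "int a = luc (int b) c"
  shows "\<exists>r s t u v w x y. luc_cert a b c r s t u v w x y"
proof -
  have b2: "2 \<le> int b" using b by simp
  have quad: "nat (luc (int d) n) < nat (luc (int d) (Suc n)) \<and>
      nat (luc (int d) (Suc n)) * nat (luc (int d) (Suc n)) + nat (luc (int d) n) * nat (luc (int d) n)
      = 1 + d * nat (luc (int d) n) * nat (luc (int d) (Suc n))" if "2 \<le> d" for d n
  proof -
    have d2: "2 \<le> int d" using that by simp
    have "int (nat (luc (int d) (Suc n)) * nat (luc (int d) (Suc n)) + nat (luc (int d) n) * nat (luc (int d) n))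
      = int (1 + d * nat (luc (int d) n) * nat (luc (int d) (Suc n)))"
      using luc_quadratic[of "int d" n] luc_nonneg[OF d2] by (simp add: mult_ac)
    moreover have "nat (luc (int d) n) < nat (luc (int d) (Suc n))"
      using luc_nonneg_less[OF d2, of n] by (simp add: nat_less_eq_zless)
    ultimately show ?thesis by (simp only: of_nat_eq_iff)
  qed
  \<comment> \<open>u has to be odd: a common divisor of u and v divides s and 2 r, and r is coprime
    to s. Two consecutive terms are coprime, so one of them is odd.\<close>
  obtain k where k: "2 * a < k" "odd (luc (int b) k)"
  proof (cases "odd (luc (int b) (2 * a + 1))")
    case True
    then show ?thesis using that[of "2 * a + 1"] by simp
  next
    case False
    have "odd (luc (int b) (Suc (2 * a + 1)))"
    proof
      assume "even (luc (int b) (Suc (2 * a + 1)))"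
      with False coprime_luc_Suc[of "int b" "2 * a + 1"] show False
        by (metis coprime_common_divisor odd_one)
    qed
    then show ?thesis using that[of "Suc (2 * a + 1)"] by simp
  qed
  obtain l where l: "k = Suc l" using k by (cases k) auto
  define u where "u = nat (luc (int b) k)"
  have u: "int u = luc (int b) k" unfolding u_def using luc_nonneg[OF b2] by simp
  define t where "t = nat (luc (int b) l)"
  have ku: "k \<le> u" using le_luc[OF b2, of k] unfolding u[symmetric] by simp
  have "k * u \<noteq> 0" using ku k by auto
  \<comment> \<open>s gets the index k u, because U_(ku) is u B^(u-1) U_k modulo u^2 and U_k =
    u.\<close>
  then obtain h where h: "k * u = Suc h" by (cases "k * u") auto
  define s where "s = nat (luc (int b) (Suc h))"
  define r where "r = nat (luc (int b) h)"
  have s: "int s = luc (int b) (Suc h)" and r: "int r = luc (int b) h"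
    unfolding s_def r_def using luc_nonneg[OF b2] by simp_all
  have rs: "r < s" "s * s + r * r = 1 + b * r * s"
    using quad[of b h] b unfolding r_def s_def by auto
  have tu: "t < u" "u * u + t * t = 1 + b * t * u"
    using quad[of b l] b unfolding t_def u_def l by auto
  have us: "u * u dvd s"
  proof -
    let ?B = "luc (int b) (Suc k)"
    have "int u * int u dvd int s * ?B - int u * ?B ^ u * int u"
      using luc_multiples[of "int b" k u] unfolding h u s[symmetric] by (simp add: u)
    moreover have "int u * int u dvd int u * ?B ^ u * int u" by (simp add: mult.commute)
    ultimately have "int u * int u dvd int s * ?B" by (metis dvd_add diff_add_cancel)
    moreover have "coprime (int u * int u) ?B" unfolding u using coprime_luc_Suc by simp
    ultimately have "int u * int u dvd int s" by (simp add: coprime_dvd_mult_left_iff)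
    then show ?thesis by (metis int_dvd_int_iff of_nat_mult)
  qed
  define v where "v = b * s - 2 * r"
  have bs: "4 * s \<le> b * s" using b by (intro mult_right_mono) auto
  have v: "v + 2 * r = b * s" and vs: "2 * s < v"
    using bs rs(1) unfolding v_def by linarith+
  have "u \<le> s" using us rs(1) ku k by (metis dvd_mult_left dvd_imp_le not_less0 gr0I)
  have cop: "coprime u v"
  proof (rule coprimeI)
    fix d assume d: "d dvd u" "d dvd v"
    have "d dvd s" using d(1) us by (meson dvd_mult_left dvd_trans)
    then have "d dvd 2 * r" using d(2) v by (metis dvd_add_right_iff dvd_mult)
    moreover have "coprime d 2"
      using d(1) k(2) unfolding u[symmetric] by (auto elim!: dvdE)
    ultimately have "d dvd r" by (simp add: coprime_dvd_mult_right_iff)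
    have "coprime r s" using coprime_luc_Suc[of "int b" h] unfolding r[symmetric] s[symmetric] by simp
    with \<open>d dvd r\<close> \<open>d dvd s\<close> show "is_unit d" using coprime_common_divisor by blast
  qed
  then obtain w0 where w0: "[w0 = 2] (mod u)" "[w0 = b] (mod v)"
    using binary_chinese_remainder_nat[OF cop] by blast
  \<comment> \<open>The added multiple of u v preserves both congruences and forces w > 2.\<close>
  define w where "w = w0 + 3 * (u * v)"
  have w: "[w = 2] (mod u)" "[w = b] (mod v)"
    using w0 unfolding w_def by (simp_all add: cong_def mod_add_eq[symmetric] del: mod_add_eq)
  have "0 < u * v" using ku k vs by simp
  then have w2: "2 < w" unfolding w_def by linarith
  define x where "x = nat (luc (int w) c)"
  define y where "y = nat (luc (int w) (Suc c))"
  have x: "int x = luc (int w) c" unfolding x_def using luc_nonneg[of "int w"] w2 by simp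
  have xy: "x < y" "x * x + y * y = 1 + w * x * y"
    using quad[of w c] w2 unfolding x_def y_def by auto
  have "int c \<le> int a" unfolding a by (rule le_luc[OF b2])
  have "int v dvd int w - int b" using w(2) by (simp add: cong_iff_dvd_diff flip: cong_int_iff)
  then have "int v dvd int x - int a" unfolding x a using luc_dvd_diff dvd_trans by blast
  then have xa: "[x = a] (mod v)" by (simp add: cong_iff_dvd_diff flip: cong_int_iff)
  have "int u dvd int w - 2" using w(1) by (simp add: cong_iff_dvd_diff flip: cong_int_iff)
  then have "int u dvd int x - int c"
    unfolding x using luc_dvd_diff[of "int w" 2 c] dvd_trans unfolding luc_2 by blast
  then have xc: "[x = c] (mod u)" by (simp add: cong_iff_dvd_diff flip: cong_int_iff)
  have "2 * a < u" using k ku by linarith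
  moreover have "2 * c < u" using \<open>2 * a < u\<close> \<open>int c \<le> int a\<close> by linarith
  moreover have "2 * a < v" using \<open>2 * a < u\<close> \<open>u \<le> s\<close> vs by linarith
  ultimately have "luc_cert a b c r s t u v w x y"
    unfolding luc_cert_def using tu rs us v w w2 xy xa xc by simp
  then show ?thesis by blast
qed

text \<open>The shift by \<open>4\<close> makes the side condition \<open>4 \<le> b\<close> of the two lemmas above automatic.\<close>

definition lucn :: "nat \<Rightarrow> nat \<Rightarrow> nat" where
  "lucn q n = nat (luc (int (q + 4)) n)"

lemma int_lucn: "int (lucn q n) = luc (int (q + 4)) n"
  unfolding lucn_def using luc_nonneg[of "int (q + 4)" n] by simp

lemma dfun_lucn [dioph_intros]: "dfun F \<Longrightarrow> dfun G \<Longrightarrow> dfun (\<lambda>v. lucn (F v) (G v))"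
proof (rule dfun_subst2[of lucn], rule dfunI)
  show "dioph (\<lambda>W. \<exists>r s t u v w x y. luc_cert (W 0) (W 1 + 4) (W 2) r s t u v w x y)" (is "dioph ?R")
    unfolding luc_cert_def by (intro dioph_intros)
  show "?R W \<longleftrightarrow> lucn (W (Suc 0)) (W (Suc 1)) = W 0" for W
  proof -
    have "lucn (W 1) (W 2) = W 0 \<longleftrightarrow> int (W 0) = luc (int (W 1 + 4)) (W 2)"
      unfolding int_lucn[symmetric] by auto
    also have "\<dots> \<longleftrightarrow> ?R W"
      using luc_complete[of "W 1 + 4" "W 0" "W 2"] luc_sound[of "W 1 + 4" "W 0" "W 2"] by auto
    finally show ?thesis by (simp add: numeral_2_eq_2)
  qed
qed

section \<open>Exponentials, binomial coefficients and factorials\<close>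

text \<open>Modulo b q - q^2 - 1 the number q is a root of x^2 - b x + 1, so q^n = q U_n - U_(n-1),
  with U_(n-1) = b U_n - U_(n+1).\<close>

lemma luc_power_dvd:
  "b * q - q * q - 1 dvd q ^ n + b * luc b n - (q * luc b n + luc b (Suc n))"
proof (induction n)
  case (Suc n)
  have "q ^ Suc n + b * luc b (Suc n) - (q * luc b (Suc n) + luc b (Suc (Suc n))) =
    q * (q ^ n + b * luc b n - (q * luc b n + luc b (Suc n))) - (b * q - q * q - 1) * luc b n"
    by (simp add: algebra_simps)
  then show ?case using dvd_diff[OF dvd_mult[OF Suc] dvd_triv_left] by (simp only:)
qed simp

text \<open>The base x + 4 must make the modulus exceed q^c, but be definable without powers. By
  \<open>power_le_luc\<close>, \<open>lucn q (Suc c)\<close> is at least (q + 3)^c; the summand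
  \<open>q * q\<close> makes up for the terms subtracted in m.\<close>

lemma power_eq_iff_lucn:
  assumes q: "0 < q"
  shows "p = q ^ c \<longleftrightarrow> (\<exists>x m. x = lucn q (Suc c) + q * q \<and> m + q * q + 1 = (x + 4) * q \<and> p < m
    \<and> [p + (x + 4) * lucn x c = q * lucn x c + lucn x (Suc c)] (mod m))"
proof -
  define x where "x = lucn q (Suc c) + q * q"
  define m where "m = (x + 4) * q - q * q - 1"
  have "int q ^ c \<le> (int (q + 4) - 1) ^ c" by (intro power_mono) auto
  also have "\<dots> \<le> int (lucn q (Suc c))" unfolding int_lucn by (intro power_le_luc) simp
  finally have "int (q ^ c) \<le> int (lucn q (Suc c))" by simp
  then have "q ^ c \<le> lucn q (Suc c)" by (simp only: of_nat_le_iff)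
  then have 1: "q ^ c + q * q \<le> x" by (simp add: x_def)
  have "q * q \<le> q * q * q" "q ^ c \<le> q ^ c * q" "4 \<le> 4 * q" using q by simp_all
  moreover have "(q ^ c + q * q + 4) * q \<le> (x + 4) * q" using 1 by (intro mult_right_mono) auto
  ultimately have 2: "q ^ c + q * q + 4 \<le> (x + 4) * q" unfolding add_mult_distrib by linarith
  then have m: "m + q * q + 1 = (x + 4) * q" and less: "q ^ c < m" unfolding m_def by linarith+
  have "int m = int (x + 4) * int q - int q * int q - 1"
    using arg_cong[OF m, of int] by simp
  then have "int m dvd int (q ^ c + (x + 4) * lucn x c) - int (q * lucn x c + lucn x (Suc c))"
    using luc_power_dvd[of "int (x + 4)" "int q" c] unfolding int_lucn[symmetric] by simp
  then have cong: "[q ^ c + (x + 4) * lucn x c = q * lucn x c + lucn x (Suc c)] (mod m)"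
    by (simp add: cong_iff_dvd_diff flip: cong_int_iff)
  show ?thesis
  proof
    assume "p = q ^ c"
    then show "\<exists>x m. x = lucn q (Suc c) + q * q \<and> m + q * q + 1 = (x + 4) * q \<and> p < m
      \<and> [p + (x + 4) * lucn x c = q * lucn x c + lucn x (Suc c)] (mod m)"
      using m less cong by (intro exI[of _ x] exI[of _ m]) (simp add: x_def)
  next
    assume "\<exists>x m. x = lucn q (Suc c) + q * q \<and> m + q * q + 1 = (x + 4) * q \<and> p < m
      \<and> [p + (x + 4) * lucn x c = q * lucn x c + lucn x (Suc c)] (mod m)"
    then obtain x' m' where "x' = x" "m' + q * q + 1 = (x' + 4) * q" "p < m'"
      "[p + (x' + 4) * lucn x' c = q * lucn x' c + lucn x' (Suc c)] (mod m')"
      unfolding x_def by blast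
    moreover from this m have "m' = m" by simp
    ultimately have "p < m" "[p + (x + 4) * lucn x c = q ^ c + (x + 4) * lucn x c] (mod m)"
      using cong cong_sym cong_trans by blast+
    then show "p = q ^ c" using less by (simp add: cong_add_rcancel_nat cong_less_modulus_unique_nat)
  qed
qed

lemma dfun_pow:
  assumes "dfun F" "dfun G" "\<And>v. 0 < F v"
  shows "dfun (\<lambda>v. F v ^ G v :: nat)"
proof -
  have "dfun (\<lambda>v. Suc (v 0) ^ v 1)"
  proof (rule dfunI)
    let ?q = "\<lambda>W :: nat \<Rightarrow> nat. Suc (W 1)"
    show "dioph (\<lambda>W. \<exists>x m. x = lucn (?q W) (Suc (W 2)) + ?q W * ?q W \<and> m + ?q W * ?q W + 1 = (x + 4) * ?q W
        \<and> W 0 < m \<and> [W 0 + (x + 4) * lucn x (W 2) = ?q W * lucn x (W 2) + lucn x (Suc (W 2))] (mod m))"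
      by (intro dioph_intros)
  qed (subst power_eq_iff_lucn[symmetric], auto simp: numeral_2_eq_2)
  then have "dfun (\<lambda>v. Suc (F v - 1) ^ G v)"
    by (rule dfun_subst2[of "\<lambda>x y. Suc x ^ y", OF _ dfun_pred[OF assms(1,3)] assms(2)])
  then show ?thesis using assms(3) by simp
qed

lemma digit_of_sum:
  fixes w :: nat
  assumes "\<And>i. i < n \<Longrightarrow> a i < w"
  shows "(\<Sum>i<n. a i * w ^ i) div w ^ k mod w = (if k < n then a k else 0)"
  using assms
proof (induction n arbitrary: a k)
  case (Suc n)
  define S where "S = (\<Sum>i<n. a (Suc i) * w ^ i)"
  have "(\<Sum>i<Suc n. a i * w ^ i) = a 0 + w * S"
    unfolding S_def by (simp add: sum.lessThan_Suc_shift sum_distrib_left mult_ac del: sum.lessThan_Suc)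
  moreover have "a 0 < w" using Suc.prems by simp
  moreover have "S div w ^ j mod w = (if j < n then a (Suc j) else 0)" for j
    unfolding S_def using Suc.prems by (intro Suc.IH) simp
  ultimately show ?case
    by (cases k) (simp_all add: div_mult2_eq del: sum.lessThan_Suc)
qed simp

text \<open>The expansion of (w + 1)^n in base w = 2^n + 1 has no carries, since no coefficient
  exceeds 2^n.\<close>

lemma binomial_eq_digit: "(n choose k) = (2 ^ n + 2) ^ n div (2 ^ n + 1) ^ k mod (2 ^ n + 1)"
proof -
  let ?w = "2 ^ n + 1 :: nat"
  have "(2 ^ n + 2) ^ n = (?w + 1) ^ n" by simp
  also have "\<dots> = (\<Sum>i\<le>n. (n choose i) * ?w ^ i)"
    unfolding binomial[of ?w 1 n] by simp
  also have "\<dots> = (\<Sum>i<Suc n. (n choose i) * ?w ^ i)" by (simp only: lessThan_Suc_atMost)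
  also have "\<dots> div ?w ^ k mod ?w = (if k < Suc n then n choose k else 0)"
    by (rule digit_of_sum) (simp add: binomial_le_pow2 less_Suc_eq_le)
  finally show ?thesis by simp
qed

lemma dfun_binomial [dioph_intros]:
  assumes "dfun F" "dfun G"
  shows "dfun (\<lambda>v. F v choose G v)"
proof -
  have "dfun (\<lambda>v. (2 ^ F v + 2) ^ F v div (2 ^ F v + 1) ^ G v mod (2 ^ F v + 1))"
    by (rule dfun_mod dfun_div dfun_pow dfun_add dfun_numeral dfun_1 assms | simp)+
  then show ?thesis unfolding binomial_eq_digit[symmetric] .
qed

text \<open>The product of \<open>fact n\<close> and \<open>r choose n\<close> is the falling
  factorial r (r - 1) ... (r - n + 1). The next lemmas bound it by r^n from above and by r^n (1 -
  n^2 / r) from below.\<close>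

lemma fact_times_binomial_Suc:
  "fact (Suc n) * (r choose Suc n) = (r - n) * (fact n * (r choose n))"
proof -
  have "Suc n * (r choose Suc n) = (r - n) * (r choose n)"
    using binomial_absorption[of n r] binomial_absorb_comp[of r n] by simp
  moreover have "fact (Suc n) * (r choose Suc n) = fact n * (Suc n * (r choose Suc n))"
    by (simp only: fact_Suc of_nat_id mult_ac)
  ultimately show ?thesis by (simp only: mult_ac)
qed

lemma fact_times_binomial_le: "fact n * (r choose n) \<le> r ^ n"
proof (induction n)
  case (Suc n)
  then show ?case unfolding fact_times_binomial_Suc power_Suc by (intro mult_mono) auto
qed simp

lemma le_fact_times_binomial:
  "n \<le> r \<Longrightarrow> r ^ Suc n \<le> r * (fact n * (r choose n)) + n * n * r ^ n"
proof (induction n)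
  case (Suc n)
  define Y where "Y = fact n * (r choose n)"
  have "r * r ^ Suc n \<le> r * (r * Y + n * n * r ^ n)"
    using Suc unfolding Y_def by (intro mult_left_mono) simp_all
  also have "\<dots> = r * ((r - n) * Y) + n * (r * Y) + n * n * r ^ Suc n"
  proof -
    have "r * Y = (r - n) * Y + n * Y" using Suc.prems by (simp flip: add_mult_distrib)
    then have "r * (r * Y) = r * ((r - n) * Y) + n * (r * Y)"
      by (metis add_mult_distrib2 mult.left_commute)
    moreover have "r * (r * Y + n * n * r ^ n) = r * (r * Y) + n * n * r ^ Suc n"
      by (simp add: algebra_simps)
    ultimately show ?thesis by (simp only:)
  qed
  also have "\<dots> \<le> r * ((r - n) * Y) + n * (r * r ^ n) + n * n * r ^ Suc n"
    unfolding Y_def using fact_times_binomial_le by (intro add_mono mult_left_mono) auto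
  also have "\<dots> \<le> r * ((r - n) * Y) + Suc n * Suc n * r ^ Suc n"
    by (simp add: algebra_simps)
  finally show ?case unfolding fact_times_binomial_Suc Y_def power_Suc .
qed simp

text \<open>The quotient of r^n by \<open>r choose n\<close> tends to n! from above. The relative
  error n^2 / r must stay below 1 / (n! + 1) for the integer part to be exact, which is the
  hypothesis.\<close>

lemma fact_eq_div:
  assumes r: "(fact n + 1) * (n * n) + n < r"
  shows "fact n = r ^ n div (r choose n)"
proof (rule div_nat_eqI[symmetric])
  show "(r choose n) * fact n \<le> r ^ n" using fact_times_binomial_le[of n r] by (simp add: mult.commute)
  define C where "C = (r choose n)"
  have le: "r * r ^ n \<le> r * (fact n * C) + n * n * r ^ n"
    using le_fact_times_binomial[of n r] r by (simp add: C_def)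
  show "r ^ n < (r choose n) * Suc (fact n)"
  proof (rule ccontr)
    assume "\<not> ?thesis"
    then have "r * (C * Suc (fact n)) \<le> r * r ^ n" unfolding C_def by (intro mult_left_mono) auto
    with le have "r * C \<le> n * n * r ^ n" by (simp add: algebra_simps)
    then have "fact n * (r * C) \<le> fact n * (n * n * r ^ n)" by (intro mult_left_mono) auto
    moreover have "r * r ^ n \<le> fact n * (r * C) + n * n * r ^ n"
      using le by (simp only: mult.left_commute[of r])
    ultimately have "r * r ^ n \<le> fact n * (n * n * r ^ n) + n * n * r ^ n" by linarith
    also have "\<dots> = ((fact n + 1) * (n * n)) * r ^ n" by (simp add: algebra_simps)
    finally have "r * r ^ n \<le> ((fact n + 1) * (n * n)) * r ^ n" .
    then show False using r by simp
  qed
qed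

lemma dfun_fact [dioph_intros]: "dfun F \<Longrightarrow> dfun (\<lambda>v. fact (F v) :: nat)"
proof -
  assume F: "dfun F"
  \<comment> \<open>The threshold must itself be definable, so n! is replaced by the larger (n +
    1)^n, whose base is positive as \<open>dfun_pow\<close> requires.\<close>
  define r where "r n = (Suc n ^ n + 1) * (n * n) + n + 1" for n
  have r: "(fact n + 1) * (n * n) + n < r n" for n
  proof -
    have "fact n \<le> n ^ n" using fact_le_power[of n, where 'a = nat] by simp
    also have "\<dots> \<le> Suc n ^ n" by (intro power_mono) auto
    finally have "(fact n + 1) * (n * n) \<le> (Suc n ^ n + 1) * (n * n)" by (intro mult_right_mono) auto
    then show ?thesis unfolding r_def by linarith
  qed
  have pos: "0 < r n" "0 < (r n choose n)" for n
    unfolding zero_less_binomial_iff by (simp_all add: r_def)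
  have "dfun (\<lambda>v. r (F v))" unfolding r_def by (intro dioph_intros dfun_pow F) simp_all
  then have "dfun (\<lambda>v. r (F v) ^ F v div (r (F v) choose F v))"
    by (intro dioph_intros dfun_div dfun_pow F pos)
  then show ?thesis unfolding fact_eq_div[OF r] .
qed

section \<open>Bounded universal quantification\<close>

primrec holds_mod :: "nat \<Rightarrow> ('x \<Rightarrow> nat) \<Rightarrow> 'x atom \<Rightarrow> bool" where
  "holds_mod m v (Is_One x) \<longleftrightarrow> [v x = 1] (mod m)"
| "holds_mod m v (Is_Sum x y z) \<longleftrightarrow> [v x + v y = v z] (mod m)"
| "holds_mod m v (Is_Prod x y z) \<longleftrightarrow> [v x * v y = v z] (mod m)"

lemma holds_imp_holds_mod: "holds v A \<Longrightarrow> holds_mod m v A"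
  by (cases A) simp_all

lemma holds_mod_dvd: "holds_mod m v A \<Longrightarrow> d dvd m \<Longrightarrow> holds_mod d v A"
  by (cases A) (auto intro: cong_dvd_modulus_nat)

lemma holds_mod_cong:
  assumes "\<And>x. x \<in> set_atom A \<Longrightarrow> [v x = v' x] (mod m)" "holds_mod m v A"
  shows "holds_mod m v' A"
proof (cases A)
  case (Is_One x)
  with assms show ?thesis using cong_trans[OF cong_sym[of "v x" "v' x" m]] by simp
next
  case (Is_Sum x y z)
  with assms have "[v' x + v' y = v x + v y] (mod m)" "[v x + v y = v z] (mod m)" "[v z = v' z] (mod m)"
    by (simp_all add: cong_add cong_sym)
  then show ?thesis using Is_Sum cong_trans by (metis holds_mod.simps(2))
next
  case (Is_Prod x y z)
  with assms have "[v' x * v' y = v x * v y] (mod m)" "[v x * v y = v z] (mod m)" "[v z = v' z] (mod m)"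
    by (simp_all add: cong_mult cong_sym)
  then show ?thesis using Is_Prod cong_trans by (metis holds_mod.simps(3))
qed

text \<open>Entries up to B give sums up to 2 B and products up to B^2, so a congruence modulo p is
  an equality. The summand 3 also secures \<open>3 \<le> Q\<close> in
  \<open>binomial_coprime_factors\<close>.\<close>

lemma holds_mod_small:
  assumes "\<And>x. x \<in> set_atom A \<Longrightarrow> v x \<le> B" "B * B + 2 * B + 3 < p" "holds_mod p v A"
  shows "holds v A"
proof (cases A)
  case (Is_One x)
  with assms show ?thesis using cong_less_modulus_unique_nat[of "v x" 1 p] by fastforce
next
  case (Is_Sum x y z)
  with assms(1) have "v x \<le> B" "v y \<le> B" "v z \<le> B" by simp_all
  with Is_Sum assms(2,3) show ?thesis
    using cong_less_modulus_unique_nat[of "v x + v y" "v z" p] by simp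
next
  case (Is_Prod x y z)
  with assms(1) have "v x * v y \<le> B * B" "v z \<le> B" by (simp_all add: mult_mono)
  with Is_Prod assms(2,3) show ?thesis
    using cong_less_modulus_unique_nat[of "v x * v y" "v z" p] by simp
qed

lemma holds_mod_prod:
  assumes "\<And>i j. i < y \<Longrightarrow> j < y \<Longrightarrow> i \<noteq> j \<Longrightarrow> coprime (m i) (m j)"
    and "\<And>k. k < (y::nat) \<Longrightarrow> holds_mod (m k) v A"
  shows "holds_mod (\<Prod>k<y. m k) v A"
  using assms by (cases A) (auto intro!: coprime_cong_prod_nat)

lemma dioph_holds_mod:
  assumes "dfun m" "\<And>x. dfun (\<lambda>w. v w x)"
  shows "dioph (\<lambda>w. holds_mod (m w) (v w) A)"
  by (cases A) (auto intro!: dioph_intros assms)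

text \<open>p must divide one of the factors n, n - 1, ..., n - b + 1 of the falling factorial. Thus
  a divisibility bounds the residue of a witness modulo p.\<close>

lemma prime_dvd_binomial:
  fixes p :: nat
  assumes p: "Factorial_Ring.prime p"
  shows "p dvd (n choose b) \<Longrightarrow> \<exists>z<b. [n = z] (mod p)"
proof (induction b)
  case 0
  then show ?case using p by simp
next
  case (Suc b)
  have "Suc b * (n choose Suc b) = (n - b) * (n choose b)"
    using binomial_absorption[of b n] binomial_absorb_comp[of n b] by simp
  with Suc.prems have "p dvd (n - b) * (n choose b)" by (metis dvd_mult)
  then consider "p dvd n - b" | "p dvd (n choose b)" using p by (auto simp: prime_dvd_mult_iff)
  then show ?case
  proof cases
    case 1
    show ?thesis
    proof (cases "b \<le> n")
      case True
      with 1 have "[n = b] (mod p)" by (simp add: cong_altdef_nat)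
      then show ?thesis by blast
    next
      case False
      then show ?thesis by (intro exI[of _ n]) simp
    qed
  next
    case 2
    then show ?thesis using Suc.IH less_SucI by blast
  qed
qed

text \<open>The converse for composite moduli; \<open>fact b\<close> is cancelled later, when m is
  coprime to it.\<close>

lemma dvd_fact_times_binomial:
  assumes "[n = z] (mod m)"
  shows "z < b \<Longrightarrow> m dvd fact b * (n choose b)"
proof (induction b)
  case (Suc b)
  show ?case
  proof (cases "z = b")
    case True
    have "m dvd n - z" using assms by (cases "z \<le> n") (simp_all add: cong_altdef_nat)
    then show ?thesis unfolding fact_times_binomial_Suc True by simp
  next
    case False
    then show ?thesis unfolding fact_times_binomial_Suc using Suc by simp
  qed
qed simp

text \<open>The moduli are \<open>m k = (c - k) div (k + 1)\<close>; their product is \<open>c choose y\<close>, which makes it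
  expressible, and \<open>c\<close> itself represents the index \<open>k\<close> modulo \<open>m k\<close>.\<close>

lemma binomial_coprime_factors:
  fixes c y Q :: nat
  assumes "y \<le> Q" "3 \<le> Q" and dvd: "fact Q * fact Q dvd Suc c"
  obtains m :: "nat \<Rightarrow> nat" where
    "(c choose y) = (\<Prod>k<y. m k)"
    "\<And>k. k < y \<Longrightarrow> [c = k] (mod m k)"
    "\<And>k. k < y \<Longrightarrow> coprime (m k) (fact Q)"
    "\<And>k. k < y \<Longrightarrow> 1 < m k"
    "\<And>i j. i < y \<Longrightarrow> j < y \<Longrightarrow> i \<noteq> j \<Longrightarrow> coprime (m i) (m j)"
proof -
  \<comment> \<open>Dividing c + 1 by k + 1 uses up only one of the two factors
    \<open>fact Q\<close>; the other makes m congruent to -1 modulo \<open>fact Q\<close>, hence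
    coprime to it.\<close>
  have "\<exists>m. Suc k * Suc m = Suc c \<and> fact Q dvd Suc m" if "k < y" for k
  proof -
    have "Suc k dvd fact Q" using that assms by (intro dvd_fact) simp_all
    then obtain h where h: "fact Q = Suc k * h" by blast
    obtain l where "Suc c = fact Q * fact Q * l" using dvd by blast
    then have c: "Suc c = Suc k * (h * fact Q * l)" unfolding h by (simp only: mult_ac)
    then have "h * fact Q * l \<noteq> 0" by (metis mult_0_right nat.distinct(1))
    then obtain n where "h * fact Q * l = Suc n" using not0_implies_Suc by blast
    moreover from this have "fact Q dvd Suc n" by (metis dvd_mult2 dvd_triv_right)
    ultimately show ?thesis using c by (intro exI[of _ n]) simp
  qed
  then obtain m where m: "\<And>k. k < y \<Longrightarrow> Suc k * Suc (m k) = Suc c"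
    and fm: "\<And>k. k < y \<Longrightarrow> fact Q dvd Suc (m k)" by metis
  have c: "c = k + Suc k * m k" if "k < y" for k
    using m[OF that] by simp
  have "n \<le> y \<Longrightarrow> (c choose n) = (\<Prod>k<n. m k)" for n
  proof (induction n)
    case (Suc n)
    have "Suc n * (c choose Suc n) = (c - n) * (c choose n)"
      using binomial_absorption[of n c] binomial_absorb_comp[of c n] by simp
    also have "c - n = Suc n * m n" using c[of n] Suc.prems by simp
    finally have "Suc n * (c choose Suc n) = Suc n * (m n * (c choose n))" by (simp only: mult.assoc)
    then have "(c choose Suc n) = m n * (c choose n)" by (simp only: mult_cancel1) simp
    with Suc show ?case by (simp add: mult.commute)
  qed simp
  then have 1: "(c choose y) = (\<Prod>k<y. m k)" by simp
  have 2: "[c = k] (mod m k)" if "k < y" for k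
    by (subst c[OF that]) (simp add: cong_def del: mult_Suc)
  have 3: "coprime (m k) (fact Q)" if "k < y" for k
  proof (rule coprimeI)
    fix d assume "d dvd m k" "d dvd fact Q"
    then have "d dvd m k" "d dvd Suc (m k)" using fm[OF that] dvd_trans by blast+
    then have "d dvd Suc (m k) - m k" by (rule dvd_diff_nat[rotated])
    then show "is_unit d" by simp
  qed
  have 4: "1 < m k" if "k < y" for k
  proof -
    have "fact 3 \<le> (fact Q :: nat)" using assms by (intro fact_mono_nat)
    moreover have "fact Q \<le> Suc (m k)" using fm[OF that] by (rule dvd_imp_le) simp
    ultimately show ?thesis by (simp add: eval_nat_numeral)
  qed
  have 5: "coprime (m i) (m j)" if "i < y" "j < y" "i \<noteq> j" for i j
    using that
  proof (induction i j rule: linorder_wlog)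
    case (le i j)
    show ?case
    proof (rule coprimeI)
      fix d assume d: "d dvd m i" "d dvd m j"
      \<comment> \<open>The two products are c - i and c - j.\<close>
      have "d dvd Suc i * m i - Suc j * m j" using d by (intro dvd_diff_nat dvd_mult)
      moreover have "Suc i * m i - Suc j * m j = j - i"
        using c[OF le(2)] c[OF le(3)] le by linarith
      moreover have "j - i dvd fact Q" using le assms by (intro dvd_fact) simp_all
      ultimately have "d dvd fact Q" using dvd_trans by metis
      with d(1) 3[OF le(2)] show "is_unit d" using coprime_common_divisor by blast
    qed
  next
    case (sym i j)
    then show ?case by (simp add: coprime_commute)
  qed
  from 1 2 3 4 5 show thesis by (rule that)
qed

text \<open>Take a prime factor p of m k. It exceeds Q since m k is coprime to
  \<open>fact Q\<close>. Modulo p, c is k and every \<open>a j\<close> that occurs is a number up to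
  B, so the atoms hold modulo p between small numbers and therefore outright.\<close>

lemma bounded_all_sound:
  fixes E :: "(nat + nat) atom list"
  assumes y: "y \<le> B" and v: "\<And>i A. A \<in> set E \<Longrightarrow> Inl (Suc i) \<in> set_atom A \<Longrightarrow> v i \<le> B"
    and c: "fact (B * B + 2 * B + 3) * fact (B * B + 2 * B + 3) dvd Suc c"
    and a: "\<And>j A. A \<in> set E \<Longrightarrow> Inr j \<in> set_atom A \<Longrightarrow> (c choose y) dvd (a j choose Suc B)"
    and E: "\<And>A. A \<in> set E \<Longrightarrow> holds_mod (c choose y) (case_sum (case_nat c v) a) A"
    and k: "k < y"
  shows "\<exists>u. \<forall>A\<in>set E. holds (case_sum (case_nat k v) u) A"
proof -
  define Q where "Q = B * B + 2 * B + 3"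
  have "y \<le> Q" "3 \<le> Q" using y by (simp_all add: Q_def)
  obtain m where m: "(c choose y) = (\<Prod>k<y. m k)" "\<And>k. k < y \<Longrightarrow> [c = k] (mod m k)"
    "\<And>k. k < y \<Longrightarrow> coprime (m k) (fact Q)" "\<And>k. k < y \<Longrightarrow> 1 < m k"
    "\<And>i j. i < y \<Longrightarrow> j < y \<Longrightarrow> i \<noteq> j \<Longrightarrow> coprime (m i) (m j)"
    by (rule binomial_coprime_factors[OF \<open>y \<le> Q\<close> \<open>3 \<le> Q\<close> c[folded Q_def]]) (rule that)
  obtain p where p: "Factorial_Ring.prime p" "p dvd m k" using m(4)[OF k] prime_factor_nat[of "m k"] by auto
  have pM: "p dvd (c choose y)" unfolding m(1) using p(2) dvd_prodI[of "{..<y}" k m] k dvd_trans by auto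
  have "Q < p"
  proof (rule ccontr)
    assume "\<not> Q < p"
    then have "p dvd fact Q" using p(1) by (intro dvd_fact) (auto dest: prime_ge_1_nat)
    with p m(3)[OF k] show False using coprime_common_divisor not_prime_unit by blast
  qed
  have "\<exists>z. z \<le> B \<and> [a j = z] (mod p)" if "A \<in> set E" "Inr j \<in> set_atom A" for A j
    using prime_dvd_binomial[OF p(1), of "a j" "Suc B"] dvd_trans[OF pM a[OF that]] less_Suc_eq_le by blast
  then have "\<forall>j. \<exists>z. (\<exists>A\<in>set E. Inr j \<in> set_atom A) \<longrightarrow> z \<le> B \<and> [a j = z] (mod p)" by blast
  then obtain u where u: "\<And>j A. A \<in> set E \<Longrightarrow> Inr j \<in> set_atom A \<Longrightarrow> u j \<le> B \<and> [a j = u j] (mod p)"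
    by metis
  have "holds (case_sum (case_nat k v) u) A" if A: "A \<in> set E" for A
  proof (rule holds_mod_small)
    show "B * B + 2 * B + 3 < p" using \<open>Q < p\<close> by (simp add: Q_def)
    show "case_sum (case_nat k v) u x \<le> B" if "x \<in> set_atom A" for x
      using that v[OF A] u[OF A] k y by (auto split: sum.split nat.split)
    show "holds_mod p (case_sum (case_nat k v) u) A"
    proof (rule holds_mod_cong)
      show "holds_mod p (case_sum (case_nat c v) a) A" using E[OF A] pM by (rule holds_mod_dvd)
      have "[c = k] (mod p)" using m(2)[OF k] p(2) by (rule cong_dvd_modulus_nat)
      then show "[case_sum (case_nat c v) a x = case_sum (case_nat k v) u x] (mod p)" if "x \<in> set_atom A" for x
        using that u[OF A] by (auto split: sum.split nat.split)
    qed
  qed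
  then show ?thesis by blast
qed

text \<open>For each j a single number \<open>a j\<close> carries the j-th witnesses for all k < y,
  as their Chinese remainder over the moduli m k.\<close>

lemma bounded_all_complete:
  fixes E :: "(nat + nat) atom list"
  assumes "\<And>k. k < y \<Longrightarrow> \<exists>u. \<forall>A\<in>set E. holds (case_sum (case_nat k v) u) A"
    and fin: "finite I" "finite J"
  shows "\<exists>B c a. y \<le> B \<and> (\<forall>i\<in>I. v i \<le> B)
    \<and> fact (B * B + 2 * B + 3) * fact (B * B + 2 * B + 3) dvd Suc c
    \<and> (\<forall>j\<in>J. (c choose y) dvd (a j choose Suc B))
    \<and> (\<forall>A\<in>set E. holds_mod (c choose y) (case_sum (case_nat c v) a) A)"
proof -
  obtain U where U: "\<And>k A. k < y \<Longrightarrow> A \<in> set E \<Longrightarrow> holds (case_sum (case_nat k v) (U k)) A"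
    using assms(1) by metis
  define B where "B = y + (\<Sum>i\<in>I. v i) + (\<Sum>k<y. \<Sum>j\<in>J. U k j)"
  define Q where "Q = B * B + 2 * B + 3"
  define c where "c = fact Q * fact Q - (1 :: nat)"
  have c: "fact Q * fact Q dvd Suc c" by (simp add: c_def)
  have yB: "y \<le> B" by (simp add: B_def)
  have vB: "v i \<le> B" if "i \<in> I" for i
    using member_le_sum[OF that, of v] fin by (simp add: B_def)
  have UB: "U k j \<le> B" if "k < y" "j \<in> J" for k j
  proof -
    have "U k j \<le> (\<Sum>j\<in>J. U k j)" using fin that by (intro member_le_sum) auto
    also have "\<dots> \<le> (\<Sum>k<y. \<Sum>j\<in>J. U k j)" using that by (intro member_le_sum) auto
    finally show ?thesis by (simp add: B_def)
  qed
  have "y \<le> Q" "3 \<le> Q" using yB by (simp_all add: Q_def)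
  obtain m where m: "(c choose y) = (\<Prod>k<y. m k)" "\<And>k. k < y \<Longrightarrow> [c = k] (mod m k)"
    "\<And>k. k < y \<Longrightarrow> coprime (m k) (fact Q)" "\<And>k. k < y \<Longrightarrow> 1 < m k"
    "\<And>i j. i < y \<Longrightarrow> j < y \<Longrightarrow> i \<noteq> j \<Longrightarrow> coprime (m i) (m j)"
    by (rule binomial_coprime_factors[OF \<open>y \<le> Q\<close> \<open>3 \<le> Q\<close> c]) (rule that)
  have "\<exists>x. \<forall>k\<in>{..<y}. [x = U k j] (mod m k)" for j
    by (rule chinese_remainder_nat) (use m(5) in auto)
  then obtain a where a: "\<And>j k. k < y \<Longrightarrow> [a j = U k j] (mod m k)" by (metis lessThan_iff)
  have "(c choose y) dvd (a j choose Suc B)" if "j \<in> J" for j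
  proof -
    have "m k dvd (a j choose Suc B)" if "k < y" for k
    proof -
      have "m k dvd fact (Suc B) * (a j choose Suc B)"
        using UB[OF that \<open>j \<in> J\<close>] by (intro dvd_fact_times_binomial[OF a[OF that]]) simp
      moreover have "fact (Suc B) dvd (fact Q :: nat)" by (intro fact_dvd) (simp add: Q_def)
      then have "coprime (m k) (fact (Suc B))" using m(3)[OF that] coprime_divisors dvd_refl by blast
      ultimately show ?thesis by (simp only: coprime_dvd_mult_right_iff)
    qed
    then have "[(a j choose Suc B) = 0] (mod (\<Prod>k<y. m k))"
      using m(5) by (intro coprime_cong_prod_nat) (auto simp: cong_0_iff)
    then show ?thesis unfolding m(1) by (simp only: cong_0_iff)
  qed
  moreover have "holds_mod (c choose y) (case_sum (case_nat c v) a) A" if A: "A \<in> set E" for A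
    unfolding m(1)
  proof (rule holds_mod_prod)
    fix k assume k: "k < y"
    show "holds_mod (m k) (case_sum (case_nat c v) a) A"
    proof (rule holds_mod_cong)
      show "holds_mod (m k) (case_sum (case_nat k v) (U k)) A"
        using U[OF k A] by (rule holds_imp_holds_mod)
      show "[case_sum (case_nat k v) (U k) x = case_sum (case_nat c v) a x] (mod m k)" for x
        using cong_sym[OF m(2)[OF k]] cong_sym[OF a[OF k]] by (auto split: sum.split nat.split)
    qed
  qed (rule m(5))
  ultimately show ?thesis
    using yB vB c unfolding Q_def by (intro exI[of _ B] exI[of _ c] exI[of _ a]) blast
qed

lemma finite_set_atom: "finite (set_atom A)"
  by (cases A) simp_all

lemma dioph_all_less:
  assumes P: "dioph (\<lambda>w. P (\<lambda>i. w (Suc i)) (w 0))" and Y: "dfun Y"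
  shows "dioph (\<lambda>v. \<forall>k<Y v :: nat. P v k)"
proof -
  obtain E :: "(nat + nat) atom list"
    where E: "\<And>w. P (\<lambda>i. w (Suc i)) (w 0) \<longleftrightarrow> (\<exists>u. \<forall>A\<in>set E. holds (case_sum w u) A)"
    using P by (rule diophE) (rule that)
  define V where "V = (\<Union>A\<in>set E. set_atom A)"
  \<comment> \<open>Only parameters and witnesses that occur need bounds, which keeps the
    conjunctions finite. Position 0 is left out: it holds k, which is below
    \<open>Y v\<close>.\<close>
  define I where "I = {i. Inl (Suc i) \<in> V}"
  define J where "J = {j. Inr j \<in> V}"
  have V: "finite V" unfolding V_def by (simp add: finite_set_atom)
  have I: "finite I" unfolding I_def
    using finite_vimageI[OF V, of "\<lambda>i. Inl (Suc i)"] by (simp add: vimage_def inj_def)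
  have J: "finite J" unfolding J_def
    using finite_vimageI[OF V, of Inr] by (simp add: vimage_def)
  define R where "R v \<longleftrightarrow> (\<exists>B c a. Y v \<le> B \<and> (\<forall>i\<in>I. v i \<le> B)
    \<and> fact (B * B + 2 * B + 3) * fact (B * B + 2 * B + 3) dvd Suc c
    \<and> (\<forall>j\<in>J. (c choose Y v) dvd (a j choose Suc B))
    \<and> (\<forall>A\<in>set E. holds_mod (c choose Y v) (case_sum (case_nat c v) a) A))" for v
  have "(\<forall>k<Y v. P v k) \<longleftrightarrow> R v" for v
  proof
    assume "\<forall>k<Y v. P v k"
    then show "R v" unfolding R_def
      using E[of "case_nat k v" for k] by (intro bounded_all_complete I J) simp
  next
    assume "R v"
    then obtain B c a where *: "Y v \<le> B" "\<forall>i\<in>I. v i \<le> B"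
      "fact (B * B + 2 * B + 3) * fact (B * B + 2 * B + 3) dvd Suc c"
      "\<forall>j\<in>J. (c choose Y v) dvd (a j choose Suc B)"
      "\<forall>A\<in>set E. holds_mod (c choose Y v) (case_sum (case_nat c v) a) A"
      unfolding R_def by blast
    have "\<exists>u. \<forall>A\<in>set E. holds (case_sum (case_nat k v) u) A" if "k < Y v" for k
      by (rule bounded_all_sound[OF *(1) _ *(3) _ _ that])
        (use *(2,4,5) in \<open>auto simp: I_def J_def V_def\<close>)
    then show "\<forall>k<Y v. P v k" using E[of "case_nat k v" for k] by simp
  qed
  moreover have "dioph R"
  proof -
    have c: "dfun (\<lambda>w. case_sum (case_nat (w n) (\<lambda>i. w (f i))) (\<lambda>i. w (g i)) x :: nat)" for x n f g
    proof (cases x)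
      case (Inl i)
      then show ?thesis by (cases i) (simp_all add: dfun_var)
    qed (simp add: dfun_var)
    show ?thesis
      unfolding R_def
      by (intro dioph_exfun dioph_holds_mod dioph_intros dfun_rename[OF Y] I J finite_set c)
  qed
  ultimately show ?thesis by simp
qed

section \<open>Graphs of partial recursive functions\<close>

text \<open>A pair (s, w) codes a finite sequence by the digits of s. The base \<open>Suc w\<close>
  is never 0, so no side condition arises in the definability lemmas.\<close>

abbreviation digit :: "nat \<Rightarrow> nat \<Rightarrow> nat \<Rightarrow> nat" where
  "digit s w i \<equiv> s div Suc w ^ i mod Suc w"

lemma dfun_digit:
  assumes "dfun S" "dfun W" "dfun I"
  shows "dfun (\<lambda>v. digit (S v) (W v) (I v))"
  by (intro dfun_mod dfun_div dfun_pow dfun_Suc assms) simp_all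

lemma ex_digits: "\<exists>s w. \<forall>i\<le>n. digit s w i = d i"
proof -
  define w where "w = (\<Sum>i\<le>n. d i)"
  have "d i < Suc w" if "i < Suc n" for i
    using member_le_sum[of i "{..n}" d] that by (simp add: w_def)
  then have "digit (\<Sum>i<Suc n. d i * Suc w ^ i) w k = (if k < Suc n then d k else 0)" for k
    by (rule digit_of_sum)
  then show ?thesis by (metis less_Suc_eq_le)
qed

lemma computes_PrimRec_iff:
  "computes (PrimRec f g) (n # xs) y \<longleftrightarrow>
    (\<exists>d. computes f xs (d 0) \<and> (\<forall>i<n. computes g (i # d i # xs) (d (Suc i))) \<and> y = d n)"
proof
  show "computes (PrimRec f g) (n # xs) y \<Longrightarrow>
    \<exists>d. computes f xs (d 0) \<and> (\<forall>i<n. computes g (i # d i # xs) (d (Suc i))) \<and> y = d n"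
  proof (induction n arbitrary: y)
    case 0
    then have "computes f xs y" by (rule computes_elims)
    then show ?case by (intro exI[of _ "\<lambda>_. y"]) simp
  next
    case (Suc n)
    then obtain z where "computes (PrimRec f g) (n # xs) z" and y: "computes g (n # z # xs) y"
      by (elim computes_elims)
    from Suc.IH[OF this(1)] obtain d where
      "computes f xs (d 0)" "\<forall>i<n. computes g (i # d i # xs) (d (Suc i))" "z = d n"
      by blast
    with y show ?case by (intro exI[of _ "d(Suc n := y)"]) (auto simp: less_Suc_eq)
  qed
next
  assume "\<exists>d. computes f xs (d 0) \<and> (\<forall>i<n. computes g (i # d i # xs) (d (Suc i))) \<and> y = d n"
  then obtain d where d: "computes f xs (d 0)" "\<forall>i<n. computes g (i # d i # xs) (d (Suc i))" "y = d n"
    by blast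
  have "m \<le> n \<Longrightarrow> computes (PrimRec f g) (m # xs) (d m)" for m
  proof (induction m)
    case 0
    show ?case using d(1) by (rule computes.prim_0)
  next
    case (Suc m)
    then show ?case using d(2) by (intro computes.prim_Suc[of _ _ _ _ "d m"]) simp_all
  qed
  then show "computes (PrimRec f g) (n # xs) y" using d(3) by simp
qed

lemma computes_PrimRec_digits:
  "computes (PrimRec f g) (n # xs) y \<longleftrightarrow>
    (\<exists>s w. computes f xs (digit s w 0) \<and>
      (\<forall>i<n. computes g (i # digit s w i # xs) (digit s w (Suc i))) \<and> y = digit s w n)"
proof
  assume "computes (PrimRec f g) (n # xs) y"
  then obtain d where d: "computes f xs (d 0)" "\<forall>i<n. computes g (i # d i # xs) (d (Suc i))" "y = d n"
    unfolding computes_PrimRec_iff by blast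
  obtain s w where "\<forall>i\<le>n. digit s w i = d i" using ex_digits by blast
  with d show "\<exists>s w. computes f xs (digit s w 0) \<and>
      (\<forall>i<n. computes g (i # digit s w i # xs) (digit s w (Suc i))) \<and> y = digit s w n"
    by (intro exI[of _ s] exI[of _ w]) (simp del: power.simps)
next
  assume "\<exists>s w. computes f xs (digit s w 0) \<and>
      (\<forall>i<n. computes g (i # digit s w i # xs) (digit s w (Suc i))) \<and> y = digit s w n"
  then obtain s w where "computes f xs (digit s w 0)"
    "\<forall>i<n. computes g (i # digit s w i # xs) (digit s w (Suc i))" "y = digit s w n" by blast
  then show "computes (PrimRec f g) (n # xs) y"
    unfolding computes_PrimRec_iff by (intro exI[of _ "\<lambda>i. digit s w i"] conjI)
qed

lemma dioph_False: "dioph (\<lambda>v. False)"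
  using dioph_eq[OF dfun_0 dfun_1] by simp

text \<open>Arbitrary definable functions are allowed as arguments and value because the induction
  hypotheses are applied to digits, quantified values and shifted parameters. Argument lists of the
  wrong length simply yield a false predicate.\<close>

lemma dioph_computes:
  "(\<And>F. F \<in> set Fs \<Longrightarrow> dfun F) \<Longrightarrow> dfun G \<Longrightarrow> dioph (\<lambda>v. computes h (map (\<lambda>F. F v) Fs) (G v))"
proof (induction h arbitrary: Fs G)
  case Zero
  have "computes Zero xs y \<longleftrightarrow> y = 0" for xs y
    by (auto intro: computes.intros elim: computes_elims)
  then show ?case using Zero by (simp add: dioph_eq dfun_0)
next
  case Succ
  have *: "computes Succ xs y \<longleftrightarrow> (\<exists>x. xs = [x] \<and> y = Suc x)" for xs y
    by (auto intro: computes.intros elim: computes_elims)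
  show ?case
  proof (cases "\<exists>F. Fs = [F]")
    case True
    then obtain F where F: "Fs = [F]" by blast
    then have "dioph (\<lambda>v. G v = Suc (F v))" using Succ by (intro dioph_eq dfun_Suc) simp_all
    then show ?thesis by (simp add: * F)
  next
    case False
    then have "\<not> computes Succ (map (\<lambda>F. F v) Fs) y" for v y unfolding * by auto
    then show ?thesis by (simp add: dioph_False)
  qed
next
  case (Proj i)
  have *: "computes (Proj i) xs y \<longleftrightarrow> i < length xs \<and> y = xs ! i" for xs y
    by (auto intro: computes.intros elim: computes_elims)
  show ?case using Proj by (cases "i < length Fs") (simp_all add: * dioph_False dioph_eq)
next
  case (Comp f gs)
  let ?n = "length gs"
  have *: "computes (Comp f gs) xs y \<longleftrightarrow>
    (\<exists>a. (\<forall>i\<in>{..<?n}. computes (gs ! i) xs (a i)) \<and> computes f (map a [0..<?n]) y)" for xs y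
  proof
    assume "computes (Comp f gs) xs y"
    then obtain ys where ys: "list_all2 (\<lambda>g. computes g xs) gs ys" and y: "computes f ys y"
      by (rule computes_elims)
    then have "length ys = ?n" by (simp add: list_all2_lengthD)
    then have "map ((!) ys) [0..<?n] = ys" using map_nth[of ys] by simp
    with ys y show "\<exists>a. (\<forall>i\<in>{..<?n}. computes (gs ! i) xs (a i)) \<and> computes f (map a [0..<?n]) y"
      by (intro exI[of _ "(!) ys"]) (auto simp: list_all2_conv_all_nth)
  next
    assume "\<exists>a. (\<forall>i\<in>{..<?n}. computes (gs ! i) xs (a i)) \<and> computes f (map a [0..<?n]) y"
    then show "computes (Comp f gs) xs y"
      by (auto intro!: computes.comp simp: list_all2_conv_all_nth)
  qed
  \<comment> \<open>As in \<open>dioph_exfun\<close>, parameters sit at even positions and the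
    values of the \<open>gs\<close> at odd ones.\<close>
  let ?Fs = "map (\<lambda>F w. F (\<lambda>i. w (2 * i))) Fs"
  have Fs: "dfun F" if "F \<in> set ?Fs" for F using that Comp.prems by (auto intro: dfun_rename)
  have "dioph (\<lambda>w. computes (gs ! i) (map (\<lambda>F. F w) ?Fs) (w (2 * i + 1)))" if "i < ?n" for i
    using that by (intro Comp.IH(2) Fs dfun_var) simp_all
  moreover have "dioph (\<lambda>w. computes f (map (\<lambda>F. F w) (map (\<lambda>i w. w (2 * i + 1)) [0..<?n]))
      (G (\<lambda>i. w (2 * i))))"
    by (intro Comp.IH(1)) (auto intro: dfun_var dfun_rename Comp.prems)
  ultimately have "dioph (\<lambda>v. \<exists>a. (\<forall>i\<in>{..<?n}. computes (gs ! i) (map (\<lambda>F. F v) Fs) (a i))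
      \<and> computes f (map a [0..<?n]) (G v))"
    by (intro dioph_exfun dioph_conj dioph_ball) (simp_all add: o_def)
  then show ?case unfolding * .
next
  case (PrimRec f g)
  show ?case
  proof (cases Fs)
    case Nil
    have "\<not> computes (PrimRec f g) [] y" for y
      by (auto elim: computes.cases)
    then show ?thesis using Nil by (simp add: dioph_False)
  next
    case (Cons F Fs')
    have F: "dfun F" and Fs': "\<And>F. F \<in> set Fs' \<Longrightarrow> dfun F" using PrimRec.prems Cons by auto
    let ?Fs = "\<lambda>n. map (\<lambda>F w. F (\<lambda>i. w (i + n))) Fs'"
    have Fs: "dfun F" if "F \<in> set (?Fs n)" for F n using that Fs' by (auto intro: dfun_rename)
    \<comment> \<open>Positions count from the innermost quantifier: w is 0 and s is 1 here; under
      the bounded quantifier i is 0, w is 1 and s is 2.\<close>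
    have 1: "dioph (\<lambda>w. computes f (map (\<lambda>F. F w) (?Fs 2)) (digit (w 1) (w 0) 0))"
    proof (rule PrimRec.IH(1))
      show "dfun F" if "F \<in> set (?Fs 2)" for F using that by (rule Fs)
      show "dfun (\<lambda>w. digit (w 1) (w 0) 0)" by (intro dfun_digit dfun_var dfun_0)
    qed
    have "dioph (\<lambda>w. computes g (map (\<lambda>F. F w)
        ((\<lambda>w. w 0) # (\<lambda>w. digit (w 2) (w 1) (w 0)) # ?Fs 3)) (digit (w 2) (w 1) (Suc (w 0))))"
    proof (rule PrimRec.IH(2))
      have "dfun (\<lambda>w. digit (w 2) (w 1) (w 0))" by (intro dfun_digit dfun_var)
      then show "dfun F" if "F \<in> set ((\<lambda>w. w 0) # (\<lambda>w. digit (w 2) (w 1) (w 0)) # ?Fs 3)" for F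
        using that Fs[of F 3] dfun_var[of 0] by (auto simp del: set_map)
      show "dfun (\<lambda>w. digit (w 2) (w 1) (Suc (w 0)))" by (intro dfun_digit dfun_Suc dfun_var)
    qed
    then have "dioph (\<lambda>v. \<forall>i<F (\<lambda>i. v (i + 2)). computes g
        (i # digit (v 1) (v 0) i # map (\<lambda>F. F (\<lambda>i. v (i + 2))) Fs') (digit (v 1) (v 0) (Suc i)))"
      by (intro dioph_all_less dfun_rename[OF F]) (simp add: o_def numeral_2_eq_2 numeral_3_eq_3)
    then have "dioph (\<lambda>v. \<exists>s w. computes f (map (\<lambda>F. F v) Fs') (digit s w 0) \<and>
      (\<forall>i<F v. computes g (i # digit s w i # map (\<lambda>F. F v) Fs') (digit s w (Suc i)))
       \<and> G v = digit s w (F v))"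
      using 1 F PrimRec.prems(2)
      by (intro dioph_ex dioph_conj dioph_eq dfun_digit dfun_rename[OF F] dfun_rename[OF PrimRec.prems(2)] dfun_var)
        (simp_all add: o_def numeral_2_eq_2)
    then show ?thesis by (simp only: Cons list.map computes_PrimRec_digits)
  qed
next
  case (Mu f)
  have *: "computes (Mu f) xs n \<longleftrightarrow> computes f (n # xs) 0 \<and> (\<forall>m<n. \<exists>k. computes f (m # xs) (Suc k))" for xs n
  proof
    assume "computes (Mu f) xs n"
    then show "computes f (n # xs) 0 \<and> (\<forall>m<n. \<exists>k. computes f (m # xs) (Suc k))"
      by (rule computes_elims) (metis gr0_implies_Suc)
  next
    assume "computes f (n # xs) 0 \<and> (\<forall>m<n. \<exists>k. computes f (m # xs) (Suc k))"
    then show "computes (Mu f) xs n" by (intro computes.mu) auto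
  qed
  let ?Fs = "map (\<lambda>F w. F (\<lambda>i. w (Suc (Suc i)))) Fs"
  have Fs: "dfun F" if "F \<in> set ?Fs" for F using that Mu.prems by (auto intro: dfun_rename)
  have "dioph (\<lambda>w. computes f (map (\<lambda>F. F w) (G # Fs)) 0)"
    using Mu.prems by (intro Mu.IH dfun_0) auto
  moreover have "dioph (\<lambda>w. computes f (map (\<lambda>F. F w) ((\<lambda>w. w 1) # ?Fs)) (Suc (w 0)))"
    using Fs by (intro Mu.IH dioph_intros) (auto intro: dfun_var)
  then have "dioph (\<lambda>v. \<forall>m<G v. \<exists>k. computes f (m # map (\<lambda>F. F v) Fs) (Suc k))"
    by (intro dioph_all_less dioph_ex Mu.prems(2)) (simp add: o_def)
  ultimately have "dioph (\<lambda>v. computes f (G v # map (\<lambda>F. F v) Fs) 0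
      \<and> (\<forall>m<G v. \<exists>k. computes f (m # map (\<lambda>F. F v) Fs) (Suc k)))"
    by (intro dioph_conj) simp_all
  then show ?case unfolding * .
qed

text \<open>Used for codes of words containing a block that is repeated a variable number of
  times.\<close>

lemma dfun_funpow:
  fixes h :: "nat \<Rightarrow> nat"
  assumes h: "dfun (\<lambda>v. h (v 0))"
  shows "dfun (\<lambda>v. (h ^^ v 0) c)"
proof (rule dfunI)
  have *: "dfun (\<lambda>v. h (F v))" if "dfun F" for F by (rule dfun_subst1[OF h that])
  show "dioph (\<lambda>v. \<exists>s w. digit s w 0 = c \<and> (\<forall>i<v 1. digit s w (Suc i) = h (digit s w i)) \<and> digit s w (v 1) = v 0)"
    by (intro dioph_ex dioph_conj dioph_all_less dioph_eq dfun_digit * dfun_const dfun_var dfun_Suc)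
next
  fix v :: "nat \<Rightarrow> nat"
  have iter: "digit s w i = (h ^^ i) c"
    if s: "digit s w 0 = c" "\<forall>i<n. digit s w (Suc i) = h (digit s w i)" and "i \<le> n" for s w n i
    using that(3)
  proof (induction i)
    case 0
    show ?case unfolding s(1) by simp
  next
    case (Suc i)
    then have "digit s w (Suc i) = h (digit s w i)" using s(2) by (simp only: Suc_le_lessD)
    with Suc show ?case by (simp only: Suc_leD funpow.simps o_apply)
  qed
  obtain s w where "\<forall>i\<le>v 1. digit s w i = (h ^^ i) c" using ex_digits[of "v 1" "\<lambda>i. (h ^^ i) c"] by (elim exE)
  then have d: "digit s w i = (h ^^ i) c" if "i \<le> v 1" for i using that by blast
  have "digit s w 0 = c \<and> (\<forall>i<v 1. digit s w (Suc i) = h (digit s w i)) \<and> digit s w (v 1) = (h ^^ v 1) c"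
    by (intro conjI allI impI) (simp_all only: d funpow.simps o_apply id_apply less_imp_le Suc_leI le0 order_refl)
  note ex = this
  show "(\<exists>s w. digit s w 0 = c \<and> (\<forall>i<v 1. digit s w (Suc i) = h (digit s w i)) \<and> digit s w (v 1) = v 0)
    \<longleftrightarrow> (h ^^ v (Suc 0)) c = v 0"
  proof
    assume "(h ^^ v (Suc 0)) c = v 0"
    then have "(h ^^ v 1) c = v 0" by simp
    from ex[unfolded this] show "\<exists>s w. digit s w 0 = c \<and> (\<forall>i<v 1. digit s w (Suc i) = h (digit s w i)) \<and> digit s w (v 1) = v 0"
      by (intro exI)
  next
    assume "\<exists>s w. digit s w 0 = c \<and> (\<forall>i<v 1. digit s w (Suc i) = h (digit s w i)) \<and> digit s w (v 1) = v 0"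
    then obtain s w where "digit s w 0 = c" "\<forall>i<v 1. digit s w (Suc i) = h (digit s w i)" "digit s w (v 1) = v 0"
      by (elim exE conjE)
    from iter[OF this(1,2) order_refl] this(3) have "(h ^^ v 1) c = v 0" by (simp only:)
    then show "(h ^^ v (Suc 0)) c = v 0" by simp
  qed
qed

lemma dfun_prod_encode:
  assumes "dfun F" "dfun G"
  shows "dfun (\<lambda>v. prod_encode (F v, G v))"
  unfolding prod_encode_def triangle_def prod.case
  by (intro dfun_div dfun_add dfun_mult dfun_Suc dfun_numeral assms) simp

section \<open>From naturals to integers\<close>

lemma squares_mod_eq:
  fixes x y :: nat
  assumes p: "Factorial_Ring.prime p" and "2 * x < p" "2 * y < p" "int p dvd int x * int x - int y * int y"
  shows "x = y"
proof -
  have "int p dvd (int x - int y) * (int x + int y)" using assms(4) by (simp add: algebra_simps)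
  then consider "int p dvd int x - int y" | "int p dvd int x + int y"
    using p by (auto simp: prime_dvd_mult_iff)
  then show ?thesis
  proof cases
    case 1
    show ?thesis
    proof (rule ccontr)
      assume "x \<noteq> y"
      then have "int p \<le> \<bar>int x - int y\<bar>" using 1 dvd_imp_le_int[of "int x - int y" "int p"] by simp
      then show False using assms(2,3) by linarith
    qed
  next
    case 2
    then have "p dvd x + y" by (metis int_dvd_int_iff of_nat_add)
    then have "x + y = 0 \<or> p \<le> x + y" using dvd_imp_le by blast
    then show ?thesis using assms(2,3) by linarith
  qed
qed

text \<open>Pigeonhole: x^2 and -1 - y^2 each take (p + 1) / 2 values modulo p, so they share
  one.\<close>

lemma prime_dvd_one_plus_squares:
  assumes p: "Factorial_Ring.prime p" "odd p"
  shows "\<exists>x y :: nat. 2 * x < p \<and> 2 * y < p \<and> int p dvd 1 + int x * int x + int y * int y"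
proof -
  define h where "h = p div 2"
  have h: "2 * x < p \<longleftrightarrow> x \<le> h" for x using p(2) unfolding h_def by (auto elim!: oddE)
  have p0: "0 < p" using p prime_gt_0_nat by blast
  define f where "f x = (int x * int x) mod int p" for x :: nat
  define g where "g y = (- 1 - int y * int y) mod int p" for y :: nat
  have "inj_on f {..h}"
  proof (rule inj_onI)
    fix x y assume "x \<in> {..h}" "y \<in> {..h}" "f x = f y"
    then show "x = y" using h by (intro squares_mod_eq[OF p(1)]) (simp_all add: f_def mod_eq_dvd_iff)
  qed
  then have f: "card (f ` {..h}) = Suc h" by (simp add: card_image)
  have "inj_on g {..h}"
  proof (rule inj_onI)
    fix x y assume "x \<in> {..h}" "y \<in> {..h}" "g x = g y"
    then show "x = y" using h by (intro squares_mod_eq[OF p(1), symmetric]) (simp_all add: g_def mod_eq_dvd_iff)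
  qed
  then have g: "card (g ` {..h}) = Suc h" by (simp add: card_image)
  have "f ` {..h} \<inter> g ` {..h} \<noteq> {}"
  proof
    assume "f ` {..h} \<inter> g ` {..h} = {}"
    then have "card (f ` {..h} \<union> g ` {..h}) = 2 * Suc h" by (simp add: card_Un_disjoint f g)
    moreover have "f ` {..h} \<union> g ` {..h} \<subseteq> {0..<int p}" using p0 by (auto simp: f_def g_def)
    then have "card (f ` {..h} \<union> g ` {..h}) \<le> card {0..<int p}" by (intro card_mono) auto
    ultimately show False using p(2) unfolding h_def by (auto elim!: oddE)
  qed
  then obtain x y where "x \<le> h" "y \<le> h" "f x = g y" by auto
  then have "int p dvd int x * int x - (- 1 - int y * int y)" unfolding f_def g_def mod_eq_dvd_iff by simp
  then show ?thesis using h \<open>x \<le> h\<close> \<open>y \<le> h\<close> by (intro exI[of _ x] exI[of _ y]) (simp add: algebra_simps)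
qed

definition sum4sq :: "int \<Rightarrow> bool" where
  "sum4sq n \<longleftrightarrow> (\<exists>a b c d. n = a * a + b * b + c * c + d * d)"

text \<open>Euler's identity, the multiplicativity of the quaternion norm.\<close>

lemma sum4sq_mult:
  assumes "sum4sq m" "sum4sq n"
  shows "sum4sq (m * n)"
proof -
  obtain a b c d where m: "m = a * a + b * b + c * c + d * d" using assms unfolding sum4sq_def by blast
  obtain p q r s where n: "n = p * p + q * q + r * r + s * s" using assms unfolding sum4sq_def by blast
  have "m * n = (a * p + b * q + c * r + d * s) * (a * p + b * q + c * r + d * s)
    + (a * q - b * p + c * s - d * r) * (a * q - b * p + c * s - d * r)
    + (a * r - b * s - c * p + d * q) * (a * r - b * s - c * p + d * q)
    + (a * s + b * r - c * q - d * p) * (a * s + b * r - c * q - d * p)"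
    unfolding m n by (simp add: algebra_simps)
  then show ?thesis unfolding sum4sq_def by blast
qed

text \<open>Allowing the denominator \<open>w\<close> replaces Lagrange's descent by a plain induction.\<close>

lemma rational_four_squares: "\<exists>w\<noteq>0. sum4sq (int n * (w * w))"
proof (induction n rule: less_induct)
  case (less n)
  consider "n \<le> 2" | "2 < n" "Factorial_Ring.prime n" | "2 < n" "\<not> Factorial_Ring.prime n" by linarith
  then show ?case
  proof cases
    case 1
    then consider "n = 0" | "n = 1" | "n = 2" by linarith
    then have "sum4sq (int n * (1 * 1))"
    proof cases
      case 1
      then show ?thesis unfolding sum4sq_def by (intro exI[of _ 0]) simp
    next
      case 2
      then show ?thesis unfolding sum4sq_def by (intro exI[of _ 1] exI[of _ 0]) simp
    next
      case 3
      then have "int n * (1 * 1) = 1 * 1 + 1 * 1 + 0 * 0 + 0 * 0" by simp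
      then show ?thesis unfolding sum4sq_def by blast
    qed
    then show ?thesis by (intro exI[of _ 1]) simp
  next
    case 2
    then have "odd n" using prime_odd_nat by blast
    then obtain x y where xy: "2 * x < n" "2 * y < n" "int n dvd 1 + int x * int x + int y * int y"
      using prime_dvd_one_plus_squares 2 by blast
    then obtain k where k: "1 + int x * int x + int y * int y = int n * k" by blast
    have "int n * k > 0" unfolding k[symmetric] by (simp add: add_pos_nonneg)
    then have "k > 0" by (simp add: zero_less_mult_iff)
    define m where "m = nat k"
    have m: "int m = k" "0 < m" using \<open>k > 0\<close> by (simp_all add: m_def)
    have "m < n"
    proof -
      have "4 * (x * x) \<le> n * n" "4 * (y * y) \<le> n * n"
        using mult_mono[of "2 * x" n "2 * x" n] mult_mono[of "2 * y" n "2 * y" n] xy by simp_all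
      moreover have "int (1 + x * x + y * y) = int (n * m)" using k by (simp add: m)
      then have "1 + x * x + y * y = n * m" by (simp only: of_nat_eq_iff)
      moreover have "3 * 3 \<le> n * n" using \<open>2 < n\<close> by (intro mult_mono) auto
      ultimately have "n * m < n * n" by linarith
      then show ?thesis by simp
    qed
    then obtain w where w: "w \<noteq> 0" "sum4sq (int m * (w * w))" using less by blast
    \<comment> \<open>n (k w)^2 is the product of n k = 1 + x^2 + y^2 and k w^2, the latter a sum of
      four squares by induction as k < n.\<close>
    have "sum4sq (int n * k)" unfolding k[symmetric] sum4sq_def
      by (intro exI[of _ 1] exI[of _ "int x"] exI[of _ "int y"] exI[of _ 0]) simp
    from sum4sq_mult[OF this w(2)] have "sum4sq (int n * ((k * w) * (k * w)))"
      unfolding m by (simp add: mult_ac)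
    then show ?thesis using w(1) \<open>k > 0\<close> by (intro exI[of _ "k * w"]) simp
  next
    case 3
    then obtain a b where ab: "n = a * b" "a < n" "b < n"
    proof -
      obtain a where a: "a dvd n" "a \<noteq> 1" "a \<noteq> n" using 3 by (auto simp: prime_nat_iff)
      then obtain b where b: "n = a * b" by blast
      have "a < n" using a 3 dvd_imp_le[of a n] by simp
      moreover have "0 < a" "0 < b" using b 3 by (auto intro!: gr0I)
      then have "b < n" using b a(2) by simp
      ultimately show thesis using b by (intro that)
    qed
    obtain w w' where "w \<noteq> 0" "sum4sq (int a * (w * w))" "w' \<noteq> 0" "sum4sq (int b * (w' * w'))"
      using less ab by meson
    then have "sum4sq (int n * ((w * w') * (w * w')))"
      using sum4sq_mult[of "int a * (w * w)" "int b * (w' * w')"] by (simp add: ab mult_ac)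
    then show ?thesis using \<open>w \<noteq> 0\<close> \<open>w' \<noteq> 0\<close> by (intro exI[of _ "w * w'"]) simp
  qed
qed

text \<open>Nonvanishing in positive form. A nonzero integer is an odd number times a power of 2,
  and a power of 2 divides a power of 4, which has the form 3 b + 1. Conversely neither factor on
  the left can vanish.\<close>

lemma int_nonzero_iff: "w \<noteq> (0 :: int) \<longleftrightarrow> (\<exists>a b c. (2 * a + 1) * (3 * b + 1) = w * c)"
proof
  show "w \<noteq> 0 \<Longrightarrow> \<exists>a b c. (2 * a + 1) * (3 * b + 1) = w * c"
  proof (induction "nat \<bar>w\<bar>" arbitrary: w rule: less_induct)
    case less
    show ?case
    proof (cases "even w")
      case True
      then obtain z where z: "w = 2 * z" by blast
      have "nat \<bar>z\<bar> < nat \<bar>w\<bar>" "z \<noteq> 0" using less.prems by (auto simp: z abs_mult)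
      from less.hyps[OF this] obtain a b c where "(2 * a + 1) * (3 * b + 1) = z * c" by blast
      \<comment> \<open>Passing from b to 4 b + 1 multiplies 3 b + 1 by 4; one factor 2 goes into w
        and the other into c.\<close>
      then have "(2 * a + 1) * (3 * (4 * b + 1) + 1) = w * (2 * c)" by (simp add: z algebra_simps)
      then show ?thesis by blast
    next
      case False
      then obtain a where "w = 2 * a + 1" by (rule oddE)
      then have "(2 * a + 1) * (3 * 0 + 1) = w * 1" by simp
      then show ?thesis by blast
    qed
  qed
next
  assume "\<exists>a b c. (2 * a + 1) * (3 * b + 1) = w * c"
  then obtain a b c where "(2 * a + 1) * (3 * b + 1) = w * c" by blast
  moreover have "2 * a + 1 \<noteq> 0" "3 * b + 1 \<noteq> 0" by presburger+
  ultimately show "w \<noteq> 0" by auto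
qed

text \<open>A four-square representation with denominator w, where e, f and g express that w is
  nonzero.\<close>

lemma int_nonneg_iff: "0 \<le> (x :: int) \<longleftrightarrow> (\<exists>w a b c d e f g. (2 * e + 1) * (3 * f + 1) = w * g
  \<and> x * (w * w) = a * a + b * b + c * c + d * d)" (is "_ \<longleftrightarrow> ?R")
proof
  assume "0 \<le> x"
  then obtain w where "w \<noteq> 0" "sum4sq (x * (w * w))" using rational_four_squares[of "nat x"] by auto
  then show ?R unfolding int_nonzero_iff sum4sq_def by blast
next
  assume ?R
  then obtain w a b c d where w: "w \<noteq> 0" and "x * (w * w) = a * a + b * b + c * c + d * d"
    unfolding int_nonzero_iff by blast
  then have "0 \<le> x * (w * w)" by simp
  moreover have "0 < w * w" using w by (metis not_square_less_zero linorder_neqE_linordered_idom mult_eq_0_iff)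
  ultimately show "0 \<le> x" by (simp add: zero_le_mult_iff)
qed

lemma dioph_int_nonneg: "dfun F \<Longrightarrow> dioph (\<lambda>v. 0 \<le> (F v :: int))"
proof (rule dioph_subst1)
  show "dioph (\<lambda>v. 0 \<le> (v 0 :: int))" unfolding int_nonneg_iff by (intro dioph_intros)
qed

lemma dioph_holds:
  assumes "\<And>x. dfun (\<lambda>w. v w x)"
  shows "dioph (\<lambda>w. holds (v w) A)"
  by (cases A) (auto intro!: dioph_intros assms)

lemma holds_int: "(\<And>x. x \<in> set_atom A \<Longrightarrow> v x = int (v' x)) \<Longrightarrow> holds v A \<longleftrightarrow> holds v' A"
  by (cases A) (simp_all flip: of_nat_add of_nat_mult)

text \<open>The same atoms are read over the integers, with every witness that occurs forced to be
  nonnegative. Constant valuations suffice because the diagonal argument has a single input.\<close>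

lemma dioph_nat_to_int:
  fixes R :: "(nat \<Rightarrow> nat) \<Rightarrow> bool"
  assumes "dioph R"
  obtains E :: "(nat + nat) atom list" where
    "\<And>n. R (\<lambda>_. n) \<longleftrightarrow> (\<exists>u. \<forall>A\<in>set E. holds (case_sum (\<lambda>_. int n) u) A)"
proof -
  obtain E0 :: "(nat + nat) atom list"
    where E0: "\<And>v. R v \<longleftrightarrow> (\<exists>u. \<forall>A\<in>set E0. holds (case_sum v u) A)"
    using assms by (rule diophE) (rule that)
  define J where "J = Inr -` (\<Union>A\<in>set E0. set_atom A)"
  have J: "finite J" unfolding J_def by (intro finite_vimageI) (simp_all add: finite_set_atom)
  define Q where "Q v \<longleftrightarrow> (\<exists>u. (\<forall>j\<in>J. 0 \<le> u j) \<and> (\<forall>A\<in>set E0. holds (case_sum v u) A))"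
    for v :: "nat \<Rightarrow> int"
  have "dfun (\<lambda>w. case_sum (\<lambda>i. w (f i)) (\<lambda>i. w (g i)) x :: int)" for x f g
    by (cases x) (simp_all add: dfun_var)
  then have "dioph Q" unfolding Q_def
    by (intro dioph_exfun dioph_conj dioph_ball dioph_holds dioph_int_nonneg dfun_var J finite_set)
  then obtain E :: "(nat + nat) atom list"
    where E: "\<And>v. Q v \<longleftrightarrow> (\<exists>u. \<forall>A\<in>set E. holds (case_sum v u) A)"
    by (rule diophE) (rule that)
  have "R (\<lambda>_. n) \<longleftrightarrow> Q (\<lambda>_. int n)" for n
  proof
    assume "R (\<lambda>_. n)"
    then obtain u where u: "\<forall>A\<in>set E0. holds (case_sum (\<lambda>_. n) u) A" unfolding E0 by blast
    have "holds (case_sum (\<lambda>_. int n) (\<lambda>j. int (u j))) A \<longleftrightarrow> holds (case_sum (\<lambda>_. n) u) A" for A :: "(nat + nat) atom"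
      by (rule holds_int) (simp split: sum.split)
    with u show "Q (\<lambda>_. int n)" unfolding Q_def by (intro exI[of _ "\<lambda>j. int (u j)"] conjI ballI) simp_all
  next
    assume "Q (\<lambda>_. int n)"
    then obtain u where u: "\<forall>j\<in>J. 0 \<le> u j" "\<forall>A\<in>set E0. holds (case_sum (\<lambda>_. int n) u) A"
      unfolding Q_def by blast
    have "holds (case_sum (\<lambda>_. int n) u) A \<longleftrightarrow> holds (case_sum (\<lambda>_. n) (\<lambda>j. nat (u j))) A"
      if "A \<in> set E0" for A
      by (rule holds_int) (use u(1) that in \<open>auto simp: J_def split: sum.split\<close>)
    with u(2) show "R (\<lambda>_. n)" unfolding E0 by blast
  qed
  then show thesis using E by (intro that) simp
qed

section \<open>The integral Heisenberg group\<close>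

text \<open>\<open>(x, y, z)\<close> is the upper unitriangular matrix with \<open>x\<close>, \<open>y\<close> next to the diagonal and \<open>z\<close> in the
  corner.\<close>

definition heis_int :: "(int \<times> int \<times> int) monoid" where
  "heis_int = \<lparr>carrier = UNIV,
     monoid.mult = (\<lambda>(x, y, z) (x', y', z'). (x + x', y + y', z + z' + x * y')),
     monoid.one = (0, 0, 0)\<rparr>"

lemma heis_int_simps [simp]:
  "carrier heis_int = UNIV"
  "(x, y, z) \<otimes>\<^bsub>heis_int\<^esub> (x', y', z') = (x + x', y + y', z + z' + x * y')"
  "\<one>\<^bsub>heis_int\<^esub> = (0, 0, 0)"
  by (simp_all add: heis_int_def)

lemma group_heis_int: "group heis_int"
proof (rule groupI)
  fix g :: "int \<times> int \<times> int"
  obtain x y z where "g = (x, y, z)" by (cases g)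
  then show "\<exists>h\<in>carrier heis_int. h \<otimes>\<^bsub>heis_int\<^esub> g = \<one>\<^bsub>heis_int\<^esub>"
    by (intro bexI[of _ "(- x, - y, x * y - z)"]) simp_all
qed (auto simp: algebra_simps)

lemma inv_heis_int [simp]: "inv\<^bsub>heis_int\<^esub> (x, y, z) = (- x, - y, x * y - z)"
  by (rule group.inv_equality[OF group_heis_int]) simp_all

lemma commutator_heis_int [simp]:
  "commutator heis_int (x, y, z) (x', y', z') = (0, 0, x * y' - x' * y)"
  by (simp add: commutator_def algebra_simps)

context group
begin

text \<open>Conjugation by v is an endomorphism that sends u to u w, and the n-th power of u w
  splits as u and w commute.\<close>

lemma int_pow_swap:
  assumes G: "u \<in> carrier G" "v \<in> carrier G" "w \<in> carrier G"
    and uv: "u \<otimes> v = v \<otimes> u \<otimes> w" and uw: "u \<otimes> w = w \<otimes> u"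
  shows "u [^] (n :: int) \<otimes> v = v \<otimes> u [^] n \<otimes> w [^] n"
proof -
  have "(\<lambda>x. inv v \<otimes> x \<otimes> v) \<in> hom G G"
  proof (rule homI)
    fix x y assume "x \<in> carrier G" "y \<in> carrier G"
    moreover from this have "v \<otimes> (inv v \<otimes> (y \<otimes> v)) = y \<otimes> v"
      using G by (simp add: m_assoc[symmetric])
    ultimately show "inv v \<otimes> (x \<otimes> y) \<otimes> v = inv v \<otimes> x \<otimes> v \<otimes> (inv v \<otimes> y \<otimes> v)"
      using G by (simp add: m_assoc)
  qed (use G in simp)
  from hom_int_pow[OF this G(1) is_group is_group, of n]
  have "inv v \<otimes> u [^] n \<otimes> v = (inv v \<otimes> u \<otimes> v) [^] n" .
  also have "inv v \<otimes> u \<otimes> v = u \<otimes> w"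
    using G uv by (simp add: m_assoc inv_solve_left')
  also have "(u \<otimes> w) [^] n = u [^] n \<otimes> w [^] n" by (rule int_pow_mult_distrib[OF uw G(1,3)])
  finally have "inv v \<otimes> (u [^] n \<otimes> v) = u [^] n \<otimes> w [^] n" using G by (simp add: m_assoc)
  then have "u [^] n \<otimes> v = v \<otimes> (u [^] n \<otimes> w [^] n)" using G by (simp add: inv_solve_left')
  then show ?thesis using G by (simp add: m_assoc)
qed

lemma int_pow_commute:
  assumes "u \<in> carrier G" "v \<in> carrier G" "u \<otimes> v = v \<otimes> u"
  shows "u [^] (n :: int) \<otimes> v = v \<otimes> u [^] n"
  using int_pow_swap[of u v "\<one>" n] assms by simp

lemma int_pow_commutator:
  assumes G: "a \<in> carrier G" "b \<in> carrier G" "c \<in> carrier G"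
    and ab: "a \<otimes> b = b \<otimes> a \<otimes> c" and ac: "a \<otimes> c = c \<otimes> a" and bc: "b \<otimes> c = c \<otimes> b"
  shows "a [^] (m :: int) \<otimes> b [^] (n :: int) = b [^] n \<otimes> a [^] m \<otimes> c [^] (m * n)"
proof -
  let ?u = "a [^] m" and ?w = "c [^] (- m)"
  have w: "?w = inv (c [^] m)" using G by (simp add: int_pow_neg)
  have "?u \<otimes> b = b \<otimes> ?u \<otimes> c [^] m" by (rule int_pow_swap[OF G ab ac])
  \<comment> \<open>Rewritten so that the swap applies again with the roles of the two factors
    exchanged; this inverts the central factor.\<close>
  then have bu: "b \<otimes> ?u = ?u \<otimes> b \<otimes> ?w"
    unfolding w using G by (subst inv_solve_right) simp_all
  have "b \<otimes> ?w = ?w \<otimes> b" using int_pow_commute[of c b "- m"] G bc by simp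
  from int_pow_swap[OF _ _ _ bu this, of n]
  have "b [^] n \<otimes> ?u = ?u \<otimes> b [^] n \<otimes> ?w [^] n" using G by simp
  also have "?w [^] n = inv (c [^] (m * n))" using G by (simp add: int_pow_pow flip: int_pow_neg)
  finally show ?thesis using G by (subst (asm) inv_solve_right) simp_all
qed

lemma hom_from_heis_int:
  assumes G: "a \<in> carrier G" "b \<in> carrier G"
    and c: "c = commutator G a b" and ac: "c \<otimes> a = a \<otimes> c" and bc: "c \<otimes> b = b \<otimes> c"
  obtains h where "h \<in> hom heis_int G" "h (1, 0, 0) = a" "h (0, 1, 0) = b"
proof
  have C: "c \<in> carrier G" unfolding c commutator_def using G by simp
  have "a \<otimes> b = c \<otimes> (b \<otimes> a)"
    unfolding c commutator_def using G by (simp add: m_assoc inv_solve_left')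
  then have ab: "a \<otimes> b = b \<otimes> a \<otimes> c"
    using G C ac bc by (metis m_assoc)
  \<comment> \<open>With b before a the matrix (x, y, z) needs no correction in the exponent of c;
    with a first it would be z - x y.\<close>
  let ?h = "\<lambda>(x, y, z). b [^] y \<otimes> a [^] x \<otimes> c [^] z"
  show "?h \<in> hom heis_int G"
  proof (rule homI)
    fix g g' :: "int \<times> int \<times> int"
    obtain x y z x' y' z' where g: "g = (x, y, z)" "g' = (x', y', z')" by (cases g, cases g')
    have cz: "c [^] i \<otimes> b [^] j = b [^] j \<otimes> c [^] i" "c [^] i \<otimes> a [^] j = a [^] j \<otimes> c [^] i" for i j :: int
      using int_pow_commutator[of c b "\<one>" i j] int_pow_commutator[of c a "\<one>" i j] G C ac bc by simp_all
    have "?h (g \<otimes>\<^bsub>heis_int\<^esub> g') = b [^] y \<otimes> b [^] y' \<otimes> (a [^] x \<otimes> a [^] x') \<otimes> (c [^] z \<otimes> c [^] z' \<otimes> c [^] (x * y'))"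
      using G C by (simp add: g int_pow_mult)
    also have "\<dots> = b [^] y \<otimes> (b [^] y' \<otimes> a [^] x \<otimes> c [^] (x * y')) \<otimes> a [^] x' \<otimes> c [^] z \<otimes> c [^] z'"
    proof -
      have "c [^] (x * y') \<otimes> (a [^] x' \<otimes> (c [^] z \<otimes> c [^] z')) = a [^] x' \<otimes> (c [^] z \<otimes> (c [^] z' \<otimes> c [^] (x * y')))"
        using G C cz(2)[of "x * y'" x'] by (simp add: m_assoc[symmetric] int_pow_mult[symmetric] add_ac) (simp add: m_assoc int_pow_mult[symmetric] add_ac)
      then show ?thesis using G C by (simp add: m_assoc)
    qed
    also have "\<dots> = b [^] y \<otimes> (a [^] x \<otimes> b [^] y') \<otimes> a [^] x' \<otimes> c [^] z \<otimes> c [^] z'"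
      unfolding int_pow_commutator[OF G C ab ac[symmetric] bc[symmetric]] ..
    also have "\<dots> = b [^] y \<otimes> a [^] x \<otimes> (b [^] y' \<otimes> a [^] x' \<otimes> c [^] z) \<otimes> c [^] z'"
      using G C by (simp add: m_assoc)
    also have "b [^] y' \<otimes> a [^] x' \<otimes> c [^] z = c [^] z \<otimes> (b [^] y' \<otimes> a [^] x')"
      using G C cz[of z] by (metis m_assoc int_pow_closed)
    also have "b [^] y \<otimes> a [^] x \<otimes> (c [^] z \<otimes> (b [^] y' \<otimes> a [^] x')) \<otimes> c [^] z' = ?h g \<otimes> ?h g'"
      using G C by (simp add: g m_assoc)
    finally show "?h (g \<otimes>\<^bsub>heis_int\<^esub> g') = ?h g \<otimes> ?h g'" .
  qed (use G C in auto)
qed (use G c in \<open>simp_all add: commutator_def\<close>)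

end

section \<open>Words, their values and substitution of constants\<close>

definition word_inv :: "'x word \<Rightarrow> 'x word" where
  "word_inv w = rev (map (\<lambda>(x, e). (x, \<not> e)) w)"

definition word_comm :: "'x word \<Rightarrow> 'x word \<Rightarrow> 'x word" where
  "word_comm u w = u @ w @ word_inv u @ word_inv w"

definition word_subst :: "('x \<Rightarrow> 'y word) \<Rightarrow> 'x word \<Rightarrow> 'y word" where
  "word_subst f w = concat (map (\<lambda>(x, e). if e then f x else word_inv (f x)) w)"

lemma word_inv_simps [simp]:
  "word_inv [] = []" "word_inv (l # w) = word_inv w @ [(fst l, \<not> snd l)]"
  by (simp_all add: word_inv_def split: prod.split)

lemma fst_set_word_inv [simp]: "fst ` set (word_inv w) = fst ` set w"
  by (induction w) auto

lemma word_subst_simps [simp]: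
  "word_subst f [] = []"
  "word_subst f (l # w) = (if snd l then f (fst l) else word_inv (f (fst l))) @ word_subst f w"
  "word_subst f (u @ w) = word_subst f u @ word_subst f w"
  by (simp_all add: word_subst_def split: prod.split)

context group
begin

lemma word_value_closed: "v ` fst ` set w \<subseteq> carrier G \<Longrightarrow> word_value G v w \<in> carrier G"
  by (induction w) auto

lemma word_value_append:
  "v ` fst ` set (u @ w) \<subseteq> carrier G \<Longrightarrow>
    word_value G v (u @ w) = word_value G v u \<otimes> word_value G v w"
proof (induction u)
  case Nil
  then show ?case by (simp add: word_value_closed)
next
  case (Cons l u)
  then have "v (fst l) \<in> carrier G" "word_value G v u \<in> carrier G" "word_value G v w \<in> carrier G"
    using word_value_closed[of v u] word_value_closed[of v w] by (simp_all add: image_Un)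
  with Cons show ?case by (simp add: m_assoc)
qed

lemma word_value_inv:
  "v ` fst ` set w \<subseteq> carrier G \<Longrightarrow> word_value G v (word_inv w) = inv (word_value G v w)"
proof (induction w)
  case (Cons l w)
  then have "v ` fst ` set (word_inv w @ [(fst l, \<not> snd l)]) \<subseteq> carrier G"
    by (simp add: image_Un)
  from word_value_append[OF this] Cons show ?case
    by (simp add: inv_mult_group word_value_closed)
qed simp

lemma word_value_comm:
  assumes "v ` fst ` set (u @ w) \<subseteq> carrier G"
  shows "word_value G v (word_comm u w) = commutator G (word_value G v u) (word_value G v w)"
proof -
  have *: "v ` fst ` set u \<subseteq> carrier G" "v ` fst ` set w \<subseteq> carrier G"
    "v ` fst ` set (word_inv u) \<subseteq> carrier G" "v ` fst ` set (word_inv w) \<subseteq> carrier G"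
    using assms by (simp_all add: image_Un)
  then show ?thesis
    by (simp add: word_comm_def commutator_def word_value_append image_Un word_value_inv word_value_closed m_assoc)
qed

lemma word_value_subst:
  "\<forall>x\<in>fst ` set w. v ` fst ` set (f x) \<subseteq> carrier G \<Longrightarrow>
    word_value G v (word_subst f w) = word_value G (\<lambda>x. word_value G v (f x)) w \<and>
    v ` fst ` set (word_subst f w) \<subseteq> carrier G"
proof (induction w)
  case (Cons l w)
  let ?l = "if snd l then f (fst l) else word_inv (f (fst l))"
  have l: "v ` fst ` set ?l \<subseteq> carrier G" using Cons.prems by simp
  have w: "v ` fst ` set (word_subst f w) \<subseteq> carrier G"
    and IH: "word_value G v (word_subst f w) = word_value G (\<lambda>x. word_value G v (f x)) w"
    using Cons by simp_all
  have lw: "v ` fst ` set (?l @ word_subst f w) \<subseteq> carrier G" using l w by (simp only: set_append image_Un Un_subset_iff)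
  have "word_value G v (?l @ word_subst f w) = word_value G v ?l \<otimes> word_value G (\<lambda>x. word_value G v (f x)) w"
    using word_value_append[OF lw] IH by simp
  with lw show ?case using Cons.prems by (simp add: word_value_inv)
qed simp

lemma generate_word:
  assumes "set gs \<subseteq> carrier G" "x \<in> generate G (set gs)"
  shows "\<exists>w. fst ` set w \<subseteq> {..<length gs} \<and> word_value G ((!) gs) w = x"
  using assms(2)
proof (induction rule: generate.induct)
  case one
  show ?case by (intro exI[of _ "[]"]) simp
next
  case (incl h)
  then obtain i where "i < length gs" "h = gs ! i" by (auto simp: in_set_conv_nth)
  moreover have "h \<in> carrier G" using incl assms(1) by blast
  ultimately show ?case by (intro exI[of _ "[(i, True)]"]) simp
next
  case (inv h)
  then obtain i where "i < length gs" "h = gs ! i" by (auto simp: in_set_conv_nth)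
  moreover have "h \<in> carrier G" using inv assms(1) by blast
  ultimately show ?case by (intro exI[of _ "[(i, False)]"]) simp
next
  case (eng h1 h2)
  then obtain u w where "fst ` set u \<subseteq> {..<length gs}" "word_value G ((!) gs) u = h1"
    "fst ` set w \<subseteq> {..<length gs}" "word_value G ((!) gs) w = h2" by blast
  moreover from this have "(!) gs ` fst ` set (u @ w) \<subseteq> carrier G"
    using assms(1) by (force simp: image_Un)
  ultimately show ?case
    using word_value_append[of "(!) gs" u w] by (intro exI[of _ "u @ w"]) (simp add: image_Un)
qed

end

lemma word_value_cong: "(\<And>x. x \<in> fst ` set w \<Longrightarrow> v x = v' x) \<Longrightarrow> word_value G v w = word_value G v' w"
  by (induction w) auto

lemma (in group_hom) word_value_hom:
  "v ` fst ` set w \<subseteq> carrier G \<Longrightarrow> h (word_value G v w) = word_value H (h \<circ> v) w"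
  by (induction w) (auto simp: G.word_value_closed)

lemma word_value_map: "word_value G v (map (\<lambda>(x, e). (f x, e)) w) = word_value G (v \<circ> f) w"
  by (induction w) (auto split: prod.split)

text \<open>The bound on generator indices matters: beyond the list, \<open>gs ! i\<close> is
  unspecified and need not be compatible with h.\<close>

lemma (in group_hom) solvable_system_hom:
  assumes "set gs \<subseteq> carrier G" "S \<in> systems (length gs)" "solvable_system G gs S"
  shows "solvable_system H (map h gs) S"
proof -
  obtain \<sigma> where \<sigma>: "\<And>j. \<sigma> j \<in> carrier G"
    and S: "\<And>w. w \<in> set S \<Longrightarrow> word_value G (case_sum ((!) gs) \<sigma>) w = \<one>\<^bsub>G\<^esub>"
    using assms(3) unfolding solvable_system_def by auto
  have "word_value H (case_sum ((!) (map h gs)) (h \<circ> \<sigma>)) w = \<one>\<^bsub>H\<^esub>" if w: "w \<in> set S" for w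
  proof -
    have len: "i < length gs" if "Inl i \<in> fst ` set w" for i
      using assms(2) w that unfolding systems_def by fastforce
    have "case_sum ((!) gs) \<sigma> ` fst ` set w \<subseteq> carrier G"
    proof
      fix y assume "y \<in> case_sum ((!) gs) \<sigma> ` fst ` set w"
      then obtain x where x: "x \<in> fst ` set w" "y = case_sum ((!) gs) \<sigma> x" by blast
      then show "y \<in> carrier G"
        using len assms(1) \<sigma> by (cases x) (auto simp: subset_iff)
    qed
    from word_value_hom[OF this] have 1: "word_value H (h \<circ> case_sum ((!) gs) \<sigma>) w = \<one>\<^bsub>H\<^esub>"
      using S[OF w] by simp
    have eq: "(h \<circ> case_sum ((!) gs) \<sigma>) x = case_sum ((!) (map h gs)) (h \<circ> \<sigma>) x"
      if "x \<in> fst ` set w" for x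
      using that len by (cases x) auto
    have "word_value H (h \<circ> case_sum ((!) gs) \<sigma>) w = word_value H (case_sum ((!) (map h gs)) (h \<circ> \<sigma>)) w"
      by (rule word_value_cong) (rule eq)
    with 1 show ?thesis by (simp only:)
  qed
  then show ?thesis unfolding solvable_system_def using \<sigma> by (intro exI[of _ "h \<circ> \<sigma>"]) auto
qed

text \<open>The integer variable \<open>k\<close> is represented by the group variables \<open>2 * k\<close> and \<open>2 * k + 1\<close>,
  whose values commute with \<open>a\<close> and \<open>b\<close> and hence have the same commutators as \<open>a\<^sup>n\<close> and \<open>b\<^sup>n\<close>;
  the third equation forces the same exponent \<open>n\<close> for both.\<close>

abbreviation a_word :: equation where "a_word \<equiv> [(Inl 0, True)]"
abbreviation b_word :: equation where "b_word \<equiv> [(Inl 1, True)]"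
abbreviation x_word :: "nat \<Rightarrow> equation" where "x_word k \<equiv> [(Inr (2 * k), True)]"
abbreviation y_word :: "nat \<Rightarrow> equation" where "y_word k \<equiv> [(Inr (2 * k + 1), True)]"

definition var_equations :: "nat \<Rightarrow> equation list" where
  "var_equations k = [word_comm (x_word k) a_word, word_comm (y_word k) b_word,
     word_comm (x_word k) b_word @ word_comm (y_word k) a_word]"

text \<open>Commutators are central in the matrix group, so multiplying them adds exponents of
  [a, b]. A commutator with exchanged entries is inverse and brings the right-hand side
  over.\<close>

primrec atom_equation :: "nat atom \<Rightarrow> equation" where
  "atom_equation (Is_One i) = word_comm (x_word i) b_word @ word_comm b_word a_word"
| "atom_equation (Is_Sum i j k) =
     word_comm (x_word i) b_word @ word_comm (x_word j) b_word @ word_comm b_word (x_word k)"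
| "atom_equation (Is_Prod i j k) = word_comm (x_word i) (y_word j) @ word_comm b_word (x_word k)"

text \<open>Group variable 0, which belongs to integer variable 0, is set to a^n. Writing n in unary
  makes the code of the equation an n-fold iterate.\<close>

definition input_equation :: "nat \<Rightarrow> equation" where
  "input_equation n = replicate n (Inl 0, True) @ [(Inr 0, False)]"

definition atom_system :: "nat list \<Rightarrow> nat atom list \<Rightarrow> equation list" where
  "atom_system ks E = concat (map var_equations ks) @ map atom_equation E"

lemma systems_iff: "S \<in> systems k \<longleftrightarrow> (\<forall>w\<in>set S. \<forall>i. Inl i \<in> fst ` set w \<longrightarrow> i < k)"
  unfolding systems_def by force

lemma systems_input_atom_system: "input_equation n # atom_system ks E \<in> systems 2"
proof -
  have input: "i < 2" if "Inl i \<in> fst ` set (input_equation n)" for i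
    using that by (auto simp: input_equation_def)
  have var: "i < 2" if "w \<in> set (var_equations k)" "Inl i \<in> fst ` set w" for i k w
    using that by (auto simp: var_equations_def word_comm_def)
  have "i < 2" if "Inl i \<in> fst ` set (atom_equation A)" for i A
    using that by (cases A) (auto simp: word_comm_def)
  note atom = this
  show ?thesis
    unfolding systems_iff
  proof (intro ballI allI impI)
    fix w i assume w: "w \<in> set (input_equation n # atom_system ks E)" and i: "Inl i \<in> fst ` set w"
    from w consider "w = input_equation n" | k where "w \<in> set (var_equations k)"
      | A where "w = atom_equation A"
      unfolding atom_system_def by auto
    then show "i < 2"
    proof cases
      case 1
      then show ?thesis using i input by (simp only:)
    next
      case 2
      then show ?thesis using i by (rule var)
    next
      case 3
      then show ?thesis using i atom by (simp only:)
    qed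
  qed
qed

lemma heis_word_value_append:
  "word_value heis_int v (u @ w) = word_value heis_int v u \<otimes>\<^bsub>heis_int\<^esub> word_value heis_int v w"
  by (rule group.word_value_append[OF group_heis_int]) simp

lemma heis_word_value_comm:
  "word_value heis_int v (word_comm u w) = commutator heis_int (word_value heis_int v u) (word_value heis_int v w)"
  by (rule group.word_value_comm[OF group_heis_int]) simp

lemma heis_word_value_letter: "word_value heis_int v [(x, True)] = v x"
  by (cases "v x") simp

lemma heis_input_equation:
  "word_value heis_int (case_sum ((!) [(1, 0, 0), (0, 1, 0)]) \<sigma>) (input_equation n) = (0, 0, 0)
    \<longleftrightarrow> \<sigma> 0 = (int n, 0, 0)"
proof -
  let ?v = "case_sum ((!) [(1, 0, 0), (0, 1, 0)]) \<sigma>"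
  have "word_value heis_int ?v (replicate n (Inl 0, True)) = (int n, 0, 0)"
    by (induction n) simp_all
  then show ?thesis
    unfolding input_equation_def heis_word_value_append by (cases "\<sigma> 0") auto
qed

lemma heis_var_equations:
  "(\<forall>w\<in>set (var_equations k). word_value heis_int (case_sum ((!) [(1, 0, 0), (0, 1, 0)]) \<sigma>) w = (0, 0, 0))
    \<longleftrightarrow> (\<exists>n z z'. \<sigma> (2 * k) = (n, 0, z) \<and> \<sigma> (2 * k + 1) = (0, n, z'))"
  by (cases "\<sigma> (2 * k)"; cases "\<sigma> (2 * k + 1)")
    (auto simp: var_equations_def heis_word_value_append heis_word_value_comm heis_word_value_letter
      simp del: word_value.simps)

lemma heis_atom_equation:
  assumes "\<And>k. k \<in> set_atom A \<Longrightarrow> \<exists>z z'. \<sigma> (2 * k) = (u k, 0, z) \<and> \<sigma> (2 * k + 1) = (0, u k, z')"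
  shows "word_value heis_int (case_sum ((!) [(1, 0, 0), (0, 1, 0)]) \<sigma>) (atom_equation A) = (0, 0, 0)
    \<longleftrightarrow> holds u A"
proof (cases A)
  case (Is_One i)
  then obtain z z' where "\<sigma> (2 * i) = (u i, 0, z)" using assms by fastforce
  then show ?thesis using Is_One
    by (auto simp: heis_word_value_append heis_word_value_comm heis_word_value_letter simp del: word_value.simps)
next
  case (Is_Sum i j k)
  then obtain z z' z'' where "\<sigma> (2 * i) = (u i, 0, z)" "\<sigma> (2 * j) = (u j, 0, z')" "\<sigma> (2 * k) = (u k, 0, z'')"
    using assms by fastforce
  then show ?thesis using Is_Sum
    by (auto simp: heis_word_value_append heis_word_value_comm heis_word_value_letter simp del: word_value.simps)
next
  case (Is_Prod i j k)
  then obtain z z' z'' where "\<sigma> (2 * i) = (u i, 0, z)" "\<sigma> (2 * j + 1) = (0, u j, z')" "\<sigma> (2 * k) = (u k, 0, z'')"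
    using assms by fastforce
  then show ?thesis using Is_Prod
    by (auto simp: heis_word_value_append heis_word_value_comm heis_word_value_letter simp del: word_value.simps)
qed

lemma solvable_atom_system:
  assumes ks: "0 \<in> set ks" "\<And>A. A \<in> set E \<Longrightarrow> set_atom A \<subseteq> set ks"
  shows "solvable_system heis_int [(1, 0, 0), (0, 1, 0)] (input_equation n # atom_system ks E)
    \<longleftrightarrow> (\<exists>u. u 0 = int n \<and> (\<forall>A\<in>set E. holds u A))"
proof -
  let ?v = "\<lambda>\<sigma>. case_sum ((!) [(1, 0, 0), (0, 1, 0)]) \<sigma>"
  let ?var = "\<lambda>\<sigma> u k. \<exists>z z'. \<sigma> (2 * k) = (u, 0 :: int, z :: int) \<and> \<sigma> (2 * k + 1) = (0 :: int, u :: int, z' :: int)"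
  have "solvable_system heis_int [(1, 0, 0), (0, 1, 0)] (input_equation n # atom_system ks E) \<longleftrightarrow>
    (\<exists>\<sigma>. \<sigma> 0 = (int n, 0, 0) \<and> (\<forall>k\<in>set ks. \<exists>u. ?var \<sigma> u k)
      \<and> (\<forall>A\<in>set E. word_value heis_int (?v \<sigma>) (atom_equation A) = (0, 0, 0)))"
    unfolding solvable_system_def atom_system_def
    by (simp add: heis_input_equation ball_Un ball_UN heis_var_equations)
  also have "\<dots> \<longleftrightarrow> (\<exists>u. u 0 = int n \<and> (\<forall>A\<in>set E. holds u A))"
  proof
    assume "\<exists>\<sigma>. \<sigma> 0 = (int n, 0, 0) \<and> (\<forall>k\<in>set ks. \<exists>u. ?var \<sigma> u k)
      \<and> (\<forall>A\<in>set E. word_value heis_int (?v \<sigma>) (atom_equation A) = (0, 0, 0))"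
    then obtain \<sigma> where \<sigma>: "\<sigma> 0 = (int n, 0, 0)" "\<forall>k\<in>set ks. \<exists>u. ?var \<sigma> u k"
      "\<forall>A\<in>set E. word_value heis_int (?v \<sigma>) (atom_equation A) = (0, 0, 0)" by blast
    define u where "u k = fst (\<sigma> (2 * k))" for k
    have "?var \<sigma> (u k) k" if "k \<in> set ks" for k
      using \<sigma>(2) that unfolding u_def by fastforce
    then have "\<forall>A\<in>set E. holds u A"
      using \<sigma>(3) heis_atom_equation[of _ \<sigma> u] ks(2) by blast
    moreover have "u 0 = int n" using \<sigma>(1) by (simp add: u_def)
    ultimately show "\<exists>u. u 0 = int n \<and> (\<forall>A\<in>set E. holds u A)" by blast
  next
    assume "\<exists>u. u 0 = int n \<and> (\<forall>A\<in>set E. holds u A)"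
    then obtain u where u: "u 0 = int n" "\<forall>A\<in>set E. holds u A" by blast
    define \<sigma> :: "nat \<Rightarrow> int \<times> int \<times> int" where "\<sigma> i = (if even i then (u (i div 2), 0, 0) else (0, u (i div 2), 0))" for i
    have var: "?var \<sigma> (u k) k" for k by (simp add: \<sigma>_def)
    then have "\<forall>A\<in>set E. word_value heis_int (?v \<sigma>) (atom_equation A) = (0, 0, 0)"
      using u(2) heis_atom_equation[of _ \<sigma> u] by blast
    moreover have "\<forall>k\<in>set ks. \<exists>u. ?var \<sigma> u k"
    proof
      fix k
      show "\<exists>u. ?var \<sigma> u k" using var[of k] by (rule exI[of _ "u k"])
    qed
    moreover have "\<sigma> 0 = (int n, 0, 0)" by (simp add: \<sigma>_def u(1))
    ultimately show "\<exists>\<sigma>. \<sigma> 0 = (int n, 0, 0) \<and> (\<forall>k\<in>set ks. \<exists>u. ?var \<sigma> u k)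
      \<and> (\<forall>A\<in>set E. word_value heis_int (?v \<sigma>) (atom_equation A) = (0, 0, 0))"
      by (intro exI[of _ \<sigma>] conjI)
  qed
  finally show ?thesis .
qed

lemma dioph_imp_solvable_system:
  fixes R :: "(nat \<Rightarrow> nat) \<Rightarrow> bool"
  assumes "dioph R"
  obtains ks E where "\<And>n. R (\<lambda>_. n) \<longleftrightarrow>
    solvable_system heis_int [(1, 0, 0), (0, 1, 0)] (input_equation n # atom_system ks E)"
proof -
  obtain E :: "(nat + nat) atom list" where
    E: "\<And>n. R (\<lambda>_. n) \<longleftrightarrow> (\<exists>u. \<forall>A\<in>set E. holds (case_sum (\<lambda>_. int n) u) A)"
    using assms by (rule dioph_nat_to_int) (rule that)
  \<comment> \<open>All parameters share variable 0, which the input equation sets; the witnesses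
    move up by one.\<close>
  define p :: "nat + nat \<Rightarrow> nat" where "p = case_sum (\<lambda>_. 0) Suc"
  define E' where "E' = map (map_atom p) E"
  have "finite (insert 0 (\<Union>A\<in>set E'. set_atom A))" by (simp add: finite_set_atom)
  then obtain ks where ks: "set ks = insert 0 (\<Union>A\<in>set E'. set_atom A)"
    using finite_list by blast
  have "(\<exists>u. \<forall>A\<in>set E. holds (case_sum (\<lambda>_. int n) u) A) \<longleftrightarrow>
    (\<exists>u. u 0 = int n \<and> (\<forall>A\<in>set E'. holds u A))" for n
  proof
    assume "\<exists>u. \<forall>A\<in>set E. holds (case_sum (\<lambda>_. int n) u) A"
    then obtain u where u: "\<forall>A\<in>set E. holds (case_sum (\<lambda>_. int n) u) A" by blast
    have "case_nat (int n) u \<circ> p = case_sum (\<lambda>_. int n) u"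
      by (auto simp: fun_eq_iff p_def split: sum.split)
    with u show "\<exists>u. u 0 = int n \<and> (\<forall>A\<in>set E'. holds u A)"
      by (intro exI[of _ "case_nat (int n) u"]) (simp add: E'_def holds_map_atom)
  next
    assume "\<exists>u. u 0 = int n \<and> (\<forall>A\<in>set E'. holds u A)"
    then obtain u where u: "u 0 = int n" "\<forall>A\<in>set E'. holds u A" by blast
    have "u \<circ> p = case_sum (\<lambda>_. int n) (\<lambda>i. u (Suc i))"
      using u(1) by (auto simp: fun_eq_iff p_def split: sum.split)
    with u(2) show "\<exists>u. \<forall>A\<in>set E. holds (case_sum (\<lambda>_. int n) u) A"
      by (intro exI[of _ "\<lambda>i. u (Suc i)"]) (simp add: E'_def holds_map_atom)
  qed
  note eq = this
  have "solvable_system heis_int [(1, 0, 0), (0, 1, 0)] (input_equation n # atom_system ks E')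
    \<longleftrightarrow> (\<exists>u. u 0 = int n \<and> (\<forall>A\<in>set E'. holds u A))" for n
    by (rule solvable_atom_system) (use ks in auto)
  then show thesis by (intro that[of ks E']) (simp only: E eq)
qed

section \<open>Undecidability\<close>

lemma list_encode_append_letters:
  "list_encode (map letter_code (u @ w)) =
    foldr (\<lambda>l y. Suc (prod_encode (letter_code l, y))) u (list_encode (map letter_code w))"
  by (induction u) simp_all

lemma dfun_foldr_prod_encode: "dfun (\<lambda>v. foldr (\<lambda>l y. Suc (prod_encode (letter_code l, y))) u (v 0))"
proof (induction u)
  case Nil
  show ?case by (simp add: dfun_var)
next
  case (Cons l u)
  then show ?case unfolding foldr.simps o_apply by (intro dfun_Suc dfun_prod_encode dfun_const)
qed

text \<open>\<open>G v\<close> is the code of the equations that follow the first one; the block u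
  will be the word for a.\<close>

lemma dfun_system_code:
  assumes "dfun F" "dfun G"
  shows "dfun (\<lambda>v. Suc (prod_encode (list_encode (map letter_code (concat (replicate (F v) u) @ w)), G v)))"
proof -
  let ?h = "\<lambda>y. foldr (\<lambda>l y. Suc (prod_encode (letter_code l, y))) u y"
  let ?c = "list_encode (map letter_code w)"
  have eq: "list_encode (map letter_code (concat (replicate n u) @ w)) = (?h ^^ n) ?c" for n
  proof (induction n)
    case (Suc n)
    show ?case
      unfolding replicate_Suc concat.simps append_assoc list_encode_append_letters[of u] Suc
      by (simp only: funpow.simps o_apply)
  qed simp
  have "dfun (\<lambda>v. (?h ^^ F v) ?c)"
    by (rule dfun_subst1[OF dfun_funpow[OF dfun_foldr_prod_encode] assms(1)])
  then show ?thesis unfolding eq by (intro dfun_Suc dfun_prod_encode assms(2))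
qed

text \<open>The generating list is arbitrary and need not contain a and b, so each constant is
  replaced by a word in the given generators. Variables are kept.\<close>

lemma (in group) solvable_system_subst:
  assumes S: "S \<in> systems 2" and gs: "set gs \<subseteq> carrier G"
    and W: "\<And>i. i < 2 \<Longrightarrow> fst ` set (W i) \<subseteq> {..<length gs}"
    and ab: "word_value G ((!) gs) (W 0) = a" "word_value G ((!) gs) (W 1) = b"
    and f: "\<And>i. f (Inl i) = map (\<lambda>(x, e). (Inl x, e)) (W i)" "\<And>j. f (Inr j) = [(Inr j, True)]"
  shows "solvable_system G gs (map (word_subst f) S) \<longleftrightarrow> solvable_system G [a, b] S"
    and "map (word_subst f) S \<in> systems (length gs)"
proof -
  have eq: "word_value G (case_sum ((!) gs) \<sigma>) (word_subst f w) = word_value G (case_sum ((!) [a, b]) \<sigma>) w"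
    if \<sigma>: "\<And>j. \<sigma> j \<in> carrier G" and w: "w \<in> set S" for \<sigma> :: "nat \<Rightarrow> 'a" and w
  proof -
    let ?v = "case_sum ((!) gs) \<sigma>"
    have i: "i < 2" if "Inl i \<in> fst ` set w" for i using S w that unfolding systems_iff by blast
    have c: "?v ` fst ` set (f x) \<subseteq> carrier G" if "x \<in> fst ` set w" for x
    proof (cases x)
      case (Inl j)
      then show ?thesis using W[OF i, of j] that gs by (force simp: f)
    qed (simp add: f \<sigma>)
    have "word_value G ?v (f x) = case_sum ((!) [a, b]) \<sigma> x" if "x \<in> fst ` set w" for x
    proof (cases x)
      case (Inl j)
      have "?v \<circ> Inl = (!) gs" by auto
      moreover from Inl that have "j < 2" using i by blast
      then have "j = 0 \<or> j = 1" by linarith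
      ultimately show ?thesis using Inl ab by (auto simp: f word_value_map)
    qed (simp add: f \<sigma>)
    with word_value_subst[of w ?v f] c show ?thesis
      using word_value_cong[of w "\<lambda>x. word_value G ?v (f x)" "case_sum ((!) [a, b]) \<sigma>"] by simp
  qed
  show "solvable_system G gs (map (word_subst f) S) \<longleftrightarrow> solvable_system G [a, b] S"
    unfolding solvable_system_def using eq by (intro iff_exI) auto
  have *: "fst ` set (word_subst f w) \<subseteq> (\<Union>x\<in>fst ` set w. fst ` set (f x))" for w
  proof (induction w)
    case (Cons l w)
    have "fst ` set (word_subst f (l # w)) = fst ` set (f (fst l)) \<union> fst ` set (word_subst f w)"
      by (simp add: image_Un)
    with Cons show ?case by auto
  qed simp
  show "map (word_subst f) S \<in> systems (length gs)"
    unfolding systems_iff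
  proof (intro ballI allI impI)
    fix w i assume "w \<in> set (map (word_subst f) S)" "Inl i \<in> fst ` set w"
    then obtain u where u: "u \<in> set S" "Inl i \<in> fst ` set (word_subst f u)" by auto
    then obtain x where x: "x \<in> fst ` set u" "Inl i \<in> fst ` set (f x)" using * by blast
    then show "i < length gs"
    proof (cases x)
      case (Inl j)
      then have "j < 2" using S u(1) x(1) unfolding systems_iff by blast
      then show ?thesis using W x(2) Inl by (force simp: f)
    qed (simp add: f)
  qed
qed

text \<open>The diagonal argument. The meaning of systems is computed in \<open>heis_int\<close>,
  their codes refer to G and \<open>gs\<close>; \<open>heis\<close> and \<open>subst\<close> connect
  the two.\<close>

lemma EP_undecidable_of_heis_int:
  assumes G: "group G" and gs: "generating_list G gs"
    and ab: "a \<in> carrier G" "b \<in> carrier G"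
    and h: "h \<in> hom G heis_int" "h a = (1, 0, 0)" "h b = (0, 1, 0)"
    and c: "commutator G a b \<otimes>\<^bsub>G\<^esub> a = a \<otimes>\<^bsub>G\<^esub> commutator G a b"
      "commutator G a b \<otimes>\<^bsub>G\<^esub> b = b \<otimes>\<^bsub>G\<^esub> commutator G a b"
  shows "\<not> EP_decidable G gs"
proof
  interpret G: group G by (rule G)
  assume "EP_decidable G gs"
  then obtain f where f: "\<And>S. S \<in> systems (length gs) \<Longrightarrow>
      computes f [system_code S] (if solvable_system G gs S then 1 else 0)"
    unfolding EP_decidable_def decidable_def by blast
  have gsG: "set gs \<subseteq> carrier G" and gen: "generate G (set gs) = carrier G"
    using gs unfolding generating_list_def by auto
  obtain Wa Wb where Wa: "fst ` set Wa \<subseteq> {..<length gs}" "word_value G ((!) gs) Wa = a"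
    and Wb: "fst ` set Wb \<subseteq> {..<length gs}" "word_value G ((!) gs) Wb = b"
    using G.generate_word[OF gsG] ab unfolding gen by metis
  define W where "W i = (if i = 0 then Wa else Wb)" for i :: nat
  define g where "g = case_sum (\<lambda>i. map (\<lambda>(x, e). (Inl x :: nat + nat, e)) (W i)) (\<lambda>j. [(Inr j, True)])"
  have W: "\<And>i. i < 2 \<Longrightarrow> fst ` set (W i) \<subseteq> {..<length gs}"
    "word_value G ((!) gs) (W 0) = a" "word_value G ((!) gs) (W 1) = b"
    using Wa Wb by (auto simp: W_def)
  have g: "g (Inl i) = map (\<lambda>(x, e). (Inl x, e)) (W i)" "g (Inr j) = [(Inr j, True)]" for i j
    by (simp_all add: g_def)
  note subst = G.solvable_system_subst[OF _ gsG W g]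
  obtain k where k: "k \<in> hom heis_int G" "k (1, 0, 0) = a" "k (0, 1, 0) = b"
    using G.hom_from_heis_int[OF ab refl c] by blast
  have heis: "solvable_system G [a, b] S \<longleftrightarrow> solvable_system heis_int [(1, 0, 0), (0, 1, 0)] S"
    if "S \<in> systems 2" for S
  proof
    assume "solvable_system G [a, b] S"
    moreover have "group_hom G heis_int h"
      using G group_heis_int h(1) by (simp add: group_hom_def group_hom_axioms_def)
    ultimately show "solvable_system heis_int [(1, 0, 0), (0, 1, 0)] S"
      using group_hom.solvable_system_hom[of G heis_int h "[a, b]" S] that ab h by (simp add: numeral_2_eq_2)
  next
    assume "solvable_system heis_int [(1, 0, 0), (0, 1, 0)] S"
    moreover have "group_hom heis_int G k"
      using G group_heis_int k(1) by (simp add: group_hom_def group_hom_axioms_def)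
    ultimately show "solvable_system G [a, b] S"
      using group_hom.solvable_system_hom[of heis_int G k "[(1, 0, 0), (0, 1, 0)]" S] that k
      by (simp add: numeral_2_eq_2)
  qed
  define code where "code n e = Suc (prod_encode (list_encode (map letter_code
    (concat (replicate n (g (Inl 0))) @ [(Inr 0, False)])), e))" for n e
  have "word_subst g (input_equation n) = concat (replicate n (g (Inl 0))) @ [(Inr 0, False)]" for n
  proof -
    have "word_subst g (replicate n (Inl 0, True)) = concat (replicate n (g (Inl 0)))"
      by (induction n) simp_all
    then show ?thesis by (simp add: input_equation_def g_def)
  qed
  then have code: "system_code (word_subst g (input_equation n) # S) = code n (system_code S)" for n S
    by (simp add: system_code_def code_def)
  have "dfun (\<lambda>v. code (v 0) (v 0))"
    unfolding code_def by (intro dfun_system_code dfun_var)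
  \<comment> \<open>Rejection is expressed as the value 0 and not as the absence of acceptance, so
    it is an existential condition.\<close>
  then have "dioph (\<lambda>v. computes f (map (\<lambda>F. F v) [\<lambda>v. code (v 0) (v 0)]) 0)"
    by (intro dioph_computes dfun_0) simp
  then have "dioph (\<lambda>v. computes f [code (v 0) (v 0)] 0)" by simp
  then obtain ks E where E: "\<And>n. computes f [code n n] 0 \<longleftrightarrow>
      solvable_system heis_int [(1, 0, 0), (0, 1, 0)] (input_equation n # atom_system ks E)"
    by (rule dioph_imp_solvable_system) (rule that)
  \<comment> \<open>Only the part that is independent of the input is coded; prepending the input
    equation for e yields code \<open>code e e\<close>.\<close>
  define e where "e = system_code (map (word_subst g) (atom_system ks E))"
  define S where "S = input_equation e # atom_system ks E"
  have S: "S \<in> systems 2" unfolding S_def by (rule systems_input_atom_system)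
  have "system_code (map (word_subst g) S) = code e e" by (simp add: S_def code e_def)
  then have "computes f [code e e] (if solvable_system G gs (map (word_subst g) S) then 1 else 0)"
    using f[OF subst(2)[OF S]] by simp
  moreover have "solvable_system G gs (map (word_subst g) S) \<longleftrightarrow> computes f [code e e] 0"
    using subst(1)[OF S] heis[OF S] E[of e, folded S_def] by simp
  \<comment> \<open>If f answers 0, the system is solvable and f also answers 1, against
    determinism. Otherwise the system is unsolvable and f does answer 0.\<close>
  ultimately show False
    by (cases "computes f [code e e] 0") (auto dest: computes_deterministic)
qed

section \<open>Homomorphisms from free groups and their quotients\<close>

lemma word_value_cancels:
  assumes "group G" "\<And>i. v i \<in> carrier G" "equivclp cancels u w"
  shows "word_value G v u = word_value G v w"
proof -
  interpret group G by fact
  have vG: "v ` Y \<subseteq> carrier G" for Y using assms(2) by blast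
  have *: "word_value G v u = word_value G v w" if "cancels u w" for u w
    using that
  proof cases
    case (1 u' i e w')
    have "v i \<in> carrier G" "word_value G v w' \<in> carrier G"
      using assms(2) by (auto intro: word_value_closed[OF vG])
    then have "word_value G v ([(i, e), (i, \<not> e)] @ w') = word_value G v w'"
      by (cases e) (simp_all add: m_assoc[symmetric])
    then show ?thesis
      unfolding 1 word_value_append[OF vG, of u'] by (simp only:)
  qed
  show ?thesis using assms(3) by (induction rule: equivclp_induct) (auto dest: *)
qed

lemma free_group_hom:
  assumes G: "group G" and v: "\<And>i. v i \<in> carrier G"
  obtains h where "group_hom (free_group q) G h" "\<And>i. i < q \<Longrightarrow> h (free_gen q i) = v i"
proof -
  interpret G: group G by (rule G)
  have vG: "v ` Y \<subseteq> carrier G" for Y using v by blast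
  define h where "h C = the_elem (word_value G v ` C)" for C
  have h: "h (free_rel q `` {u}) = word_value G v u" if "u \<in> words q" for u
  proof -
    have "u \<in> free_rel q `` {u}" using equiv_class_self[OF equiv_free_rel that] .
    moreover have "word_value G v w = word_value G v u" if "w \<in> free_rel q `` {u}" for w
      using that word_value_cancels[OF G v] by (auto simp: free_rel_def)
    ultimately have "word_value G v ` (free_rel q `` {u}) = {word_value G v u}" by blast
    then show ?thesis by (simp add: h_def)
  qed
  have "h \<in> hom (free_group q) G"
  proof (rule homI)
    fix x y assume "x \<in> carrier (free_group q)" "y \<in> carrier (free_group q)"
    then obtain u w where "u \<in> words q" "x = free_rel q `` {u}" "w \<in> words q" "y = free_rel q `` {w}"
      by (elim free_group_carrier_cases)
    then show "h (x \<otimes>\<^bsub>free_group q\<^esub> y) = h x \<otimes>\<^bsub>G\<^esub> h y"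
      by (simp add: h G.word_value_append[OF vG])
  next
    fix x assume "x \<in> carrier (free_group q)"
    then show "h x \<in> carrier G"
      by (elim free_group_carrier_cases) (simp add: h G.word_value_closed[OF vG])
  qed
  then have "group_hom (free_group q) G h"
    using G group_free_group by (simp add: group_hom_def group_hom_axioms_def)
  moreover have "h (free_gen q i) = v i" if "i < q" for i
    using that v by (simp add: free_gen_def h)
  ultimately show thesis by (rule that)
qed

lemma (in group_hom) hom_commutator:
  "x \<in> carrier G \<Longrightarrow> y \<in> carrier G \<Longrightarrow> h (commutator G x y) = commutator H (h x) (h y)"
  by (simp add: commutator_def)

lemma (in group_hom) generate_hom_subset:
  assumes "T \<subseteq> carrier G" "subgroup K H" "h ` T \<subseteq> K"
  shows "h ` generate G T \<subseteq> K"
  using generate_img[OF assms(1)] H.generate_subgroup_incl[OF assms(3,2)] by simp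

lemma (in group) commutator_eq_one_iff:
  "x \<in> carrier G \<Longrightarrow> y \<in> carrier G \<Longrightarrow> commutator G x y = \<one> \<longleftrightarrow> x \<otimes> y = y \<otimes> x"
  by (simp add: commutator_def inv_solve_right')

text \<open>Two opposite demands on N: it dies under every homomorphism to \<open>heis_int\<close>,
  so a map given on generators descends to the quotient; and it is large enough for [a, b] to
  commute with a and b there.\<close>

lemma EP_undecidable_quotient:
  fixes q :: nat
  defines "F \<equiv> free_group q"
  defines "a \<equiv> free_gen q 0" and "b \<equiv> free_gen q 1"
  assumes q: "2 \<le> q" and N: "N \<lhd> F"
    and hN: "\<And>h. group_hom F heis_int h \<Longrightarrow> h ` N \<subseteq> {\<one>\<^bsub>heis_int\<^esub>}"
    and c: "commutator F (commutator F a b) a \<in> N" "commutator F (commutator F a b) b \<in> N"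
    and gs: "generating_list (F Mod N) gs"
  shows "\<not> EP_decidable (F Mod N) gs"
proof -
  interpret N: normal N F by (rule N)
  let ?\<pi> = "\<lambda>x. N #>\<^bsub>F\<^esub> x"
  have Q: "group (F Mod N)" by (rule N.factorgroup_is_group)
  interpret \<pi>: group_hom F "F Mod N" ?\<pi>
    using Q N.group_axioms N.r_coset_hom_Mod by (simp add: group_hom_def group_hom_axioms_def)
  have abF: "a \<in> carrier F" "b \<in> carrier F"
    using q by (simp_all add: a_def b_def F_def free_gen_carrier)
  obtain h where h: "group_hom F heis_int h"
    \<comment> \<open>For q > 2 the generators beyond the second are sent to the same matrix as b;
      only the images of a and b matter.\<close>
    and gen: "\<And>i. i < q \<Longrightarrow> h (free_gen q i) = (if i = 0 then (1, 0, 0) else (0, 1, 0))"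
    by (rule free_group_hom[OF group_heis_int, of "\<lambda>i. if i = 0 then (1, 0, 0) else (0, 1, 0)" q,
        folded F_def]) (simp, rule that)
  have ab: "h a = (1, 0, 0)" "h b = (0, 1, 0)" using q by (simp_all add: a_def b_def gen)
  interpret h: group_hom F heis_int h by (rule h)
  have "N \<subseteq> kernel F heis_int h"
    using hN[OF h.group_hom_axioms] N.subset unfolding kernel_def by blast
  then obtain g where g: "g \<in> hom (F Mod N) heis_int" "\<And>x. x \<in> carrier F \<Longrightarrow> g (?\<pi> x) = h x"
    by (rule h.FactGroup_universal_kernel[OF N]) (rule that)
  have comm: "commutator F x y \<in> carrier F" if "x \<in> carrier F" "y \<in> carrier F" for x y
    using that by (simp add: commutator_def)
  have one: "?\<pi> x = \<one>\<^bsub>F Mod N\<^esub>" if "x \<in> N" for x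
    using N.rcos_const[OF N.is_group that] by (simp add: FactGroup_def)
  have central: "commutator (F Mod N) (?\<pi> a) (?\<pi> b) \<otimes>\<^bsub>F Mod N\<^esub> ?\<pi> x = ?\<pi> x \<otimes>\<^bsub>F Mod N\<^esub> commutator (F Mod N) (?\<pi> a) (?\<pi> b)"
    if "x \<in> carrier F" "commutator F (commutator F a b) x \<in> N" for x
  proof -
    let ?c = "commutator F a b"
    have "?\<pi> ?c \<otimes>\<^bsub>F Mod N\<^esub> ?\<pi> x = ?\<pi> x \<otimes>\<^bsub>F Mod N\<^esub> ?\<pi> ?c"
    proof (rule \<pi>.H.commutator_eq_one_iff[THEN iffD1])
      show "commutator (F Mod N) (?\<pi> ?c) (?\<pi> x) = \<one>\<^bsub>F Mod N\<^esub>"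
        using one[OF that(2)] \<pi>.hom_commutator[OF comm[OF abF] that(1)] by (simp only:)
    qed (use that(1) abF comm in \<open>blast intro: \<pi>.hom_closed\<close>)+
    then show ?thesis by (simp only: \<pi>.hom_commutator abF)
  qed
  show ?thesis
  proof (rule EP_undecidable_of_heis_int[OF Q gs _ _ g(1)])
    show "?\<pi> a \<in> carrier (F Mod N)" "?\<pi> b \<in> carrier (F Mod N)"
      by (rule \<pi>.hom_closed, rule abF)+
    show "g (?\<pi> a) = (1, 0, 0)" "g (?\<pi> b) = (0, 1, 0)"
      using g(2)[OF abF(1)] g(2)[OF abF(2)] ab by (simp_all only:)
  qed (rule central abF c)+
qed

text \<open>Both groups are quotients covered by the preceding lemma: commutators in
  \<open>heis_int\<close> are central, so triple commutators and their conjugates die there. The two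
  cases run in parallel instead of identifying the groups for q = 2.\<close>

theorem theorem4:
  shows "(\<forall>q\<ge>2. \<forall>gs. generating_list (free_nilpotent 2 q) gs
            \<longrightarrow> \<not> EP_decidable (free_nilpotent 2 q) gs) \<and>
         (\<forall>gs. generating_list heisenberg gs \<longrightarrow> \<not> EP_decidable heisenberg gs)"
proof (intro conjI allI impI)
  fix q :: nat and gs
  assume q: "2 \<le> q" and gs: "generating_list (free_nilpotent 2 q) gs"
  let ?F = "free_group q"
  interpret F: group ?F by (rule group_free_group)
  \<comment> \<open>The center of \<open>heis_int\<close>, which contains all its
    commutators.\<close>
  let ?C = "{(0, 0, z) | z :: int. True}"
  have sub: "subgroup ?C heis_int" "subgroup {\<one>\<^bsub>heis_int\<^esub>} heis_int"
    by (auto intro!: subgroup.intro)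
  have L: "lower_central ?F i \<subseteq> carrier ?F" for i
    using normal_imp_subgroup[OF F.lower_central_normal] by (rule subgroup.subset)
  have "h ` lower_central ?F 2 \<subseteq> {\<one>\<^bsub>heis_int\<^esub>}" if "group_hom ?F heis_int h" for h
  proof -
    interpret h: group_hom ?F heis_int h by fact
    have "h ` lower_central ?F 1 \<subseteq> ?C"
      unfolding One_nat_def lower_central.simps
    proof (rule h.generate_hom_subset[OF _ sub(1)])
      have C: "commutator heis_int x y \<in> ?C" for x y by (cases x; cases y) simp
      show "h ` {commutator ?F x y |x y. x \<in> carrier ?F \<and> y \<in> carrier ?F} \<subseteq> ?C"
      proof (rule image_subsetI)
        fix g assume "g \<in> {commutator ?F x y |x y. x \<in> carrier ?F \<and> y \<in> carrier ?F}"
        then obtain x y where "g = commutator ?F x y" "x \<in> carrier ?F" "y \<in> carrier ?F" by blast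
        then show "h g \<in> ?C" using C[of "h x" "h y"] by (simp only: h.hom_commutator)
      qed
    qed (auto simp: commutator_def)
    note hC = this
    have C1: "commutator heis_int x y = \<one>\<^bsub>heis_int\<^esub>" if "x \<in> ?C" for x y
      using that by (cases y) auto
    have h1: "h (commutator ?F x y) = \<one>\<^bsub>heis_int\<^esub>"
      if x: "x \<in> lower_central ?F 1" and y: "y \<in> carrier ?F" for x y
    proof -
      have "h x \<in> ?C" using hC x by (rule subsetD[OF _ imageI])
      from C1[OF this] show ?thesis
        using h.hom_commutator[OF subsetD[OF L x] y] by (simp only:)
    qed
    have "lower_central ?F 2 = generate ?F
        {commutator ?F x y |x y. x \<in> lower_central ?F 1 \<and> y \<in> carrier ?F}"
      unfolding numeral_2_eq_2 One_nat_def by (rule lower_central.simps(2))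
    moreover have "h ` \<dots> \<subseteq> {\<one>\<^bsub>heis_int\<^esub>}"
    proof (rule h.generate_hom_subset[OF _ sub(2)])
      show "{commutator ?F x y |x y. x \<in> lower_central ?F 1 \<and> y \<in> carrier ?F} \<subseteq> carrier ?F"
      proof
        fix g assume "g \<in> {commutator ?F x y |x y. x \<in> lower_central ?F 1 \<and> y \<in> carrier ?F}"
        then obtain x y where "g = commutator ?F x y" "x \<in> lower_central ?F 1" "y \<in> carrier ?F" by blast
        moreover from this have "x \<in> carrier ?F" using L by (elim subsetD[rotated])
        ultimately show "g \<in> carrier ?F" by (simp add: commutator_def)
      qed
      show "h ` {commutator ?F x y |x y. x \<in> lower_central ?F 1 \<and> y \<in> carrier ?F} \<subseteq> {\<one>\<^bsub>heis_int\<^esub>}"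
        using h1 by blast
    qed
    ultimately show ?thesis by (simp only:)
  qed
  moreover have "commutator ?F x y \<in> lower_central ?F (Suc i)" if "x \<in> lower_central ?F i" "y \<in> carrier ?F" for x y i
    unfolding lower_central.simps using that by (blast intro: generate.incl)
  then have "commutator ?F (commutator ?F x y) z \<in> lower_central ?F 2"
    if "x \<in> carrier ?F" "y \<in> carrier ?F" "z \<in> carrier ?F" for x y z
    using that by (metis lower_central.simps(1) numeral_2_eq_2)
  ultimately show "\<not> EP_decidable (free_nilpotent 2 q) gs"
    using gs q unfolding free_nilpotent_def
    by (intro EP_undecidable_quotient F.lower_central_normal) (simp_all add: free_gen_carrier)
next
  fix gs
  assume gs: "generating_list heisenberg gs"
  let ?F = "free_group 2" and ?a = "free_gen 2 0" and ?b = "free_gen 2 1"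
  interpret F: group ?F by (rule group_free_group)
  let ?c = "commutator ?F ?a ?b"
  let ?R = "{commutator ?F ?c ?a, commutator ?F ?c ?b}"
  have ab: "?a \<in> carrier ?F" "?b \<in> carrier ?F" by (simp_all add: free_gen_carrier)
  have comm: "commutator ?F x y \<in> carrier ?F" if "x \<in> carrier ?F" "y \<in> carrier ?F" for x y
    using that by (simp add: commutator_def)
  have R: "?R \<subseteq> carrier ?F" using ab comm by simp
  have "h ` normal_closure ?F ?R \<subseteq> {\<one>\<^bsub>heis_int\<^esub>}" if "group_hom ?F heis_int h" for h
  proof -
    interpret h: group_hom ?F heis_int h by fact
    have "commutator heis_int (commutator heis_int x y) z = \<one>\<^bsub>heis_int\<^esub>" for x y z
      by (cases x; cases y; cases z) simp
    then have "h (commutator ?F (commutator ?F x y) z) = \<one>\<^bsub>heis_int\<^esub>"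
      if "x \<in> carrier ?F" "y \<in> carrier ?F" "z \<in> carrier ?F" for x y z
      by (simp only: h.hom_commutator comm that)
    then have hR: "h r = \<one>\<^bsub>heis_int\<^esub>" if "r \<in> ?R" for r
      using that by (elim insertE emptyE) (simp_all only: ab)
    let ?T = "{g \<otimes>\<^bsub>?F\<^esub> r \<otimes>\<^bsub>?F\<^esub> inv\<^bsub>?F\<^esub> g | g r. g \<in> carrier ?F \<and> r \<in> ?R}"
    have T: "t \<in> carrier ?F \<and> h t = \<one>\<^bsub>heis_int\<^esub>" if tT: "t \<in> ?T" for t
    proof -
      obtain g r where t: "t = g \<otimes>\<^bsub>?F\<^esub> r \<otimes>\<^bsub>?F\<^esub> inv\<^bsub>?F\<^esub> g" and g: "g \<in> carrier ?F" and r: "r \<in> ?R"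
        using tT by blast
      have "r \<in> carrier ?F" using R r by (rule subsetD)
      then show ?thesis using g hR[OF r] by (simp add: t del: heis_int_simps)
    qed
    have "h ` generate ?F ?T \<subseteq> {\<one>\<^bsub>heis_int\<^esub>}"
    proof (rule h.generate_hom_subset)
      show "?T \<subseteq> carrier ?F" "h ` ?T \<subseteq> {\<one>\<^bsub>heis_int\<^esub>}" using T by blast+
      show "subgroup {\<one>\<^bsub>heis_int\<^esub>} heis_int" by (auto intro!: subgroup.intro)
    qed
    then show ?thesis unfolding normal_closure_def .
  qed
  moreover have "r \<in> normal_closure ?F ?R" if "r \<in> ?R" for r
  proof -
    have "r = \<one>\<^bsub>?F\<^esub> \<otimes>\<^bsub>?F\<^esub> r \<otimes>\<^bsub>?F\<^esub> inv\<^bsub>?F\<^esub> \<one>\<^bsub>?F\<^esub>" using R that by auto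
    then show ?thesis unfolding normal_closure_def using that by (blast intro: generate.incl)
  qed
  ultimately show "\<not> EP_decidable heisenberg gs"
    using gs unfolding heisenberg_def Let_def
    by (intro EP_undecidable_quotient F.normal_closure_normal[OF R]) simp_all
qed

end
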